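(* Let $n,m,k_1,k_2$ be positive integers in the large dimensional proportional regime $$\alpha=\lim_{n\to\infty}\frac{m}{n},\qquad \beta_1=\lim_{n\to\infty}\frac{k_1}{n},\qquad \beta_2=\lim_{n\to\infty}\frac{k_2}{n}.$$ Let each element of $\mathbf{h}\in\mathbb{R}^m$ and $\mathbf{g}\in\mathbb{R}^n$ be a standard normal random variable independent of any other randomness, let $A\in\mathbb{R}^{m\times n}$ be comprised of independent standard normal entries, and let $\xi$ be its largest average $k_1\times k_2$ submatrix value. Let $L$, $L^{(2)}$ and $I^{(2)}(c_3,\nu;\beta)$ be as defined in the context. Then $$\lim_{n\to\infty}\sqrt{n}\,L^{(2)}=\frac{1}{\sqrt{\beta_1\beta_2}}\ \min_{c_3>0,\,\nu_1,\,\nu_2}\left(-\frac{c_3}{2}+\frac{\alpha}{c_3}\log\left(I^{(2)}(c_3,\nu_1;\beta_1)\right)+\nu_1\sqrt{\beta_1}+\frac{1}{c_3}\log\left(I^{(2)}(c_3,\nu_2;\beta_2)\right)+\nu_2\sqrt{\beta_2}\right)$$ and $$\lim_{n\to\infty}\mathbb{E}\,\xi\sqrt{n}\ \le\ \lim_{n\to\infty}\mathbb{E}\,L^{(2)}\sqrt{n}\ \le\ \lim_{n\to\infty}\mathbb{E}\,L\sqrt{n}.$$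
   Context: For $A\in\mathbb{R}^{m\times n}$, the largest average $k_1\times k_2$ submatrix value is $$\xi=\frac{1}{k_1k_2}\max_{\substack{I_1\subset\{1,\dots,m\},\ |I_1|=k_1\\ I_2\subset\{1,\dots,n\},\ |I_2|=k_2}}\ \sum_{i\in I_1,\,j\in I_2}A_{ij}.$$ Set $\mathcal{S}_{\mathbf{x}}=\{\mathbf{x}\in\mathbb{R}^n:\ \mathbf{x}_i\in\{0,1/\sqrt{k_2}\}\text{ for all }i,\ \sum_{i=1}^n\mathbf{x}_i=\sqrt{k_2}\}$ and $\mathcal{S}_{\mathbf{y}}=\{\mathbf{y}\in\mathbb{R}^m:\ \mathbf{y}_i\in\{0,1/\sqrt{k_1}\}\text{ for all }i,\ \sum_{i=1}^m\mathbf{y}_i=\sqrt{k_1}\}$. Then $$L=\frac{1}{\sqrt{k_1k_2}}\max_{\mathbf{x}\in\mathcal{S}_{\mathbf{x}},\,\mathbf{y}\in\mathcal{S}_{\mathbf{y}}}\left(\mathbf{h}^T\mathbf{y}+\mathbf{g}^T\mathbf{x}\right),$$ $$L^{(2)}=\frac{1}{\sqrt{k_1k_2}}\ \min_{c_3>0}\left(-\frac{c_3}{2}+\frac{1}{c_3}\log\left(\mathbb{E}\,e^{c_3\max_{\mathbf{y}\in\mathcal{S}_{\mathbf{y}}}\left(\mathbf{h}^T\mathbf{y}\right)}\right)+\frac{1}{c_3}\log\left(\mathbb{E}\,e^{c_3\max_{\mathbf{x}\in\mathcal{S}_{\mathbf{x}}}\left(\mathbf{g}^T\mathbf{x}\right)}\right)\right).$$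 With $h$ a standard normal random variable, $$I^{(2)}(c_3,\nu;\beta)=\mathbb{E}\,e^{-\frac{c_3}{\sqrt{\beta}}\min(h+\nu,0)}=\frac{1}{2}\mathrm{erfc}\left(-\frac{\nu}{\sqrt2}\right)+\frac12 e^{-\frac{c_3\left(2\nu-\frac{c_3}{\sqrt\beta}\right)}{2\sqrt\beta}}\,\mathrm{erfc}\left(\frac{\nu-\frac{c_3}{\sqrt\beta}}{\sqrt2}\right),$$ where $\mathrm{erfc}(x)=\frac{2}{\sqrt\pi}\int_x^\infty e^{-t^2}\,dt$. *)

theory Defs
  imports "HOL-Probability.Probability"
begin

text \<open>Matrices and vectors have growing dimensions, so they are represented by functions on
  \<open>nat\<close>, with row indices \<open>{1..m}\<close> and column indices \<open>{1..n}\<close>.\<close>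

definition submatrix_avg :: "nat \<Rightarrow> nat \<Rightarrow> nat \<Rightarrow> nat \<Rightarrow> (nat \<Rightarrow> nat \<Rightarrow> real) \<Rightarrow> real" where
  "submatrix_avg m n k1 k2 A =
     1 / (real k1 * real k2) *
     Max {(\<Sum>i\<in>I1. \<Sum>j\<in>I2. A i j) | I1 I2.
            I1 \<subseteq> {1..m} \<and> card I1 = k1 \<and> I2 \<subseteq> {1..n} \<and> card I2 = k2}"

definition selectors :: "nat \<Rightarrow> nat \<Rightarrow> (nat \<Rightarrow> real) set" where
  "selectors n k =
     {x \<in> {1..n} \<rightarrow>\<^sub>E {0, 1 / sqrt (real k)}. (\<Sum>i = 1..n. x i) = sqrt (real k)}"

definition lin_max :: "nat \<Rightarrow> nat \<Rightarrow> (nat \<Rightarrow> real) \<Rightarrow> real" where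
  "lin_max n k g = Max {(\<Sum>i = 1..n. g i * x i) | x. x \<in> selectors n k}"

definition lin_bound ::
  "nat \<Rightarrow> nat \<Rightarrow> nat \<Rightarrow> nat \<Rightarrow> (nat \<Rightarrow> real) \<Rightarrow> (nat \<Rightarrow> real) \<Rightarrow> real" where
  "lin_bound m n k1 k2 h g =
     1 / sqrt (real k1 * real k2) *
     Max {(\<Sum>i = 1..m. h i * y i) + (\<Sum>j = 1..n. g j * x j) | x y.
            x \<in> selectors n k2 \<and> y \<in> selectors m k1}"

text \<open>The minimum over the open half-line \<open>c > 0\<close> need not be attained: for \<open>k1 = m\<close>
  and \<open>k2 = n\<close> the objective is \<open>c / 2\<close>. It is therefore rendered as an infimum. The
  objective is always at least \<open>c / 2\<close>, since for a fixed selector \<open>x\<close> the variable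
  \<open>g \<bullet> x\<close> is standard normal.\<close>

definition lifted_bound ::
  "'a measure \<Rightarrow> nat \<Rightarrow> nat \<Rightarrow> nat \<Rightarrow> nat \<Rightarrow> (nat \<Rightarrow> 'a \<Rightarrow> real) \<Rightarrow> (nat \<Rightarrow> 'a \<Rightarrow> real) \<Rightarrow> real"
where
  "lifted_bound M m n k1 k2 h g =
     1 / sqrt (real k1 * real k2) *
     (INF c\<in>{0<..}.
        - c / 2
        + 1 / c * ln (\<integral>\<omega>. exp (c * lin_max m k1 (\<lambda>i. h i \<omega>)) \<partial>M)
        + 1 / c * ln (\<integral>\<omega>. exp (c * lin_max n k2 (\<lambda>j. g j \<omega>)) \<partial>M))"

text \<open>Expectation with respect to a standard normal variable; the closed form in terms of
  the complementary error function is \<open>I2_erfc\<close> below.\<close>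

definition I2 :: "real \<Rightarrow> real \<Rightarrow> real \<Rightarrow> real" where
  "I2 c \<nu> \<beta> =
     (\<integral>t. exp (- (c / sqrt \<beta>) * min (t + \<nu>) 0) \<partial>density lborel std_normal_density)"

definition erfc :: "real \<Rightarrow> real" where
  "erfc x = 2 / sqrt pi * (\<integral>t\<in>{x..}. exp (- t\<^sup>2) \<partial>lborel)"

definition gaussian_data ::
  "'a measure \<Rightarrow> nat \<Rightarrow> nat \<Rightarrow> (nat \<Rightarrow> 'a \<Rightarrow> real) \<Rightarrow> (nat \<Rightarrow> 'a \<Rightarrow> real)
     \<Rightarrow> (nat \<Rightarrow> nat \<Rightarrow> 'a \<Rightarrow> real) \<Rightarrow> bool" where
  "gaussian_data M m n h g A \<longleftrightarrow>
     prob_space M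
     \<and> (\<forall>i\<in>{1..m}. distributed M lborel (h i) std_normal_density)
     \<and> (\<forall>j\<in>{1..n}. distributed M lborel (g j) std_normal_density)
     \<and> (\<forall>i\<in>{1..m}. \<forall>j\<in>{1..n}. distributed M lborel (A i j) std_normal_density)
     \<and> prob_space.indep_vars M (\<lambda>_. borel)
          (case_sum h (case_sum g (\<lambda>(i, j). A i j)))
          ({1..m} <+> ({1..n} <+> {1..m} \<times> {1..n}))"

lemma normal_tail:
  "(\<integral>t\<in>{x..}. std_normal_density t \<partial>lborel) = erfc (x / sqrt 2) / 2"
proof -
  have "(\<integral>t. indicator {x..} t *\<^sub>R std_normal_density t \<partial>lborel)
      = \<bar>sqrt 2\<bar> *\<^sub>R (\<integral>s. indicator {x..} (0 + sqrt 2 * s) *\<^sub>R std_normal_density (0 + sqrt 2 * s) \<partial>lborel)"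
    by (rule lborel_integral_real_affine) simp
  also have "(\<lambda>s. indicator {x..} (0 + sqrt 2 * s) *\<^sub>R std_normal_density (0 + sqrt 2 * s))
      = (\<lambda>s. (1 / sqrt (2 * pi)) * (indicator {x / sqrt 2..} s *\<^sub>R exp (- s\<^sup>2)))"
    by (auto simp: fun_eq_iff std_normal_density_def indicator_def field_simps power_mult_distrib)
  finally show ?thesis
    by (simp add: set_lebesgue_integral_def erfc_def real_sqrt_mult)
qed

lemma I2_erfc:
  assumes "\<beta> > 0"
  shows "I2 c \<nu> \<beta> =
     1 / 2 * erfc (- \<nu> / sqrt 2)
     + 1 / 2 * exp (- (c * (2 * \<nu> - c / sqrt \<beta>) / (2 * sqrt \<beta>)))
         * erfc ((\<nu> - c / sqrt \<beta>) / sqrt 2)"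
proof -
  define a where "a = c / sqrt \<beta>"
  let ?\<phi> = "std_normal_density"
  have int: "integrable lborel (\<lambda>t. indicator S t *\<^sub>R ?\<phi> t)" if "S \<in> sets borel" for S :: "real set"
    using that by (intro integrable_mult_indicator) auto
  have sh: "exp (- a * (t + \<nu>)) * ?\<phi> t = exp (a\<^sup>2 / 2 - a * \<nu>) * ?\<phi> (- a - t)" for t
    unfolding std_normal_density_def
    by (simp add: exp_add [symmetric] power2_eq_square algebra_simps add_divide_distrib diff_divide_distrib)
  have split: "?\<phi> t * exp (- a * min (t + \<nu>) 0)
      = indicator {- \<nu>..} t *\<^sub>R ?\<phi> t
        + exp (a\<^sup>2 / 2 - a * \<nu>) * (indicator {\<nu> - a<..} (- a - t) *\<^sub>R ?\<phi> (- a - t))" for t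
  proof (cases "t < - \<nu>")
    case True
    then show ?thesis
      using sh [of t] by (simp add: min_def mult.commute [of "?\<phi> t"])
  qed simp
  have int2: "integrable lborel (\<lambda>t. indicator {\<nu> - a<..} (- a - t) *\<^sub>R ?\<phi> (- a - t))"
    using lborel_integrable_real_affine [OF int [of "{\<nu> - a<..}"], of "-1" "-a"] by simp
  have eq2: "(\<integral>t. indicator {\<nu> - a<..} (- a - t) *\<^sub>R ?\<phi> (- a - t) \<partial>lborel)
      = (\<integral>t. indicator {\<nu> - a<..} t *\<^sub>R ?\<phi> t \<partial>lborel)"
    using lborel_integral_real_affine [of "-1" "\<lambda>t. indicator {\<nu> - a<..} t *\<^sub>R ?\<phi> t" "-a"] by simp
  have eq3: "(\<integral>t. indicator {\<nu> - a<..} t *\<^sub>R ?\<phi> t \<partial>lborel)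
      = (\<integral>t. indicator {\<nu> - a..} t *\<^sub>R ?\<phi> t \<partial>lborel)"
    by (rule integral_cong_AE)
       (auto intro!: eventually_mono [OF AE_lborel_singleton [of "\<nu> - a"]] simp: indicator_def)
  have tail: "(\<integral>t. indicator {x..} t *\<^sub>R ?\<phi> t \<partial>lborel) = erfc (x / sqrt 2) / 2" for x
    using normal_tail [of x] by (simp add: set_lebesgue_integral_def)
  have "I2 c \<nu> \<beta> = (\<integral>t. ?\<phi> t * exp (- a * min (t + \<nu>) 0) \<partial>lborel)"
    unfolding I2_def a_def by (subst integral_real_density) auto
  also have "\<dots> = (\<integral>t. indicator {- \<nu>..} t *\<^sub>R ?\<phi> t \<partial>lborel)
      + exp (a\<^sup>2 / 2 - a * \<nu>) * (\<integral>t. indicator {\<nu> - a<..} (- a - t) *\<^sub>R ?\<phi> (- a - t) \<partial>lborel)"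
    unfolding split using int [of "{- \<nu>..}"] int2
    by (subst Bochner_Integration.integral_add) auto
  also have "\<dots> = 1 / 2 * erfc (- \<nu> / sqrt 2)
      + 1 / 2 * exp (a\<^sup>2 / 2 - a * \<nu>) * erfc ((\<nu> - a) / sqrt 2)"
    unfolding eq2 eq3 tail by simp
  also have "a\<^sup>2 / 2 - a * \<nu> = - (c * (2 * \<nu> - c / sqrt \<beta>) / (2 * sqrt \<beta>))"
    using assms by (simp add: a_def power2_eq_square field_simps)
  finally show ?thesis
    by (simp add: a_def)
qed

end

theory Submission
  imports Defs "HOL-Real_Asymp.Real_Asymp"
begin

text \<open>For \<open>k\<close> out of \<open>N\<close> normal variables the maximum over selectors is the sum of the \<open>k\<close> largest
  ones, divided by \<open>sqrt k\<close>. Its moment generating function is at most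
  \<open>exp (c k \<nu>) J(\<nu>)^N\<close> for every level \<open>\<nu>\<close>, where \<open>J(\<nu>) = E exp (c max (g - \<nu>) 0)\<close>. Restricting
  to the event that exactly the \<open>k\<close> largest variables exceed \<open>\<nu>\<close> gives a lower bound that, at the level
  balancing the two parts of \<open>J\<close>, differs only by the factor \<open>N + 1\<close>, because the mode of a binomial
  distribution carries mass at least \<open>1 / (N + 1)\<close>. Hence the normalised objective converges for
  each fixed \<open>c\<close>. Convexity of the log moment generating function together with a tensorised
  concentration bound makes the objectives uniformly Lipschitz in \<open>c\<close>, so their infima converge.
  The concentration bound also yields, as \<open>c\<close> tends to \<open>0\<close>, the convergence of the means and the
  comparison of \<open>L2\<close> with \<open>EL\<close>.

  The submatrix maximum is compared with \<open>L2\<close> for every \<open>n\<close>: adding an independent scalar normal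
  variable to the bilinear process equalises the variances, and its covariance
  \<open>1 + p q\<close> dominates the covariance \<open>p + q\<close> of the linear process for overlaps \<open>p, q \<le> 1\<close>. The
  Gaussian comparison is proved by Lindeberg replacement: both processes are split into
  \<open>M\<close> independent copies, which are exchanged one at a time at cost \<open>M powr (-3/2)\<close> each.\<close>

subsection \<open>Standard normal variables and products\<close>

text \<open>Under the scaling of \<open>c\<close> by \<open>sqrt n\<close> both log moment
  generating functions are of order \<open>n\<close>. Pointwise convergence in \<open>c\<close>
  alone does not control an infimum over an open half-line. A single fixed selector yields a
  standard normal variable, so each of the two blocks is at least \<open>c / 2\<close> and so is the
  objective; this confines the infimum to bounded \<open>c\<close>. Down to \<open>c = 0\<close> the
  uniform Lipschitz bound takes over. There, and in the passage to the means, only the order N c^2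
  of the concentration bound matters and not its constant, so an elementary symmetrisation replaces
  sharp Gaussian concentration.

  In the comparison, the exponential of a maximum is smoothed to the power \<open>p\<close> of a sum
  of exponentials. For 0 < p < 1 its mixed second derivatives are negative, which fixes the
  direction of the inequality, and the smoothing costs only the factor \<open>card T powr p\<close>,
  which disappears as \<open>p\<close> tends to 0.

  For \<open>k = N\<close> no balanced level exists: the upper bound is then approached only as the
  level tends to minus infinity. The lower bound on the moment generating function is therefore used
  up to an arbitrary \<epsilon>.\<close>

definition gauss :: "real measure" where
  "gauss = density lborel std_normal_density"

abbreviation gprod :: "'i set \<Rightarrow> ('i \<Rightarrow> real) measure" where
  "gprod I \<equiv> PiM I (\<lambda>_. gauss)"

lemma sets_gauss [simp, measurable_cong]: "sets gauss = sets borel"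
  by (simp add: gauss_def)

lemma space_gauss [simp]: "space gauss = UNIV"
  by (simp add: gauss_def)

lemma prob_space_gauss: "prob_space gauss"
  unfolding gauss_def by (rule prob_space_normal_density) simp

interpretation gauss: prob_space gauss
  by (rule prob_space_gauss)

interpretation GP: product_sigma_finite "\<lambda>_. gauss"
  by standard

lemma prob_space_gprod: "prob_space (gprod I)"
  by (rule prob_space_PiM) (rule prob_space_gauss)

lemma integral_gauss:
  fixes f :: "real \<Rightarrow> real"
  assumes "f \<in> borel_measurable borel"
  shows "(\<integral>x. f x \<partial>gauss) = (\<integral>x. std_normal_density x * f x \<partial>lborel)"
  unfolding gauss_def using assms by (subst integral_real_density) auto

lemma integrable_gauss_iff:
  fixes f :: "real \<Rightarrow> real"
  assumes "f \<in> borel_measurable borel"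
  shows "integrable gauss f \<longleftrightarrow> integrable lborel (\<lambda>x. std_normal_density x * f x)"
  unfolding gauss_def using assms by (subst integrable_real_density) auto

text \<open>Completing the square: the factor \<open>exp (c * x)\<close> moves the mean of the
  normal density from 0 to \<open>c\<close>.\<close>

lemma has_integral_exp_gauss:
  "has_bochner_integral gauss (\<lambda>x. exp (c * x)) (exp (c\<^sup>2 / 2))"
proof -
  have eq: "std_normal_density x * exp (c * x) = exp (c\<^sup>2 / 2) * normal_density c 1 x" for x
    unfolding normal_density_def
    by (simp add: exp_add [symmetric] power2_eq_square field_simps)
  have "has_bochner_integral lborel (\<lambda>x. exp (c\<^sup>2 / 2) * normal_density c 1 x) (exp (c\<^sup>2 / 2) * 1)"
    by (intro has_bochner_integral_mult_right) (auto simp: has_bochner_integral_iff)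
  then show ?thesis
    by (subst has_bochner_integral_iff, subst integrable_gauss_iff, simp, subst integral_gauss, simp)
       (simp add: eq has_bochner_integral_iff)
qed

lemma integrable_exp_gauss [simp]: "integrable gauss (\<lambda>x. exp (c * x))"
  and integral_exp_gauss: "(\<integral>x. exp (c * x) \<partial>gauss) = exp (c\<^sup>2 / 2)"
  using has_integral_exp_gauss[of c] by (auto simp: has_bochner_integral_iff)

lemma integrable_exp_abs_gauss [simp]: "integrable gauss (\<lambda>x. exp (c * \<bar>x\<bar>))"
proof (rule Bochner_Integration.integrable_bound)
  show "integrable gauss (\<lambda>x. exp (c * x) + exp ((- c) * x))"
    by (intro Bochner_Integration.integrable_add integrable_exp_gauss)
  show "AE x in gauss. norm (exp (c * \<bar>x\<bar>)) \<le> norm (exp (c * x) + exp ((- c) * x))"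
  proof (rule AE_I2)
    fix x :: real
    have "exp (c * \<bar>x\<bar>) \<le> exp (c * x) + exp ((- c) * x)"
      by (auto simp: abs_if)
    then show "norm (exp (c * \<bar>x\<bar>)) \<le> norm (exp (c * x) + exp ((- c) * x))"
      by (simp del: mult_minus_left)
  qed
qed auto

lemma gauss_id: "integrable gauss (\<lambda>x. x)" "(\<integral>x. x \<partial>gauss) = 0"
  using std_normal_moment_odd[of 0]
  by (auto simp: integrable_gauss_iff integral_gauss has_bochner_integral_iff)

lemma gauss_sq: "integrable gauss (\<lambda>x. x * x)" "(\<integral>x. x * x \<partial>gauss) = 1"
  using std_normal_moment_even[of 1]
  by (auto simp: integrable_gauss_iff integral_gauss has_bochner_integral_iff power2_eq_square)

lemma gauss_uminus:
  fixes f :: "real \<Rightarrow> real"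
  assumes [measurable]: "f \<in> borel_measurable borel"
  shows "(\<integral>x. f (- x) \<partial>gauss) = (\<integral>x. f x \<partial>gauss)"
proof -
  have "(\<integral>x. f x \<partial>gauss) = (\<integral>x. std_normal_density x * f x \<partial>lborel)"
    by (simp add: integral_gauss)
  also have "\<dots> = (\<integral>x. std_normal_density x * f (- x) \<partial>lborel)"
    by (subst lborel_integral_real_affine[of "-1" _ 0]) (auto simp: std_normal_density_def)
  finally show ?thesis
    by (simp add: integral_gauss)
qed

section \<open>Rotation invariance of the Gaussian law\<close>

text \<open>This splits a standard normal variable into independent pieces of variances a^2 and b^2,
  which is what allows a Gaussian vector to be replaced piece by piece. Nonnegative integrals keep
  the identity free of integrability conditions.\<close>

lemma gauss_rotate:
  assumes ab: "a \<ge> 0" "b \<ge> 0" "a\<^sup>2 + b\<^sup>2 = 1"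
    and [measurable]: "f \<in> borel_measurable borel"
  shows "(\<integral>\<^sup>+x. (\<integral>\<^sup>+y. f (a * x + b * y) \<partial>gauss) \<partial>gauss) = (\<integral>\<^sup>+x. f x \<partial>gauss)"
proof -
  \<comment> \<open>A vanishing coefficient would produce a normal law with standard deviation 0,
    which has no density; these two cases are trivial. The third is the sum of two independent
    normal variables.\<close>
  consider "a = 0" "b = 1" | "b = 0" "a = 1" | "a > 0" "b > 0"
    using ab by (cases "a = 0"; cases "b = 0") (auto simp: power2_eq_1_iff)
  then show ?thesis
  proof cases
    case 3
    interpret P: pair_prob_space gauss gauss ..
    let ?P = "gauss \<Otimes>\<^sub>M gauss"
    have f: "distr ?P borel fst = gauss"
      using gauss.distr_pair_fst[of gauss] by (simp cong: distr_cong)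
    have g: "distr ?P borel snd = gauss"
    proof (rule measure_eqI)
      fix A assume "A \<in> sets (distr ?P borel snd)"
      then have A: "A \<in> sets gauss" by simp
      have "emeasure (distr ?P borel snd) A = emeasure ?P (space gauss \<times> A)"
        using A by (subst emeasure_distr) (auto simp: space_pair_measure intro!: arg_cong2[where f=emeasure])
      also have "\<dots> = emeasure gauss A"
        using A gauss.emeasure_space_1 by (subst gauss.emeasure_pair_measure_Times) auto
      finally show "emeasure (distr ?P borel snd) A = emeasure gauss A" .
    qed simp
    have d1: "distributed ?P lborel fst std_normal_density"
      unfolding distributed_def using f by (simp add: gauss_def cong: distr_cong)
    have d2: "distributed ?P lborel snd std_normal_density"
      unfolding distributed_def using g by (simp add: gauss_def cong: distr_cong)
    have "distr ?P (borel \<Otimes>\<^sub>M borel) (\<lambda>x. x) = ?P"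
      by (rule distr_id2) (auto intro!: sets_pair_measure_cong)
    then have ind: "P.indep_var borel fst borel snd"
      unfolding P.indep_var_distribution_eq f g by simp
    have "P.indep_var borel (((*) a) \<circ> fst) borel (((*) b) \<circ> snd)"
      by (intro P.indep_var_compose[OF ind]) auto
    moreover have "distributed ?P lborel (\<lambda>x. a * fst x) (normal_density 0 a)"
      using P.normal_density_affine[OF d1, of a 0] 3 by simp
    moreover have "distributed ?P lborel (\<lambda>x. b * snd x) (normal_density 0 b)"
      using P.normal_density_affine[OF d2, of b 0] 3 by simp
    ultimately have "distributed ?P lborel (\<lambda>x. a * fst x + b * snd x) (normal_density (0 + 0) (sqrt (a\<^sup>2 + b\<^sup>2)))"
      using 3 by (intro P.add_indep_normal) (auto simp: comp_def)
    then have d: "distr ?P lborel (\<lambda>x. a * fst x + b * snd x) = gauss"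
      using ab by (simp add: distributed_def gauss_def)
    have "(\<integral>\<^sup>+x. (\<integral>\<^sup>+y. f (a * x + b * y) \<partial>gauss) \<partial>gauss) = (\<integral>\<^sup>+z. f (a * fst z + b * snd z) \<partial>?P)"
      by (subst gauss.nn_integral_fst[symmetric]) auto
    also have "\<dots> = (\<integral>\<^sup>+x. f x \<partial>distr ?P lborel (\<lambda>x. a * fst x + b * snd x))"
      by (subst nn_integral_distr) auto
    finally show ?thesis by (simp add: d)
  qed (use gauss.emeasure_space_1 in auto)
qed


text \<open>Boxes determine a product measure, and the indicator of a box factorises over the
  coordinates, so the claim reduces to \<open>gauss_rotate\<close> in each coordinate.\<close>

lemma gprod_rotate:
  assumes I: "finite I" and ab: "a \<ge> 0" "b \<ge> 0" "a\<^sup>2 + b\<^sup>2 = 1"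
  shows "distr (gprod I \<Otimes>\<^sub>M gprod I) (gprod I) (\<lambda>z. \<lambda>i\<in>I. a * fst z i + b * snd z i) = gprod I"
proof (rule GP.PiM_eqI[OF I])
  interpret Q: prob_space "gprod I"
    by (rule prob_space_gprod)
  fix A :: "_ \<Rightarrow> real set" assume A: "\<And>i. i \<in> I \<Longrightarrow> A i \<in> sets gauss"
  then have [measurable]: "\<And>i. i \<in> I \<Longrightarrow> A i \<in> sets borel" by simp
  have pi: "indicator (Pi\<^sub>E I A) (\<lambda>i\<in>I. a * x i + b * y i) = (\<Prod>i\<in>I. indicator (A i) (a * x i + b * y i) :: ennreal)"
    for x y :: "_ \<Rightarrow> real"
  proof (cases "\<forall>i\<in>I. a * x i + b * y i \<in> A i")
    case False
    then have "(\<Prod>i\<in>I. indicator (A i) (a * x i + b * y i) :: ennreal) = 0"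
      using I by (intro prod_zero) (auto simp: indicator_def)
    with False show ?thesis by (auto simp: indicator_def PiE_iff)
  qed (auto simp: PiE_iff)
  have sets [measurable]: "Pi\<^sub>E I A \<in> sets (gprod I)"
    using A I by (intro sets_PiM_I_finite) auto
  have "emeasure (distr (gprod I \<Otimes>\<^sub>M gprod I) (gprod I) (\<lambda>z. \<lambda>i\<in>I. a * fst z i + b * snd z i)) (Pi\<^sub>E I A)
     = (\<integral>\<^sup>+z. indicator (Pi\<^sub>E I A) (\<lambda>i\<in>I. a * fst z i + b * snd z i) \<partial>(gprod I \<Otimes>\<^sub>M gprod I))"
    using sets by (simp add: nn_integral_indicator[symmetric] nn_integral_distr del: nn_integral_indicator)
  also have "\<dots> = (\<integral>\<^sup>+x. (\<integral>\<^sup>+y. indicator (Pi\<^sub>E I A) (\<lambda>i\<in>I. a * x i + b * y i) \<partial>gprod I) \<partial>gprod I)"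
    using sets by (subst Q.nn_integral_fst[symmetric]) auto
  also have "\<dots> = (\<integral>\<^sup>+x. (\<Prod>i\<in>I. \<integral>\<^sup>+y. indicator (A i) (a * x i + b * y) \<partial>gauss) \<partial>gprod I)"
    unfolding pi using I by (intro nn_integral_cong GP.product_nn_integral_prod) auto
  also have "\<dots> = (\<Prod>i\<in>I. \<integral>\<^sup>+x. (\<integral>\<^sup>+y. indicator (A i) (a * x + b * y) \<partial>gauss) \<partial>gauss)"
    using I by (intro GP.product_nn_integral_prod) auto
  also have "\<dots> = (\<Prod>i\<in>I. emeasure gauss (A i))"
    using A by (intro prod.cong refl, subst gauss_rotate[OF ab]) auto
  finally show "emeasure (distr (gprod I \<Otimes>\<^sub>M gprod I) (gprod I) (\<lambda>z. \<lambda>i\<in>I. a * fst z i + b * snd z i)) (Pi\<^sub>E I A)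
    = (\<Prod>i\<in>I. emeasure gauss (A i))" .
qed simp

lemma nn_integral_gprod_rotate:
  assumes I: "finite I" and ab: "a \<ge> 0" "b \<ge> 0" "a\<^sup>2 + b\<^sup>2 = 1"
    and f [measurable]: "f \<in> borel_measurable (gprod I)"
  shows "(\<integral>\<^sup>+x. f x \<partial>gprod I) = (\<integral>\<^sup>+x. (\<integral>\<^sup>+y. f (\<lambda>i\<in>I. a * x i + b * y i) \<partial>gprod I) \<partial>gprod I)"
proof -
  interpret Q: prob_space "gprod I"
    by (rule prob_space_gprod)
  show ?thesis
    by (subst gprod_rotate[OF I ab, symmetric], subst nn_integral_distr, simp, simp,
        subst Q.nn_integral_fst[symmetric]) auto
qed

section \<open>Integrability and second moments on Gaussian product spaces\<close>

lemma integrable_gprod_exp_sum_abs: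
  assumes "finite I"
  shows "integrable (gprod I) (\<lambda>x. exp (B * (\<Sum>i\<in>I. \<bar>x i\<bar>)))"
proof -
  have "integrable (gprod I) (\<lambda>x. \<Prod>i\<in>I. exp (B * \<bar>x i\<bar>))"
    using assms by (intro GP.product_integrable_prod) auto
  then show ?thesis
    using assms by (simp add: exp_sum sum_distrib_left)
qed

lemma integrable_gprod_bound:
  fixes f :: "('a \<Rightarrow> real) \<Rightarrow> real"
  assumes I: "finite I" and [measurable]: "f \<in> borel_measurable (gprod I)"
    and le: "\<And>x. \<bar>f x\<bar> \<le> A * exp (B * (\<Sum>i\<in>I. \<bar>x i\<bar>))"
  shows "integrable (gprod I) f"
proof (rule Bochner_Integration.integrable_bound)
  show "integrable (gprod I) (\<lambda>x. A * exp (B * (\<Sum>i\<in>I. \<bar>x i\<bar>)))"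
    using integrable_gprod_exp_sum_abs[OF I] by simp
  show "AE x in gprod I. norm (f x) \<le> norm (A * exp (B * (\<Sum>i\<in>I. \<bar>x i\<bar>)))"
    using le by (auto intro!: AE_I2 intro: order_trans abs_ge_self)
qed simp

text \<open>Maxima of finitely many linear forms grow at most linearly; this covers them together
  with all their exponential moments.\<close>

lemma integrable_gprod_linear_growth:
  fixes f :: "('a \<Rightarrow> real) \<Rightarrow> real"
  assumes I: "finite I" and [measurable]: "f \<in> borel_measurable (gprod I)"
    and le: "\<And>x. \<bar>f x\<bar> \<le> A + B * (\<Sum>i\<in>I. \<bar>x i\<bar>)"
  shows "integrable (gprod I) f" "integrable (gprod I) (\<lambda>x. exp (c * f x))"
proof -
  show "integrable (gprod I) f"
  proof (rule integrable_gprod_bound[OF I])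
    fix x :: "'a \<Rightarrow> real"
    have "\<bar>f x\<bar> \<le> exp \<bar>f x\<bar>"
      using exp_ge_add_one_self[of "\<bar>f x\<bar>"] by linarith
    also have "\<dots> \<le> exp A * exp (B * (\<Sum>i\<in>I. \<bar>x i\<bar>))"
      using le[of x] by (simp add: exp_add[symmetric])
    finally show "\<bar>f x\<bar> \<le> exp A * exp (B * (\<Sum>i\<in>I. \<bar>x i\<bar>))" .
  qed simp
  show "integrable (gprod I) (\<lambda>x. exp (c * f x))"
  proof (rule integrable_gprod_bound[OF I])
    fix x :: "'a \<Rightarrow> real"
    have "c * f x \<le> \<bar>c\<bar> * \<bar>f x\<bar>"
      by (metis abs_ge_self abs_mult)
    also have "\<dots> \<le> \<bar>c\<bar> * (A + B * (\<Sum>i\<in>I. \<bar>x i\<bar>))"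
      using le[of x] by (intro mult_left_mono) auto
    finally show "\<bar>exp (c * f x)\<bar> \<le> exp (\<bar>c\<bar> * A) * exp ((\<bar>c\<bar> * B) * (\<Sum>i\<in>I. \<bar>x i\<bar>))"
      by (simp add: exp_add[symmetric] algebra_simps)
  qed simp
qed

lemma gprod_component:
  fixes f :: "real \<Rightarrow> real"
  assumes "i \<in> I" and f [measurable]: "f \<in> borel_measurable borel"
  shows "(\<integral>x. f (x i) \<partial>gprod I) = (\<integral>x. f x \<partial>gauss)"
proof -
  have "distr (gprod I) gauss (\<lambda>x. x i) = gauss"
    using assms by (intro distr_PiM_component prob_space_gauss)
  moreover have "(\<integral>x. f x \<partial>distr (gprod I) gauss (\<lambda>x. x i)) = (\<integral>x. f (x i) \<partial>gprod I)"
    using assms by (subst integral_distr) auto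
  ultimately show ?thesis by simp
qed

lemma integrable_gprod_coord:
  assumes I: "finite I" and "i \<in> I"
  shows "integrable (gprod I) (\<lambda>x. x i)"
proof (rule integrable_gprod_linear_growth[OF I])
  show "\<bar>x i\<bar> \<le> 0 + 1 * (\<Sum>i\<in>I. \<bar>x i\<bar>)" for x :: "'a \<Rightarrow> real"
    using assms member_le_sum[of i I "\<lambda>i. \<bar>x i\<bar>"] by simp
qed (use assms in simp)

lemma gprod_mean: "i \<in> I \<Longrightarrow> (\<integral>x. x i \<partial>gprod I) = 0"
  using gprod_component[of i I "\<lambda>x. x"] by (simp add: gauss_id)

lemma integrable_gprod_coord2:
  assumes I: "finite I" and i: "i \<in> I" and j: "j \<in> I"
  shows "integrable (gprod I) (\<lambda>x. x i * x j)"
proof (rule integrable_gprod_bound[OF I])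
  fix x :: "'a \<Rightarrow> real"
  let ?S = "\<Sum>i\<in>I. \<bar>x i\<bar>"
  have S: "0 \<le> ?S" by (simp add: sum_nonneg)
  have "\<bar>x i * x j\<bar> \<le> ?S * ?S"
    unfolding abs_mult using assms S by (intro mult_mono member_le_sum) auto
  also have "\<dots> \<le> exp ?S * exp ?S"
    using exp_ge_add_one_self[of ?S] S by (intro mult_mono order_trans[OF _ exp_ge_add_one_self]) auto
  also have "\<dots> = 1 * exp (2 * ?S)"
    by (simp add: exp_add[symmetric])
  finally show "\<bar>x i * x j\<bar> \<le> 1 * exp (2 * ?S)" .
qed (use assms in simp)

lemma gprod_covariance:
  assumes I: "finite I" and i: "i \<in> I" and j: "j \<in> I"
  shows "(\<integral>x. x i * x j \<partial>gprod I) = (if i = j then 1 else 0)"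
proof (cases "i = j")
  case True
  then show ?thesis
    using gprod_component[of i I "\<lambda>x. x * x"] i by (simp add: gauss_sq)
next
  case False
  \<comment> \<open>Factors equal to 1 in the remaining coordinates turn \<open>x i * x j\<close>
    into a product over all of \<open>I\<close>, to which the product formula for integrals
    applies.\<close>
  define f :: "_ \<Rightarrow> real \<Rightarrow> real" where "f k x = (if k = i \<or> k = j then x else 1)" for k x
  have int: "integrable gauss (f k)" for k
    by (cases "k = i \<or> k = j") (auto simp: f_def[abs_def] gauss_id)
  have f: "(\<Prod>k\<in>I. f k (x k)) = x i * x j" for x
  proof -
    have "(\<Prod>k\<in>I. f k (x k)) = (\<Prod>k\<in>{i, j}. f k (x k))"
      using I i j by (intro prod.mono_neutral_right) (auto simp: f_def)
    also have "\<dots> = x i * x j" using False by (simp add: f_def)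
    finally show ?thesis .
  qed
  have "(\<integral>x. x i * x j \<partial>gprod I) = (\<integral>x. (\<Prod>k\<in>I. f k (x k)) \<partial>gprod I)"
    by (simp add: f)
  also have "\<dots> = (\<Prod>k\<in>I. \<integral>x. f k x \<partial>gauss)"
    using I int by (intro GP.product_integral_prod) auto
  also have "\<dots> = 0"
    using I i by (intro prod_zero) (auto simp: f_def gauss_id intro!: bexI[of _ i])
  finally show ?thesis using False by simp
qed

subsection \<open>Gaussian comparison\<close>

definition esum :: "'s set \<Rightarrow> ('s \<Rightarrow> real) \<Rightarrow> real" where
  "esum T z = (\<Sum>s\<in>T. exp (z s))"

text \<open>Evaluated at \<open>c / p * z s\<close> this exceeds the exponential of \<open>c\<close>
  times the maximum of \<open>z\<close> by a factor of at most \<open>card T powr p\<close>.\<close>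

definition smax :: "'s set \<Rightarrow> real \<Rightarrow> ('s \<Rightarrow> real) \<Rightarrow> real" where
  "smax T p z = esum T z powr p"

text \<open>The Hessian of \<open>smax T p\<close> at \<open>z\<close>, contracted with a matrix
  \<open>G\<close>. Being linear in \<open>G\<close>, it turns under expectation of
  \<open>G s t = w s * w t\<close> into its value at the covariance matrix.\<close>

definition smax_hess :: "'s set \<Rightarrow> real \<Rightarrow> ('s \<Rightarrow> real) \<Rightarrow> ('s \<Rightarrow> 's \<Rightarrow> real) \<Rightarrow> real" where
  "smax_hess T p z G =
     p * (p - 1) * esum T z powr (p - 2) * (\<Sum>s\<in>T. \<Sum>t\<in>T. exp (z s) * exp (z t) * G s t)
     + p * esum T z powr (p - 1) * (\<Sum>s\<in>T. exp (z s) * G s s)"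

text \<open>A centred Gaussian process indexed by \<open>s\<close>, represented by linear forms in
  independent standard normal coordinates; \<open>gram\<close> is its covariance.\<close>

definition linf :: "'k set \<Rightarrow> ('s \<Rightarrow> 'k \<Rightarrow> real) \<Rightarrow> ('k \<Rightarrow> real) \<Rightarrow> 's \<Rightarrow> real" where
  "linf K a \<omega> s = (\<Sum>k\<in>K. a s k * \<omega> k)"

definition gram :: "'k set \<Rightarrow> ('s \<Rightarrow> 'k \<Rightarrow> real) \<Rightarrow> 's \<Rightarrow> 's \<Rightarrow> real" where
  "gram K a s t = (\<Sum>k\<in>K. a s k * a t k)"

lemma esum_pos: "finite T \<Longrightarrow> T \<noteq> {} \<Longrightarrow> 0 < esum T z"
  unfolding esum_def by (intro sum_pos) auto

lemma smax_pos: "finite T \<Longrightarrow> T \<noteq> {} \<Longrightarrow> 0 < smax T p z"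
  using esum_pos[of T z] by (simp add: smax_def)

text \<open>The remainder is bounded relative to \<open>smax T p z\<close>, not by an absolute
  constant. This makes the error uniform in \<open>z\<close> after division by \<open>smax\<close>,
  so that it can be integrated over a random base point later.\<close>

lemma smax_taylor:
  fixes z w :: "'s \<Rightarrow> real"
  assumes T: "finite T" "T \<noteq> {}" and p: "0 < p" "p < 1"
  defines "W \<equiv> \<Sum>s\<in>T. \<bar>w s\<bar>"
  shows "\<bar>smax T p (\<lambda>s. z s + w s) - smax T p z
      - p * esum T z powr (p - 1) * (\<Sum>s\<in>T. exp (z s) * w s)
      - smax_hess T p z (\<lambda>s t. w s * w t) / 2\<bar> \<le> W ^ 3 * exp W * smax T p z"
proof -
  \<comment> \<open>\<open>S j\<close> is the \<open>j\<close>-th derivative of the exponential sum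
    along the segment from \<open>z\<close> to \<open>z + w\<close>.\<close>
  define S where "S j \<tau> = (\<Sum>s\<in>T. w s ^ j * exp (z s + \<tau> * w s))" for j :: nat and \<tau> :: real
  have S0pos: "0 < S 0 \<tau>" for \<tau>
    unfolding S_def using T by (intro sum_pos) auto
  have dS: "(S j has_real_derivative S (Suc j) \<tau>) (at \<tau>)" for j \<tau>
    unfolding S_def[abs_def] by (auto intro!: derivative_eq_intros sum.cong simp: algebra_simps)
  have dP: "((\<lambda>\<tau>. S 0 \<tau> powr q) has_real_derivative q * S 0 \<tau> powr (q - 1) * S 1 \<tau>) (at \<tau>)" for q \<tau>
    using DERIV_fun_powr[OF dS S0pos, of q \<tau>] by simp
  have W0: "0 \<le> W" by (simp add: W_def sum_nonneg)
  have wW: "\<bar>w s\<bar> \<le> W" if "s \<in> T" for s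
    unfolding W_def using T that by (intro member_le_sum) auto
  have Sj: "\<bar>S j \<tau>\<bar> \<le> W ^ j * S 0 \<tau>" for j \<tau>
  proof -
    have "\<bar>S j \<tau>\<bar> \<le> (\<Sum>s\<in>T. \<bar>w s ^ j * exp (z s + \<tau> * w s)\<bar>)"
      unfolding S_def by (rule sum_abs)
    also have "\<dots> \<le> (\<Sum>s\<in>T. W ^ j * exp (z s + \<tau> * w s))"
      using wW by (intro sum_mono) (auto simp: abs_mult power_abs intro!: power_mono)
    finally show ?thesis by (simp add: S_def sum_distrib_left)
  qed
  have S0: "S 0 \<tau> \<le> exp W * S 0 0" if "0 \<le> \<tau>" "\<tau> \<le> 1" for \<tau>
  proof -
    have "exp (z s + \<tau> * w s) \<le> exp W * exp (z s)" if "s \<in> T" for s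
    proof -
      have "\<tau> * w s \<le> 1 * \<bar>w s\<bar>"
        using \<open>0 \<le> \<tau>\<close> \<open>\<tau> \<le> 1\<close> by (metis abs_ge_self abs_ge_zero mult_left_mono mult_right_mono order_trans)
      then show ?thesis using wW[OF that] by (simp add: exp_add[symmetric])
    qed
    then show ?thesis unfolding S_def by (auto simp: sum_distrib_left intro!: sum_mono)
  qed
  \<comment> \<open>The derivatives of order 0 to 3 of \<open>S 0 powr p\<close>, written out by the
    chain rule.\<close>
  define d where "d m \<tau> =
    (if m = 0 then S 0 \<tau> powr p
     else if m = 1 then p * S 0 \<tau> powr (p - 1) * S 1 \<tau>
     else if m = 2 then p * (p - 1) * S 0 \<tau> powr (p - 2) * S 1 \<tau> ^ 2 + p * S 0 \<tau> powr (p - 1) * S 2 \<tau>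
     else p * (p - 1) * (p - 2) * S 0 \<tau> powr (p - 3) * S 1 \<tau> ^ 3
        + 3 * p * (p - 1) * S 0 \<tau> powr (p - 2) * S 1 \<tau> * S 2 \<tau>
        + p * S 0 \<tau> powr (p - 1) * S 3 \<tau>)" for m :: nat and \<tau>
  have d0: "(d 0 has_real_derivative d (Suc 0) \<tau>) (at \<tau>)" for \<tau>
    using dP[of p \<tau>] by (simp add: d_def[abs_def])
  have d1: "(d (Suc 0) has_real_derivative d (Suc (Suc 0)) \<tau>) (at \<tau>)" for \<tau>
    unfolding d_def[abs_def]
    by (auto intro!: derivative_eq_intros dP dS S0pos simp: power2_eq_square numeral_2_eq_2 algebra_simps)
  have d2: "(d (Suc (Suc 0)) has_real_derivative d (Suc (Suc (Suc 0))) \<tau>) (at \<tau>)" for \<tau>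
    unfolding d_def[abs_def]
    by (auto intro!: derivative_eq_intros dP dS S0pos
        simp: power2_eq_square power3_eq_cube numeral_2_eq_2 numeral_3_eq_3 algebra_simps)
  have "\<exists>t>0. t < 1 \<and> d 0 1 = (\<Sum>m<3. d m 0 / fact m * 1 ^ m) + d 3 t / fact 3 * 1 ^ 3"
  proof (rule Maclaurin)
    show "\<forall>m t. m < 3 \<and> 0 \<le> t \<and> t \<le> 1 \<longrightarrow> (d m has_real_derivative d (Suc m) t) (at t)"
      using d0 d1 d2 by (auto simp: numeral_3_eq_3 less_Suc_eq)
  qed auto
  then obtain t where t: "0 < t" "t < 1" and
    eq: "d 0 1 = d 0 0 + d 1 0 + d 2 0 / 2 + d 3 t / 6"
    by (auto simp: numeral_3_eq_3 fact_numeral numeral_2_eq_2)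
  \<comment> \<open>Every term of the third derivative is homogeneous of degree \<open>p\<close> in
    the \<open>S j\<close>, and \<open>S j\<close> is at most \<open>W ^ j * S 0\<close>; hence each
    is bounded by \<open>W ^ 3 * S 0 powr p\<close> up to its coefficient.\<close>
  have pw: "S 0 t powr (p - real j) * S 0 t ^ j = S 0 t powr p" for j
    using S0pos[of t] by (simp add: powr_diff powr_realpow)
  have pw: "S 0 t powr (p - 1) * S 0 t = S 0 t powr p" "S 0 t powr (p - 2) * S 0 t ^ 2 = S 0 t powr p"
     "S 0 t powr (p - 3) * S 0 t ^ 3 = S 0 t powr p"
    using pw[of 1] pw[of 2] pw[of 3] by auto
  let ?P = "S 0 t powr p"
  have b1: "\<bar>S 0 t powr (p - 3) * S 1 t ^ 3\<bar> \<le> W ^ 3 * ?P"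
  proof -
    have "\<bar>S 1 t\<bar> ^ 3 \<le> (W * S 0 t) ^ 3"
      using Sj[of 1 t] by (intro power_mono) auto
    then have "S 0 t powr (p - 3) * \<bar>S 1 t\<bar> ^ 3 \<le> S 0 t powr (p - 3) * (W * S 0 t) ^ 3"
      by (intro mult_left_mono) auto
    also have "\<dots> = W ^ 3 * (S 0 t powr (p - 3) * S 0 t ^ 3)"
      by (simp add: power_mult_distrib)
    finally show ?thesis unfolding pw by (simp add: abs_mult power_abs)
  qed
  have b2: "\<bar>S 0 t powr (p - 2) * S 1 t * S 2 t\<bar> \<le> W ^ 3 * ?P"
  proof -
    have "\<bar>S 1 t\<bar> * \<bar>S 2 t\<bar> \<le> (W * S 0 t) * (W ^ 2 * S 0 t)"
      using Sj[of 1 t] Sj[of 2 t] W0 S0pos[of t] by (intro mult_mono) auto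
    then have "S 0 t powr (p - 2) * (\<bar>S 1 t\<bar> * \<bar>S 2 t\<bar>) \<le> S 0 t powr (p - 2) * ((W * S 0 t) * (W ^ 2 * S 0 t))"
      by (intro mult_left_mono) auto
    also have "\<dots> = W ^ 3 * (S 0 t powr (p - 2) * S 0 t ^ 2)"
      by (simp add: power2_eq_square power3_eq_cube)
    finally show ?thesis unfolding pw by (simp add: abs_mult mult.assoc)
  qed
  have b3: "\<bar>S 0 t powr (p - 1) * S 3 t\<bar> \<le> W ^ 3 * ?P"
  proof -
    have "S 0 t powr (p - 1) * \<bar>S 3 t\<bar> \<le> S 0 t powr (p - 1) * (W ^ 3 * S 0 t)"
      using Sj[of 3 t] by (intro mult_left_mono) auto
    also have "\<dots> = W ^ 3 * (S 0 t powr (p - 1) * S 0 t)" by simp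
    finally show ?thesis unfolding pw by (simp add: abs_mult)
  qed
  have c1: "\<bar>p * (p - 1) * (p - 2)\<bar> \<le> 2"
  proof -
    have "\<bar>p\<bar> * \<bar>p - 1\<bar> * \<bar>p - 2\<bar> \<le> 1 * 1 * 2"
      using p by (intro mult_mono) auto
    then show ?thesis by (simp add: abs_mult)
  qed
  have c2: "\<bar>3 * p * (p - 1)\<bar> \<le> 3"
  proof -
    have "3 * \<bar>p\<bar> * \<bar>p - 1\<bar> \<le> 3 * 1 * 1"
      using p by (intro mult_mono) auto
    then show ?thesis by (simp add: abs_mult)
  qed
  have N: "0 \<le> W ^ 3 * ?P" using W0 by simp
  have "\<bar>d 3 t\<bar> \<le> \<bar>p * (p - 1) * (p - 2)\<bar> * \<bar>S 0 t powr (p - 3) * S 1 t ^ 3\<bar>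
      + \<bar>3 * p * (p - 1)\<bar> * \<bar>S 0 t powr (p - 2) * S 1 t * S 2 t\<bar> + \<bar>p\<bar> * \<bar>S 0 t powr (p - 1) * S 3 t\<bar>"
    unfolding abs_mult[symmetric] d_def by (simp add: mult.assoc)
  \<comment> \<open>The coefficients add up to 6, which cancels the 3! of the Maclaurin
    remainder.\<close>
  also have "\<dots> \<le> 2 * (W ^ 3 * ?P) + 3 * (W ^ 3 * ?P) + 1 * (W ^ 3 * ?P)"
    using p b1 b2 b3 c1 c2 N by (intro add_mono mult_mono) auto
  finally have "\<bar>d 3 t / 6\<bar> \<le> W ^ 3 * ?P" by simp
  also have "?P \<le> (exp W * S 0 0) powr p"
    using S0[of t] t p S0pos[of t] by (intro powr_mono2) auto
  also have "(exp W * S 0 0) powr p = exp (p * W) * S 0 0 powr p"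
    using S0pos[of 0] by (simp add: powr_mult powr_def exp_add[symmetric] ln_mult algebra_simps)
  also have "\<dots> \<le> exp W * S 0 0 powr p"
    using p W0 by (intro mult_right_mono) (auto simp: mult_left_le_one_le)
  finally have R: "\<bar>d 3 t / 6\<bar> \<le> W ^ 3 * (exp W * S 0 0 powr p)"
    using W0 by (simp add: mult_left_mono)
  have S00: "S 0 0 = esum T z" "S 0 1 = esum T (\<lambda>s. z s + w s)"
    by (simp_all add: S_def esum_def)
  have "d 0 1 = smax T p (\<lambda>s. z s + w s)" "d 0 0 = smax T p z"
    by (simp_all add: d_def smax_def S00)
  moreover have "d 1 0 = p * esum T z powr (p - 1) * (\<Sum>s\<in>T. exp (z s) * w s)"
    by (simp add: d_def S00[symmetric]) (simp add: S_def mult.commute)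
  moreover have "d 2 0 = smax_hess T p z (\<lambda>s t. w s * w t)"
    by (simp add: d_def smax_hess_def S00[symmetric])
       (simp add: S_def power2_eq_square sum_product ac_simps)
  ultimately have "smax T p (\<lambda>s. z s + w s) - smax T p z
      - p * esum T z powr (p - 1) * (\<Sum>s\<in>T. exp (z s) * w s)
      - smax_hess T p z (\<lambda>s t. w s * w t) / 2 = d 3 t / 6"
    using eq by linarith
  then show ?thesis using R by (simp add: smax_def S00 mult.assoc)
qed

text \<open>The double sum has the negative coefficient \<open>p * (p - 1)\<close>, so larger
  covariances decrease the Hessian term; equal variances leave the diagonal sum unchanged. This is
  where \<open>p < 1\<close> decides the direction of the comparison.\<close>

lemma smax_hess_mono:
  assumes T: "finite T" and p: "0 < p" "p < 1"
    and le: "\<And>s t. s \<in> T \<Longrightarrow> t \<in> T \<Longrightarrow> H s t \<le> G s t"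
    and diag: "\<And>s. s \<in> T \<Longrightarrow> H s s = G s s"
  shows "smax_hess T p z G \<le> smax_hess T p z H"
proof -
  have "(\<Sum>s\<in>T. \<Sum>t\<in>T. exp (z s) * exp (z t) * H s t) \<le> (\<Sum>s\<in>T. \<Sum>t\<in>T. exp (z s) * exp (z t) * G s t)"
    using le by (intro sum_mono mult_left_mono) auto
  moreover have "p * (p - 1) * esum T z powr (p - 2) \<le> 0"
    using p by (intro mult_nonpos_nonneg mult_nonneg_nonpos) auto
  moreover have "(\<Sum>s\<in>T. exp (z s) * H s s) = (\<Sum>s\<in>T. exp (z s) * G s s)"
    using diag by (intro sum.cong) auto
  ultimately show ?thesis
    unfolding smax_hess_def by (simp add: mult_left_mono_neg)
qed


lemma borel_measurable_linf [measurable]: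
  "(\<lambda>\<omega>. linf K a \<omega> s) \<in> borel_measurable (gprod K)"
  unfolding linf_def by measurable

lemma sum_abs_linf_le:
  "(\<Sum>s\<in>T. \<bar>linf K a \<omega> s\<bar>) \<le> (\<Sum>s\<in>T. \<Sum>k\<in>K. \<bar>a s k\<bar>) * (\<Sum>k\<in>K. \<bar>\<omega> k\<bar>)"
proof (cases "finite K")
  case True
  have "\<bar>linf K a \<omega> s\<bar> \<le> (\<Sum>k\<in>K. \<bar>a s k\<bar>) * (\<Sum>k\<in>K. \<bar>\<omega> k\<bar>)" for s
  proof -
    have "\<bar>linf K a \<omega> s\<bar> \<le> (\<Sum>k\<in>K. \<bar>a s k\<bar> * \<bar>\<omega> k\<bar>)"
      unfolding linf_def by (rule order_trans[OF sum_abs]) (simp add: abs_mult)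
    also have "\<dots> \<le> (\<Sum>k\<in>K. \<bar>a s k\<bar> * (\<Sum>k\<in>K. \<bar>\<omega> k\<bar>))"
      using True by (intro sum_mono mult_left_mono member_le_sum) auto
    finally show ?thesis by (simp add: sum_distrib_right)
  qed
  then show ?thesis by (auto simp: sum_distrib_right intro!: sum_mono)
qed (simp add: linf_def)

lemma cube_le_exp: "x ^ 3 \<le> 27 * exp x" if "0 \<le> x" for x :: real
proof -
  have "x / 3 \<le> exp (x / 3)"
    using exp_ge_add_one_self[of "x / 3"] by linarith
  then have "(x / 3) ^ 3 \<le> exp (x / 3) ^ 3"
    using that by (intro power_mono) auto
  then show ?thesis
    by (simp add: exp_of_nat_mult[symmetric] power_divide)
qed

text \<open>The Taylor expansion is averaged over a Gaussian increment of size
  \<open>\<sigma>\<close>: the linear term has mean 0 and the quadratic one yields the covariance.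
  The constant depends neither on \<open>z\<close> nor on \<open>\<sigma>\<close>.\<close>

lemma smax_gaussian_step:
  fixes a :: "'s \<Rightarrow> 'k \<Rightarrow> real"
  assumes T: "finite T" "T \<noteq> {}" and p: "0 < p" "p < 1" and K: "finite K"
  obtains C where "C \<ge> 0"
    "\<And>z \<sigma>. 0 \<le> \<sigma> \<Longrightarrow> \<sigma> \<le> 1 \<Longrightarrow> integrable (gprod K) (\<lambda>\<omega>. smax T p (\<lambda>s. z s + \<sigma> * linf K a \<omega> s))"
    "\<And>z \<sigma>. 0 \<le> \<sigma> \<Longrightarrow> \<sigma> \<le> 1 \<Longrightarrow> \<bar>(\<integral>\<omega>. smax T p (\<lambda>s. z s + \<sigma> * linf K a \<omega> s) \<partial>gprod K)
       - smax T p z - \<sigma>\<^sup>2 / 2 * smax_hess T p z (gram K a)\<bar> \<le> C * \<sigma> ^ 3 * smax T p z"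
proof -
  interpret P: prob_space "gprod K"
    by (rule prob_space_gprod)
  define B where "B = (\<Sum>s\<in>T. \<Sum>k\<in>K. \<bar>a s k\<bar>)"
  define N where "N \<omega> = B * (\<Sum>k\<in>K. \<bar>\<omega> k\<bar>)" for \<omega> :: "'k \<Rightarrow> real"
  \<comment> \<open>One factor \<open>exp N\<close> bounds the exponential in the Taylor remainder,
    the other, with the 27, absorbs the cube by \<open>cube_le_exp\<close>.\<close>
  define C where "C = 27 * (\<integral>\<omega>. exp (2 * N \<omega>) \<partial>gprod K)"
  have iN: "integrable (gprod K) (\<lambda>\<omega>. exp (2 * N \<omega>))"
    using integrable_gprod_exp_sum_abs[OF K, of "2 * B"] by (simp add: N_def mult.assoc)
  have N0: "0 \<le> N \<omega>" for \<omega>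
    unfolding N_def B_def by (intro mult_nonneg_nonneg sum_nonneg) auto
  note [measurable] = borel_measurable_linf
  show ?thesis
  proof (rule that)
    show "C \<ge> 0" unfolding C_def by simp
    fix z :: "'s \<Rightarrow> real" and \<sigma> :: real assume \<sigma>: "0 \<le> \<sigma>" "\<sigma> \<le> 1"
    let ?w = "\<lambda>\<omega> s. \<sigma> * linf K a \<omega> s"
    define D1 where "D1 \<omega> = p * esum T z powr (p - 1) * (\<Sum>s\<in>T. exp (z s) * ?w \<omega> s)" for \<omega>
    define D2 where "D2 \<omega> = smax_hess T p z (\<lambda>s t. ?w \<omega> s * ?w \<omega> t) / 2" for \<omega>
    define F where "F \<omega> = smax T p (\<lambda>s. z s + ?w \<omega> s)" for \<omega>
    define R where "R \<omega> = F \<omega> - smax T p z - D1 \<omega> - D2 \<omega>" for \<omega>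
    have [measurable]: "F \<in> borel_measurable (gprod K)" "D1 \<in> borel_measurable (gprod K)" "D2 \<in> borel_measurable (gprod K)"
      unfolding F_def[abs_def] D1_def[abs_def] D2_def[abs_def] smax_def smax_hess_def esum_def by measurable
    then have [measurable]: "R \<in> borel_measurable (gprod K)"
      unfolding R_def[abs_def] by measurable
    have Rle: "\<bar>R \<omega>\<bar> \<le> 27 * exp (2 * N \<omega>) * (\<sigma> ^ 3 * smax T p z)" for \<omega>
    proof -
      let ?V = "\<Sum>s\<in>T. \<bar>linf K a \<omega> s\<bar>"
      have V: "?V \<le> N \<omega>" "0 \<le> ?V"
        using sum_abs_linf_le[of K a \<omega> T] by (auto simp: N_def B_def sum_nonneg)
      have W: "(\<Sum>s\<in>T. \<bar>?w \<omega> s\<bar>) = \<sigma> * ?V"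
        using \<sigma> by (simp add: abs_mult sum_distrib_left)
      have "\<bar>R \<omega>\<bar> \<le> (\<sigma> * ?V) ^ 3 * exp (\<sigma> * ?V) * smax T p z"
        using smax_taylor[OF T p, of z "?w \<omega>"] unfolding W R_def F_def D1_def D2_def .
      also have "\<dots> \<le> (\<sigma> * N \<omega>) ^ 3 * exp (N \<omega>) * smax T p z"
        using V \<sigma> smax_pos[OF T, of p z] N0[of \<omega>]
        by (intro mult_right_mono mult_mono power_mono) (auto intro: order_trans[OF _ V(1)] simp: mult_left_le_one_le)
      also have "\<dots> \<le> \<sigma> ^ 3 * (27 * exp (N \<omega>)) * exp (N \<omega>) * smax T p z"
        using \<sigma> smax_pos[OF T, of p z] N0[of \<omega>] cube_le_exp[OF N0[of \<omega>]]
        by (auto simp: power_mult_distrib intro!: mult_right_mono mult_left_mono)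
      also have "\<dots> = 27 * exp (2 * N \<omega>) * (\<sigma> ^ 3 * smax T p z)"
        by (simp add: exp_double power2_eq_square)
      finally show ?thesis .
    qed
    have iR: "integrable (gprod K) R"
    proof (rule Bochner_Integration.integrable_bound)
      show "integrable (gprod K) (\<lambda>\<omega>. 27 * exp (2 * N \<omega>) * (\<sigma> ^ 3 * smax T p z))"
        using iN by simp
      show "AE x in gprod K. norm (R x) \<le> norm (27 * exp (2 * N x) * (\<sigma> ^ 3 * smax T p z))"
        by (intro AE_I2, unfold real_norm_def) (rule order_trans[OF Rle abs_ge_self])
    qed simp
    have il: "integrable (gprod K) (\<lambda>\<omega>. linf K a \<omega> s)" "(\<integral>\<omega>. linf K a \<omega> s \<partial>gprod K) = 0" for s
      unfolding linf_def using K by (auto simp: integrable_gprod_coord gprod_mean)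
    have il2: "has_bochner_integral (gprod K) (\<lambda>\<omega>. linf K a \<omega> s * linf K a \<omega> t) (gram K a s t)" for s t
    proof -
      have "linf K a \<omega> s * linf K a \<omega> t = (\<Sum>k\<in>K. \<Sum>l\<in>K. a s k * a t l * (\<omega> k * \<omega> l))" for \<omega>
        unfolding linf_def sum_product by (simp add: ac_simps)
      moreover have "has_bochner_integral (gprod K) (\<lambda>\<omega>. \<Sum>k\<in>K. \<Sum>l\<in>K. a s k * a t l * (\<omega> k * \<omega> l))
          (\<Sum>k\<in>K. \<Sum>l\<in>K. a s k * a t l * (if k = l then 1 else 0))"
        using K by (intro has_bochner_integral_sum has_bochner_integral_mult_right)
          (auto simp: has_bochner_integral_iff gprod_covariance integrable_gprod_coord2)
      moreover have "(\<Sum>k\<in>K. \<Sum>l\<in>K. a s k * a t l * (if k = l then 1 else 0)) = gram K a s t"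
        using K by (simp add: gram_def if_distrib sum.delta cong: if_cong)
      ultimately show ?thesis by simp
    qed
    have D1: "has_bochner_integral (gprod K) D1 0"
    proof -
      have "has_bochner_integral (gprod K) D1 (p * esum T z powr (p - 1) * (\<Sum>s\<in>T. exp (z s) * (\<sigma> * 0)))"
        unfolding D1_def[abs_def]
        by (intro has_bochner_integral_mult_right has_bochner_integral_sum) (simp add: has_bochner_integral_iff il)
      then show ?thesis by simp
    qed
    have D2: "has_bochner_integral (gprod K) D2 (\<sigma>\<^sup>2 / 2 * smax_hess T p z (gram K a))"
    proof -
      have hess: "smax_hess T p z (\<lambda>s t. \<sigma>\<^sup>2 * G s t) = \<sigma>\<^sup>2 * smax_hess T p z G" for G
        unfolding smax_hess_def by (simp add: sum_distrib_left distrib_left ac_simps)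
      have "D2 = (\<lambda>\<omega>. \<sigma>\<^sup>2 / 2 * smax_hess T p z (\<lambda>s t. linf K a \<omega> s * linf K a \<omega> t))"
        unfolding D2_def using hess[of "\<lambda>s t. linf K a \<omega> s * linf K a \<omega> t" for \<omega>]
        by (simp add: fun_eq_iff power2_eq_square ac_simps)
      moreover have "has_bochner_integral (gprod K) (\<lambda>\<omega>. smax_hess T p z (\<lambda>s t. linf K a \<omega> s * linf K a \<omega> t))
          (smax_hess T p z (gram K a))"
        unfolding smax_hess_def
        by (intro has_bochner_integral_add has_bochner_integral_mult_right has_bochner_integral_sum il2)
      ultimately show ?thesis
        by (simp only: has_bochner_integral_mult_right)
    qed
    have Feq: "F = (\<lambda>\<omega>. (smax T p z + D1 \<omega> + D2 \<omega>) + R \<omega>)"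
      by (simp add: R_def)
    have "integrable (gprod K) F"
      unfolding Feq using D1 D2 iR by (auto simp: has_bochner_integral_iff)
    then show "integrable (gprod K) (\<lambda>\<omega>. smax T p (\<lambda>s. z s + \<sigma> * linf K a \<omega> s))"
      by (simp add: F_def[abs_def])
    have "(\<integral>\<omega>. F \<omega> \<partial>gprod K) = smax T p z + \<sigma>\<^sup>2 / 2 * smax_hess T p z (gram K a) + (\<integral>\<omega>. R \<omega> \<partial>gprod K)"
      unfolding Feq using D1 D2 iR by (simp add: has_bochner_integral_iff P.prob_space)
    moreover have "\<bar>\<integral>\<omega>. R \<omega> \<partial>gprod K\<bar> \<le> C * \<sigma> ^ 3 * smax T p z"
    proof -
      have "\<bar>\<integral>\<omega>. R \<omega> \<partial>gprod K\<bar> \<le> (\<integral>\<omega>. 27 * exp (2 * N \<omega>) * (\<sigma> ^ 3 * smax T p z) \<partial>gprod K)"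
        using iR iN Rle by (intro order_trans[OF integral_abs_bound] integral_mono) auto
      then show ?thesis by (simp add: C_def mult.assoc)
    qed
    ultimately show "\<bar>(\<integral>\<omega>. smax T p (\<lambda>s. z s + \<sigma> * linf K a \<omega> s) \<partial>gprod K)
       - smax T p z - \<sigma>\<^sup>2 / 2 * smax_hess T p z (gram K a)\<bar> \<le> C * \<sigma> ^ 3 * smax T p z"
      unfolding F_def by simp
  qed
qed


section \<open>Exchange of the two Gaussian processes\<close>

text \<open>Interpolates between the two processes through independent copies with weights
  \<open>x\<close> and \<open>y\<close>; the weights (1, 0) and (0, 1) are the two sides to be
  compared.\<close>

definition mixed_smax :: "'s set \<Rightarrow> real \<Rightarrow> 'k set \<Rightarrow> ('s \<Rightarrow> 'k \<Rightarrow> real) \<Rightarrow> 'l set \<Rightarrow> ('s \<Rightarrow> 'l \<Rightarrow> real) \<Rightarrow> real \<Rightarrow> real \<Rightarrow> ennreal" where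
  "mixed_smax T p K a L b x y =
     (\<integral>\<^sup>+\<omega>. (\<integral>\<^sup>+\<eta>. ennreal (smax T p (\<lambda>s. x * linf K a \<omega> s + y * linf L b \<eta> s)) \<partial>gprod L) \<partial>gprod K)"

lemma smax_le:
  assumes T: "finite T" "T \<noteq> {}" and p: "0 < p" "p < 1"
  shows "smax T p z \<le> card T powr p * exp (\<Sum>s\<in>T. \<bar>z s\<bar>)"
proof -
  let ?W = "\<Sum>s\<in>T. \<bar>z s\<bar>"
  have "z s \<le> ?W" if "s \<in> T" for s
    using member_le_sum[of s T "\<lambda>s. \<bar>z s\<bar>"] that T by simp
  then have "esum T z \<le> card T * exp ?W"
    unfolding esum_def by (intro sum_bounded_above) auto
  then have "smax T p z \<le> (card T * exp ?W) powr p"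
    unfolding smax_def using p esum_pos[OF T, of z] by (intro powr_mono2) auto
  also have "\<dots> = card T powr p * exp (p * ?W)"
    by (subst powr_mult) (auto simp: exp_powr_real mult.commute)
  also have "\<dots> \<le> card T powr p * exp ?W"
    using p by (intro mult_left_mono) (auto simp: mult_left_le_one_le sum_nonneg)
  finally show ?thesis .
qed

text \<open>The relative error of one exchange is proportional to \<open>mixed_smax\<close>; a bound
  uniform in the weights makes it an absolute error.\<close>

lemma mixed_smax_bounded:
  fixes a :: "'s \<Rightarrow> 'k \<Rightarrow> real" and b :: "'s \<Rightarrow> 'l \<Rightarrow> real"
  assumes T: "finite T" "T \<noteq> {}" and p: "0 < p" "p < 1" and K: "finite K" and L: "finite L"
  obtains D where "D \<ge> 0" "\<And>x y. 0 \<le> x \<Longrightarrow> x \<le> 1 \<Longrightarrow> 0 \<le> y \<Longrightarrow> y \<le> 1 \<Longrightarrow> mixed_smax T p K a L b x y \<le> ennreal D"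
proof -
  define N where "N \<omega> = (\<Sum>s\<in>T. \<Sum>k\<in>K. \<bar>a s k\<bar>) * (\<Sum>k\<in>K. \<bar>\<omega> k\<bar>)" for \<omega> :: "'k \<Rightarrow> real"
  define N' where "N' \<omega> = (\<Sum>s\<in>T. \<Sum>k\<in>L. \<bar>b s k\<bar>) * (\<Sum>k\<in>L. \<bar>\<omega> k\<bar>)" for \<omega> :: "'l \<Rightarrow> real"
  have [measurable]: "N \<in> borel_measurable (gprod K)" "N' \<in> borel_measurable (gprod L)"
    unfolding N_def[abs_def] N'_def[abs_def] by measurable
  define D where "D = card T powr p * ((\<integral>\<omega>. exp (N \<omega>) \<partial>gprod K) * (\<integral>\<omega>. exp (N' \<omega>) \<partial>gprod L))"
  show ?thesis
  proof (rule that)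
    show "D \<ge> 0" by (simp add: D_def)
    fix x y :: real assume x: "0 \<le> x" "x \<le> 1" and y: "0 \<le> y" "y \<le> 1"
    have le: "smax T p (\<lambda>s. x * linf K a \<omega> s + y * linf L b \<eta> s) \<le> card T powr p * (exp (N \<omega>) * exp (N' \<eta>))" for \<omega> \<eta>
    proof -
      have "(\<Sum>s\<in>T. \<bar>x * linf K a \<omega> s + y * linf L b \<eta> s\<bar>) \<le> (\<Sum>s\<in>T. \<bar>linf K a \<omega> s\<bar> + \<bar>linf L b \<eta> s\<bar>)"
        using x y
        by (intro sum_mono order_trans[OF abs_triangle_ineq] add_mono) (auto simp: abs_mult mult_left_le_one_le)
      also have "\<dots> \<le> N \<omega> + N' \<eta>"
        using sum_abs_linf_le[of K a \<omega> T] sum_abs_linf_le[of L b \<eta> T] by (simp add: sum.distrib N_def N'_def)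
      finally show ?thesis
        by (intro order_trans[OF smax_le[OF T p]]) (simp add: exp_add[symmetric] mult_left_mono)
    qed
    have "mixed_smax T p K a L b x y \<le> (\<integral>\<^sup>+\<omega>. (\<integral>\<^sup>+\<eta>. ennreal (card T powr p) * (ennreal (exp (N \<omega>)) * ennreal (exp (N' \<eta>))) \<partial>gprod L) \<partial>gprod K)"
      unfolding mixed_smax_def using le by (intro nn_integral_mono) (auto simp: ennreal_mult[symmetric] intro!: ennreal_leI)
    also have "\<dots> = ennreal (card T powr p) * ((\<integral>\<^sup>+\<omega>. ennreal (exp (N \<omega>)) \<partial>gprod K) * (\<integral>\<^sup>+\<eta>. ennreal (exp (N' \<eta>)) \<partial>gprod L))"
      by (simp add: nn_integral_cmult nn_integral_multc)
    also have "\<dots> = ennreal D"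
      unfolding D_def N_def N'_def using K L
      by (simp add: nn_integral_eq_integral integrable_gprod_exp_sum_abs ennreal_mult)
    finally show "mixed_smax T p K a L b x y \<le> ennreal D" .
  qed
qed

text \<open>With \<open>r = sqrt (x\<^sup>2 + y\<^sup>2)\<close> the argument on the left is a
  rotated copy of the coordinates, so two independent pieces merge into one process of weight
  \<open>r\<close>.\<close>

lemma linf_rotate:
  "r * linf K a (\<lambda>i\<in>K. (x * \<omega> i + y * \<eta> i) / r) s = x * linf K a \<omega> s + y * linf K a \<eta> s" if "r \<noteq> 0"
proof -
  have "r * (a s i * ((x * \<omega> i + y * \<eta> i) / r)) = x * (a s i * \<omega> i) + y * (a s i * \<eta> i)" for i
    using that by (simp add: field_simps)
  then show ?thesis
    unfolding linf_def by (simp add: sum_distrib_left sum.distrib[symmetric] cong: sum.cong)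
qed

text \<open>A piece of variance \<open>\<sigma>\<^sup>2\<close> is split off the first process and
  replaced by one of the second. Both are expanded around the common base point with weights
  \<open>x\<close> and \<open>y\<close>: the Hessian terms are ordered by
  \<open>smax_hess_mono\<close>, and only the third-order error remains.\<close>

lemma mixed_smax_step:
  fixes a :: "'s \<Rightarrow> 'k \<Rightarrow> real" and b :: "'s \<Rightarrow> 'l \<Rightarrow> real"
  assumes T: "finite T" "T \<noteq> {}" and p: "0 < p" "p < 1" and K: "finite K" and L: "finite L"
    and le: "\<And>s t. s \<in> T \<Longrightarrow> t \<in> T \<Longrightarrow> gram L b s t \<le> gram K a s t"
    and diag: "\<And>s. s \<in> T \<Longrightarrow> gram L b s s = gram K a s s"
  obtains C where "C \<ge> 0"
    "\<And>x y \<sigma>. 0 \<le> x \<Longrightarrow> 0 \<le> y \<Longrightarrow> x \<le> 1 \<Longrightarrow> y \<le> 1 \<Longrightarrow> 0 < \<sigma> \<Longrightarrow> \<sigma> \<le> 1 \<Longrightarrow>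
       mixed_smax T p K a L b (sqrt (x\<^sup>2 + \<sigma>\<^sup>2)) y \<le> mixed_smax T p K a L b x (sqrt (y\<^sup>2 + \<sigma>\<^sup>2)) + ennreal (C * \<sigma> ^ 3)"
proof -
  interpret PK: prob_space "gprod K" by (rule prob_space_gprod)
  interpret PL: prob_space "gprod L" by (rule prob_space_gprod)
  interpret KL: pair_prob_space "gprod K" "gprod L" ..
  obtain C1 where C1: "C1 \<ge> 0"
    "\<And>z \<sigma>. 0 \<le> \<sigma> \<Longrightarrow> \<sigma> \<le> 1 \<Longrightarrow> integrable (gprod K) (\<lambda>\<omega>. smax T p (\<lambda>s. z s + \<sigma> * linf K a \<omega> s))"
    "\<And>z \<sigma>. 0 \<le> \<sigma> \<Longrightarrow> \<sigma> \<le> 1 \<Longrightarrow> \<bar>(\<integral>\<omega>. smax T p (\<lambda>s. z s + \<sigma> * linf K a \<omega> s) \<partial>gprod K)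
       - smax T p z - \<sigma>\<^sup>2 / 2 * smax_hess T p z (gram K a)\<bar> \<le> C1 * \<sigma> ^ 3 * smax T p z"
    using smax_gaussian_step[OF T p K, of a] by blast
  obtain C2 where C2: "C2 \<ge> 0"
    "\<And>z \<sigma>. 0 \<le> \<sigma> \<Longrightarrow> \<sigma> \<le> 1 \<Longrightarrow> integrable (gprod L) (\<lambda>\<omega>. smax T p (\<lambda>s. z s + \<sigma> * linf L b \<omega> s))"
    "\<And>z \<sigma>. 0 \<le> \<sigma> \<Longrightarrow> \<sigma> \<le> 1 \<Longrightarrow> \<bar>(\<integral>\<omega>. smax T p (\<lambda>s. z s + \<sigma> * linf L b \<omega> s) \<partial>gprod L)
       - smax T p z - \<sigma>\<^sup>2 / 2 * smax_hess T p z (gram L b)\<bar> \<le> C2 * \<sigma> ^ 3 * smax T p z"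
    using smax_gaussian_step[OF T p L, of b] by blast
  obtain D where D: "D \<ge> 0" "\<And>x y. 0 \<le> x \<Longrightarrow> x \<le> 1 \<Longrightarrow> 0 \<le> y \<Longrightarrow> y \<le> 1 \<Longrightarrow> mixed_smax T p K a L b x y \<le> ennreal D"
    using mixed_smax_bounded[OF T p K L, of a b] by blast
  note [measurable] = borel_measurable_linf
  show ?thesis
  proof (rule that)
    show "(C1 + C2) * D \<ge> 0" using C1 C2 D by simp
    fix x y \<sigma> :: real assume x: "0 \<le> x" "x \<le> 1" and y: "0 \<le> y" "y \<le> 1" and \<sigma>: "0 < \<sigma>" "\<sigma> \<le> 1"
    define r where "r = sqrt (x\<^sup>2 + \<sigma>\<^sup>2)"
    define q where "q = sqrt (y\<^sup>2 + \<sigma>\<^sup>2)"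
    have r: "r > 0" "(x / r)\<^sup>2 + (\<sigma> / r)\<^sup>2 = 1"
      using \<sigma> by (auto simp: r_def sum_power2_gt_zero_iff power_divide add_divide_distrib[symmetric])
    have q: "q > 0" "(y / q)\<^sup>2 + (\<sigma> / q)\<^sup>2 = 1"
      using \<sigma> by (auto simp: q_def sum_power2_gt_zero_iff power_divide add_divide_distrib[symmetric])
    let ?z = "\<lambda>\<omega> \<eta> s. x * linf K a \<omega> s + y * linf L b \<eta> s"
    have one: "(\<integral>\<^sup>+\<omega>'. smax T p (\<lambda>s. z s + \<sigma> * linf K a \<omega>' s) \<partial>gprod K)
       \<le> (\<integral>\<^sup>+\<eta>'. smax T p (\<lambda>s. z s + \<sigma> * linf L b \<eta>' s) \<partial>gprod L) + ennreal ((C1 + C2) * \<sigma> ^ 3) * ennreal (smax T p z)" for z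
    proof -
      have pos: "0 \<le> smax T p z" for z
        using smax_pos[OF T, of p z] by simp
      have "\<sigma>\<^sup>2 / 2 * smax_hess T p z (gram K a) \<le> \<sigma>\<^sup>2 / 2 * smax_hess T p z (gram L b)"
        using smax_hess_mono[where G = "gram K a" and H = "gram L b", OF T(1) p le diag]
        by (intro mult_left_mono) auto
      then have "(\<integral>\<omega>. smax T p (\<lambda>s. z s + \<sigma> * linf K a \<omega> s) \<partial>gprod K) \<le>
         (\<integral>\<omega>. smax T p (\<lambda>s. z s + \<sigma> * linf L b \<omega> s) \<partial>gprod L) + (C1 + C2) * \<sigma> ^ 3 * smax T p z"
        using C1(3)[of \<sigma> z] C2(3)[of \<sigma> z] \<sigma> unfolding distrib_right abs_le_iff by linarith
      then show ?thesis
        using C1(1,2) C2(1,2) \<sigma> pos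
        by (simp add: nn_integral_eq_integral ennreal_mult[symmetric] ennreal_plus[symmetric] ennreal_leI del: ennreal_plus)
    qed
    have "mixed_smax T p K a L b r y
      = (\<integral>\<^sup>+\<omega>. (\<integral>\<^sup>+\<omega>'. (\<integral>\<^sup>+\<eta>. smax T p (\<lambda>s. r * linf K a (\<lambda>i\<in>K. x / r * \<omega> i + \<sigma> / r * \<omega>' i) s + y * linf L b \<eta> s) \<partial>gprod L) \<partial>gprod K) \<partial>gprod K)"
      unfolding mixed_smax_def using r \<sigma> x
      by (intro nn_integral_gprod_rotate[OF K]) (auto simp: smax_def esum_def)
    also have "\<dots> = (\<integral>\<^sup>+\<omega>. (\<integral>\<^sup>+\<omega>'. (\<integral>\<^sup>+\<eta>. smax T p (\<lambda>s. ?z \<omega> \<eta> s + \<sigma> * linf K a \<omega>' s) \<partial>gprod L) \<partial>gprod K) \<partial>gprod K)"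
      using linf_rotate[of r K a x _ \<sigma>] r by (simp add: add_divide_distrib ac_simps)
    \<comment> \<open>The fresh piece becomes the innermost integral, so that \<open>one\<close>
      applies with the base point held fixed.\<close>
    also have "\<dots> = (\<integral>\<^sup>+\<omega>. (\<integral>\<^sup>+\<eta>. (\<integral>\<^sup>+\<omega>'. smax T p (\<lambda>s. ?z \<omega> \<eta> s + \<sigma> * linf K a \<omega>' s) \<partial>gprod K) \<partial>gprod L) \<partial>gprod K)"
      by (intro nn_integral_cong KL.Fubini'[symmetric]) (auto simp: smax_def esum_def)
    also have "\<dots> \<le> (\<integral>\<^sup>+\<omega>. (\<integral>\<^sup>+\<eta>. (\<integral>\<^sup>+\<eta>'. smax T p (\<lambda>s. ?z \<omega> \<eta> s + \<sigma> * linf L b \<eta>' s) \<partial>gprod L)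
         + ennreal ((C1 + C2) * \<sigma> ^ 3) * ennreal (smax T p (?z \<omega> \<eta>)) \<partial>gprod L) \<partial>gprod K)"
      by (intro nn_integral_mono one)
    also have "\<dots> = (\<integral>\<^sup>+\<omega>. (\<integral>\<^sup>+\<eta>. (\<integral>\<^sup>+\<eta>'. smax T p (\<lambda>s. ?z \<omega> \<eta> s + \<sigma> * linf L b \<eta>' s) \<partial>gprod L) \<partial>gprod L) \<partial>gprod K)
         + ennreal ((C1 + C2) * \<sigma> ^ 3) * mixed_smax T p K a L b x y"
      unfolding mixed_smax_def smax_def esum_def
      by (subst nn_integral_cmult[symmetric], measurable, subst nn_integral_add[symmetric], measurable,
          intro nn_integral_cong, subst nn_integral_cmult[symmetric], measurable, subst nn_integral_add[symmetric], measurable)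
    also have "(\<integral>\<^sup>+\<omega>. (\<integral>\<^sup>+\<eta>. (\<integral>\<^sup>+\<eta>'. smax T p (\<lambda>s. ?z \<omega> \<eta> s + \<sigma> * linf L b \<eta>' s) \<partial>gprod L) \<partial>gprod L) \<partial>gprod K)
      = (\<integral>\<^sup>+\<omega>. (\<integral>\<^sup>+\<eta>. (\<integral>\<^sup>+\<eta>'. smax T p (\<lambda>s. x * linf K a \<omega> s + q * linf L b (\<lambda>i\<in>L. y / q * \<eta> i + \<sigma> / q * \<eta>' i) s) \<partial>gprod L) \<partial>gprod L) \<partial>gprod K)"
      using linf_rotate[of q L b y _ \<sigma>] q by (simp add: add_divide_distrib ac_simps)
    also have "\<dots> = mixed_smax T p K a L b x q"
      unfolding mixed_smax_def using q \<sigma> y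
      by (intro nn_integral_cong nn_integral_gprod_rotate[OF L, symmetric]) (auto simp: smax_def esum_def)
    also have "ennreal ((C1 + C2) * \<sigma> ^ 3) * mixed_smax T p K a L b x y \<le> ennreal ((C1 + C2) * \<sigma> ^ 3) * ennreal D"
      using D x y by (intro mult_left_mono) auto
    also have "\<dots> = ennreal ((C1 + C2) * D * \<sigma> ^ 3)"
      using D C1 C2 \<sigma> by (subst ennreal_mult[symmetric]) (auto simp: ac_simps)
    finally show "mixed_smax T p K a L b (sqrt (x\<^sup>2 + \<sigma>\<^sup>2)) y \<le> mixed_smax T p K a L b x (sqrt (y\<^sup>2 + \<sigma>\<^sup>2)) + ennreal ((C1 + C2) * D * \<sigma> ^ 3)"
      by (simp add: r_def q_def)
  qed
qed


text \<open>\<open>N\<close> exchanges with \<open>\<sigma> = 1 / sqrt N\<close> move all variance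
  from one process to the other at total cost C N \<sigma>^3 = C / sqrt N, which vanishes in the
  limit.\<close>

lemma gaussian_smax_comparison:
  fixes a :: "'s \<Rightarrow> 'k \<Rightarrow> real" and b :: "'s \<Rightarrow> 'l \<Rightarrow> real"
  assumes T: "finite T" "T \<noteq> {}" and p: "0 < p" "p < 1" and K: "finite K" and L: "finite L"
    and le: "\<And>s t. s \<in> T \<Longrightarrow> t \<in> T \<Longrightarrow> gram L b s t \<le> gram K a s t"
    and diag: "\<And>s. s \<in> T \<Longrightarrow> gram L b s s = gram K a s s"
  shows "(\<integral>\<^sup>+\<omega>. smax T p (linf K a \<omega>) \<partial>gprod K) \<le> (\<integral>\<^sup>+\<eta>. smax T p (linf L b \<eta>) \<partial>gprod L)"
proof -
  interpret PK: prob_space "gprod K" by (rule prob_space_gprod)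
  interpret PL: prob_space "gprod L" by (rule prob_space_gprod)
  let ?A = "mixed_smax T p K a L b"
  obtain C where C: "C \<ge> 0"
    "\<And>x y \<sigma>. 0 \<le> x \<Longrightarrow> 0 \<le> y \<Longrightarrow> x \<le> 1 \<Longrightarrow> y \<le> 1 \<Longrightarrow> 0 < \<sigma> \<Longrightarrow> \<sigma> \<le> 1 \<Longrightarrow>
       ?A (sqrt (x\<^sup>2 + \<sigma>\<^sup>2)) y \<le> ?A x (sqrt (y\<^sup>2 + \<sigma>\<^sup>2)) + ennreal (C * \<sigma> ^ 3)"
    using mixed_smax_step[OF T p K L le diag] by blast
  have N: "?A 1 0 \<le> ?A 0 1 + ennreal (C / sqrt (real N))" if N: "N > 0" for N :: nat
  proof -
    define \<sigma> where "\<sigma> = 1 / sqrt (real N)"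
    have \<sigma>: "0 < \<sigma>" "\<sigma> \<le> 1" "\<sigma>\<^sup>2 = 1 / real N"
      using N by (auto simp: \<sigma>_def power_divide)
    \<comment> \<open>\<open>j\<close> of the \<open>N\<close> pieces still belong to the first
      process; \<open>j = N\<close> is the left side and \<open>j = 0\<close> the right side of the
      comparison.\<close>
    have "?A (sqrt (real j / real N)) (sqrt (real (N - j) / real N)) \<le> ?A 0 1 + ennreal (real j * (C * \<sigma> ^ 3))"
      if "j \<le> N" for j
      using that
    proof (induction j)
      case (Suc j)
      let ?x = "sqrt (real j / real N)" and ?y = "sqrt (real (N - Suc j) / real N)"
      have x: "sqrt (?x\<^sup>2 + \<sigma>\<^sup>2) = sqrt (real (Suc j) / real N)"
        by (simp add: \<sigma> add_divide_distrib)
      have y: "sqrt (?y\<^sup>2 + \<sigma>\<^sup>2) = sqrt (real (N - j) / real N)"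
        using Suc.prems by (simp add: \<sigma> add_divide_distrib[symmetric] of_nat_diff)
      have "?A (sqrt (real (Suc j) / real N)) ?y \<le> ?A ?x (sqrt (real (N - j) / real N)) + ennreal (C * \<sigma> ^ 3)"
        using C(2)[of ?x ?y \<sigma>] \<sigma> Suc.prems unfolding x y by simp
      also have "\<dots> \<le> (?A 0 1 + ennreal (real j * (C * \<sigma> ^ 3))) + ennreal (C * \<sigma> ^ 3)"
        using Suc by (intro add_right_mono) auto
      also have "\<dots> = ?A 0 1 + ennreal (real (Suc j) * (C * \<sigma> ^ 3))"
        using C \<sigma> by (simp add: add.assoc ennreal_plus[symmetric] algebra_simps del: ennreal_plus)
      finally show ?case .
    qed (use N in simp)
    from this[of N] have "?A 1 0 \<le> ?A 0 1 + ennreal (real N * (C * \<sigma> ^ 3))"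
      using N by simp
    also have "real N * (C * \<sigma> ^ 3) = C * \<sigma> * (real N * \<sigma>\<^sup>2)"
      by (simp add: power2_eq_square power3_eq_cube)
    also have "\<dots> = C / sqrt (real N)"
      using N by (simp add: \<sigma>) (simp add: \<sigma>_def)
    finally show ?thesis .
  qed
  have "?A 1 0 \<le> ?A 0 1"
  proof (rule ennreal_le_epsilon)
    fix e :: real assume e: "0 < e"
    obtain n :: nat where n: "real n > (C / e)\<^sup>2"
      using reals_Archimedean2 by blast
    then have "n > 0" using of_nat_0_less_iff[of n] zero_le_power2[of "C / e"] by linarith
    have "C / e \<le> sqrt (real n)"
      using n C e by (intro real_le_rsqrt) auto
    then have "C / sqrt (real n) \<le> e"
      using e \<open>n > 0\<close> by (simp add: field_simps)
    then show "?A 1 0 \<le> ?A 0 1 + ennreal e"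
      using order_trans[OF N[OF \<open>n > 0\<close>] add_left_mono[OF ennreal_leI]] by blast
  qed
  then show ?thesis
    by (simp add: mixed_smax_def PK.emeasure_space_1 PL.emeasure_space_1)
qed

text \<open>A Slepian inequality for exponential moments of maxima. Scaling both processes by
  \<open>c / p\<close> multiplies both covariances by the same factor, so their order survives, and
  \<open>p\<close> then tends to 0.\<close>

theorem gaussian_max_comparison:
  fixes a :: "'s \<Rightarrow> 'k \<Rightarrow> real" and b :: "'s \<Rightarrow> 'l \<Rightarrow> real"
  assumes T: "finite T" "T \<noteq> {}" and K: "finite K" and L: "finite L" and c: "0 < c"
    and le: "\<And>s t. s \<in> T \<Longrightarrow> t \<in> T \<Longrightarrow> gram L b s t \<le> gram K a s t"
    and diag: "\<And>s. s \<in> T \<Longrightarrow> gram L b s s = gram K a s s"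
  shows "(\<integral>\<^sup>+\<omega>. exp (c * Max (linf K a \<omega> ` T)) \<partial>gprod K) \<le> (\<integral>\<^sup>+\<eta>. exp (c * Max (linf L b \<eta> ` T)) \<partial>gprod L)"
    (is "?X \<le> ?Y")
proof -
  have lo: "exp (c * Max (z ` T)) \<le> smax T p (\<lambda>s. c / p * z s)"
    and up: "smax T p (\<lambda>s. c / p * z s) \<le> card T powr p * exp (c * Max (z ` T))" if p: "0 < p" for p and z :: "'s \<Rightarrow> real"
  proof -
    let ?m = "Max (z ` T)"
    obtain s where s: "s \<in> T" "z s = ?m"
      using Max_in[of "z ` T"] T by fastforce
    have e: "exp (c / p * x) powr p = exp (c * x)" for x
      using p by (simp add: exp_powr_real)
    have "exp (c / p * ?m) \<le> esum T (\<lambda>s. c / p * z s)"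
      unfolding esum_def s(2)[symmetric] using s T by (intro member_le_sum) auto
    then have "exp (c / p * ?m) powr p \<le> smax T p (\<lambda>s. c / p * z s)"
      unfolding smax_def using p by (intro powr_mono2) auto
    then show "exp (c * ?m) \<le> smax T p (\<lambda>s. c / p * z s)" unfolding e .
    have "esum T (\<lambda>s. c / p * z s) \<le> card T * exp (c / p * ?m)"
      unfolding esum_def using T p c
      by (intro sum_bounded_above) (auto intro!: divide_right_mono mult_left_mono)
    then have "smax T p (\<lambda>s. c / p * z s) \<le> (card T * exp (c / p * ?m)) powr p"
      unfolding smax_def using p esum_pos[OF T] by (intro powr_mono2) (auto intro: less_imp_le)
    then show "smax T p (\<lambda>s. c / p * z s) \<le> card T powr p * exp (c * ?m)"
      unfolding powr_mult e .
  qed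
  have sc: "linf K' (\<lambda>s k. r * a' s k) \<omega> = (\<lambda>s. r * linf K' a' \<omega> s)"
    "gram K' (\<lambda>s k. r * a' s k) s t = r\<^sup>2 * gram K' a' s t" for K' :: "'z set" and r a' \<omega> and s t :: 's
    by (auto simp: linf_def gram_def sum_distrib_left power2_eq_square ac_simps)
  have "?X \<le> ennreal (card T powr p) * ?Y" if p: "0 < p" "p < 1" for p
  proof -
    have "?X \<le> (\<integral>\<^sup>+\<omega>. smax T p (linf K (\<lambda>s k. c / p * a s k) \<omega>) \<partial>gprod K)"
      unfolding sc using lo p by (intro nn_integral_mono ennreal_leI) auto
    also have "\<dots> \<le> (\<integral>\<^sup>+\<eta>. smax T p (linf L (\<lambda>s k. c / p * b s k) \<eta>) \<partial>gprod L)"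
      using le diag by (intro gaussian_smax_comparison T p K L) (auto simp only: sc intro!: mult_left_mono zero_le_power2)
    also have "\<dots> \<le> (\<integral>\<^sup>+\<eta>. ennreal (card T powr p) * ennreal (exp (c * Max (linf L b \<eta> ` T))) \<partial>gprod L)"
      unfolding sc using up p by (intro nn_integral_mono) (auto simp: ennreal_mult[symmetric] intro!: ennreal_leI)
    also have "\<dots> = ennreal (card T powr p) * ?Y"
      using T by (intro nn_integral_cmult) simp
    finally show ?thesis .
  qed
  \<comment> \<open>The choice \<open>1 / (n + 2)\<close> for \<open>p\<close> stays strictly
    between 0 and 1 for every \<open>n\<close>.\<close>
  then have le: "?X \<le> ennreal (card T powr (1 / (real n + 2))) * ?Y" for n
    by simp
  have lim: "(\<lambda>n. ennreal (card T powr (1 / (real n + 2))) * ?Y) \<longlonglongrightarrow> ennreal (card T powr 0) * ?Y"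
  proof (intro tendsto_mult_ennreal tendsto_const tendsto_ennrealI tendsto_powr)
    show "(\<lambda>n. 1 / (real n + 2)) \<longlonglongrightarrow> 0" by real_asymp
  qed (use T in auto)
  have "?X \<le> ennreal (card T powr 0) * ?Y"
    by (rule LIMSEQ_le_const[OF lim]) (use le in blast)
  then show ?thesis using T by simp
qed

subsection \<open>Sums of the largest normal variables\<close>

lemma prob_gauss_UNIV [simp]: "measure gauss UNIV = 1"
  using gauss.prob_space by simp

section \<open>Exponential moments of Lipschitz functions\<close>

lemma lipschitz_borel_measurable:
  fixes \<phi> :: "real \<Rightarrow> real"
  assumes "\<And>x y. \<bar>\<phi> x - \<phi> y\<bar> \<le> \<bar>x - y\<bar>"
  shows "\<phi> \<in> borel_measurable borel"
proof -
  have "1-lipschitz_on UNIV \<phi>"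
    using assms by (intro lipschitz_onI) (auto simp: dist_real_def)
  then show ?thesis
    by (intro borel_measurable_continuous_onI lipschitz_on_continuous_on)
qed

lemma integrable_gauss_lipschitz:
  fixes \<phi> :: "real \<Rightarrow> real"
  assumes lip: "\<And>x y. \<bar>\<phi> x - \<phi> y\<bar> \<le> \<bar>x - y\<bar>"
  shows "integrable gauss \<phi>" "integrable gauss (\<lambda>x. exp (c * \<phi> x))"
proof -
  have [measurable]: "\<phi> \<in> borel_measurable borel"
    by (rule lipschitz_borel_measurable[OF lip])
  have b: "\<bar>\<phi> x\<bar> \<le> \<bar>\<phi> 0\<bar> + \<bar>x\<bar>" for x
    using lip[of x 0] by simp
  show "integrable gauss \<phi>"
  proof (rule Bochner_Integration.integrable_bound)
    show "integrable gauss (\<lambda>x. \<bar>\<phi> 0\<bar> + \<bar>x\<bar>)"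
      using gauss_id by auto
    show "AE x in gauss. norm (\<phi> x) \<le> norm (\<bar>\<phi> 0\<bar> + \<bar>x\<bar>)"
      using b by auto
  qed simp
  show "integrable gauss (\<lambda>x. exp (c * \<phi> x))"
  proof (rule Bochner_Integration.integrable_bound)
    show "integrable gauss (\<lambda>x. exp (\<bar>c\<bar> * \<bar>\<phi> 0\<bar>) * exp (\<bar>c\<bar> * \<bar>x\<bar>))"
      by simp
    have "c * \<phi> x \<le> \<bar>c\<bar> * (\<bar>\<phi> 0\<bar> + \<bar>x\<bar>)" for x
      using b[of x] by (metis abs_ge_self abs_ge_zero abs_mult mult_left_mono order_trans)
    then show "AE x in gauss. norm (exp (c * \<phi> x)) \<le> norm (exp (\<bar>c\<bar> * \<bar>\<phi> 0\<bar>) * exp (\<bar>c\<bar> * \<bar>x\<bar>))"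
      by (simp add: exp_add[symmetric] distrib_left)
  qed simp
qed

lemma exp_expectation_le:
  fixes f :: "'a \<Rightarrow> real"
  assumes "prob_space M" "integrable M f" "integrable M (\<lambda>x. exp (c * f x))"
  shows "exp (c * (\<integral>x. f x \<partial>M)) \<le> (\<integral>x. exp (c * f x) \<partial>M)"
proof -
  interpret prob_space M by fact
  have "convex_on UNIV (\<lambda>x::real. exp x)"
    using convex_on_exp[of 1] by simp
  then show ?thesis
    using jensens_inequality[of "\<lambda>x. c * f x" UNIV 0 0 exp] assms by simp
qed

lemma exp_symmetric_mono:
  fixes u v :: real
  assumes "\<bar>u\<bar> \<le> \<bar>v\<bar>"
  shows "exp u + exp (- u) \<le> exp v + exp (- v)"
proof -
  have "cosh \<bar>u\<bar> \<le> cosh \<bar>v\<bar>"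
    using assms by (subst cosh_real_nonneg_le_iff) auto
  then show ?thesis
    unfolding cosh_def by (auto simp: abs_if split: if_splits)
qed

text \<open>By Jensen, the exponential moment of the centred variable is at most that of the difference of
  two independent copies; the difference is symmetric, so the Lipschitz bound can be applied inside
  cosh.\<close>

lemma gauss_lipschitz_exp_le:
  fixes \<phi> :: "real \<Rightarrow> real"
  assumes lip: "\<And>x y. \<bar>\<phi> x - \<phi> y\<bar> \<le> \<bar>x - y\<bar>"
  shows "(\<integral>x. exp (c * \<phi> x) \<partial>gauss) \<le> exp (c * (\<integral>x. \<phi> x \<partial>gauss) + c\<^sup>2)"
proof -
  note int = integrable_gauss_lipschitz[OF lip]
  have [measurable]: "\<phi> \<in> borel_measurable borel"
    by (rule lipschitz_borel_measurable[OF lip])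
  define a where "a = (\<integral>x. exp (c * \<phi> x) \<partial>gauss)"
  define b where "b = (\<integral>x. exp ((- c) * \<phi> x) \<partial>gauss)"
  have b: "exp (- c * (\<integral>x. \<phi> x \<partial>gauss)) \<le> b"
    unfolding b_def by (intro exp_expectation_le prob_space_gauss int)
  have a0: "0 \<le> a" by (simp add: a_def)
  have ec: "(\<integral>y. exp (- (c * y)) \<partial>gauss) = exp (c\<^sup>2 / 2)" "integrable gauss (\<lambda>y. exp (- (c * y)))"
    using integral_exp_gauss[of "- c"] integrable_exp_gauss[of "- c"] by auto
  have i2: "integrable gauss (\<lambda>x. exp (- (c * \<phi> x)))"
    using int(2)[of "- c"] by simp
  have "2 * (a * b) = (\<integral>x. (\<integral>y. exp (c * \<phi> x) * exp (- (c * \<phi> y)) + exp (c * \<phi> y) * exp (- (c * \<phi> x)) \<partial>gauss) \<partial>gauss)"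
    using int(2)[of c] i2 by (simp add: a_def b_def)
  also have "\<dots> \<le> (\<integral>x. (\<integral>y. exp (c * x) * exp (- (c * y)) + exp (c * y) * exp (- (c * x)) \<partial>gauss) \<partial>gauss)"
  proof (intro integral_mono)
    fix x y
    have "\<bar>c * \<phi> x - c * \<phi> y\<bar> \<le> \<bar>c * x - c * y\<bar>"
      using mult_left_mono[OF lip[of x y], of "\<bar>c\<bar>"] by (simp add: abs_mult[symmetric] right_diff_distrib)
    from exp_symmetric_mono[OF this]
    show "exp (c * \<phi> x) * exp (- (c * \<phi> y)) + exp (c * \<phi> y) * exp (- (c * \<phi> x))
       \<le> exp (c * x) * exp (- (c * y)) + exp (c * y) * exp (- (c * x))"
      by (simp add: exp_add[symmetric])
  qed (use int(2)[of c] i2 ec in simp_all)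
  also have "\<dots> = 2 * (exp (c\<^sup>2 / 2) * exp (c\<^sup>2 / 2))"
    using ec by (simp add: integral_exp_gauss)
  finally have ab: "a * b \<le> exp (c\<^sup>2)"
    by (simp add: exp_add[symmetric])
  have "a * exp (- c * (\<integral>x. \<phi> x \<partial>gauss)) \<le> exp (c\<^sup>2)"
    using mult_left_mono[OF b a0] ab by linarith
  then have "a * exp (- c * (\<integral>x. \<phi> x \<partial>gauss)) * exp (c * (\<integral>x. \<phi> x \<partial>gauss)) \<le> exp (c\<^sup>2) * exp (c * (\<integral>x. \<phi> x \<partial>gauss))"
    by (intro mult_right_mono) auto
  then show ?thesis
    by (simp add: a_def mult.assoc exp_add[symmetric] add.commute)
qed

lemma lipschitz_linear_growth:
  fixes f :: "('i \<Rightarrow> real) \<Rightarrow> real"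
  assumes "\<And>x y. \<bar>f x - f y\<bar> \<le> (\<Sum>i\<in>I. \<bar>x i - y i\<bar>)"
  shows "\<bar>f x\<bar> \<le> \<bar>f (\<lambda>_. 0)\<bar> + 1 * (\<Sum>i\<in>I. \<bar>x i\<bar>)"
  using assms[of x "\<lambda>_. 0"] by simp

text \<open>Tensorisation: integrating out one coordinate preserves the Lipschitz bound in the
  remaining ones and costs a factor \<open>exp (c\<^sup>2)\<close> by the one-dimensional
  case.\<close>

lemma gprod_lipschitz_exp_le:
  fixes f :: "('i \<Rightarrow> real) \<Rightarrow> real" and c :: real
  assumes "finite I" "f \<in> borel_measurable (gprod I)"
    and "\<And>x y. \<bar>f x - f y\<bar> \<le> (\<Sum>i\<in>I. \<bar>x i - y i\<bar>)"
  shows "(\<integral>x. exp (c * f x) \<partial>gprod I) \<le> exp (c * (\<integral>x. f x \<partial>gprod I) + card I * c\<^sup>2)"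
  using assms
proof (induction I arbitrary: f rule: finite_induct)
  case empty
  show ?case by (simp add: PiM_empty lebesgue_integral_count_space_finite)
next
  case (insert i I)
  note lip = insert.prems(2)
  note [measurable] = insert.prems(1)
  have fin: "finite (insert i I)" using insert by simp
  note int = integrable_gprod_linear_growth[OF fin insert.prems(1) lipschitz_linear_growth[OF lip]]
  \<comment> \<open>The conditional expectation given the coordinates in \<open>I\<close>; the
    induction hypothesis is applied to it.\<close>
  define g where "g x = (\<integral>t. f (x(i := t)) \<partial>gauss)" for x
  have up: "(\<lambda>z. f ((fst z)(i := snd z))) \<in> borel_measurable (gprod I \<Otimes>\<^sub>M gauss)"
    using measurable_comp[OF measurable_add_dim insert.prems(1)]
    by (simp add: comp_def case_prod_beta)
  have sec: "\<bar>f (x(i := t)) - f (x(i := u))\<bar> \<le> \<bar>t - u\<bar>" for x t u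
  proof -
    have "(\<Sum>j\<in>insert i I. \<bar>(x(i := t)) j - (x(i := u)) j\<bar>) = \<bar>t - u\<bar>"
      using insert.hyps by (subst sum.insert) (auto intro!: sum.neutral)
    then show ?thesis using lip[of "x(i := t)" "x(i := u)"] by metis
  qed
  have sec': "integrable gauss (\<lambda>t. f (x(i := t)))" for x
    using integrable_gauss_lipschitz(1)[of "\<lambda>t. f (x(i := t))"] sec by blast
  have g [measurable]: "g \<in> borel_measurable (gprod I)"
    unfolding g_def[abs_def] using up
    by (intro gauss.borel_measurable_lebesgue_integral) (simp add: case_prod_beta)
  have glip: "\<bar>g x - g y\<bar> \<le> (\<Sum>i\<in>I. \<bar>x i - y i\<bar>)" for x y
  proof -
    have p: "\<bar>f (x(i := t)) - f (y(i := t))\<bar> \<le> (\<Sum>i\<in>I. \<bar>x i - y i\<bar>)" for t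
    proof -
      have "(\<Sum>j\<in>I. \<bar>(x(i := t)) j - (y(i := t)) j\<bar>) = (\<Sum>i\<in>I. \<bar>x i - y i\<bar>)"
        using insert.hyps by (intro sum.cong) auto
      then show ?thesis
        using lip[of "x(i := t)" "y(i := t)"] insert.hyps by (simp del: fun_upd_apply add: fun_upd_same)
    qed
    have "\<bar>g x - g y\<bar> = \<bar>\<integral>t. f (x(i := t)) - f (y(i := t)) \<partial>gauss\<bar>"
      unfolding g_def using sec' by (subst Bochner_Integration.integral_diff) auto
    also have "\<dots> \<le> (\<integral>t. \<bar>f (x(i := t)) - f (y(i := t))\<bar> \<partial>gauss)"
      by (rule integral_abs_bound)
    also have "\<dots> \<le> (\<integral>t. (\<Sum>i\<in>I. \<bar>x i - y i\<bar>) \<partial>gauss)"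
      using sec' p by (intro integral_mono) auto
    finally show ?thesis by (simp add: gauss.prob_space)
  qed
  note gint = integrable_gprod_linear_growth[OF insert.hyps(1) g lipschitz_linear_growth[OF glip]]
  have mean: "(\<integral>x. g x \<partial>gprod I) = (\<integral>x. f x \<partial>gprod (insert i I))"
    unfolding g_def using insert.hyps int(1) by (subst GP.product_integral_insert) auto
  have "(\<integral>x. exp (c * f x) \<partial>gprod (insert i I)) = (\<integral>x. (\<integral>t. exp (c * f (x(i := t))) \<partial>gauss) \<partial>gprod I)"
    using insert.hyps int(2) by (subst GP.product_integral_insert) auto
  also have "\<dots> \<le> (\<integral>x. exp (c * g x) * exp (c\<^sup>2) \<partial>gprod I)"
  proof (rule integral_mono')
    show "(\<integral>t. exp (c * f (x(i := t))) \<partial>gauss) \<le> exp (c * g x) * exp (c\<^sup>2)" for x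
      using gauss_lipschitz_exp_le[of "\<lambda>t. f (x(i := t))" c] sec
      by (simp add: g_def exp_add)
  qed (use gint in auto)
  also have "\<dots> = (\<integral>x. exp (c * g x) \<partial>gprod I) * exp (c\<^sup>2)"
    by simp
  also have "\<dots> \<le> exp (c * (\<integral>x. g x \<partial>gprod I) + card I * c\<^sup>2) * exp (c\<^sup>2)"
    by (intro mult_right_mono insert.IH g glip) auto
  also have "\<dots> = exp (c * (\<integral>x. f x \<partial>gprod (insert i I)) + card (insert i I) * c\<^sup>2)"
    using insert.hyps by (simp add: mean exp_add[symmetric] algebra_simps)
  finally show ?case .
qed

section \<open>Maxima over subsets of fixed size\<close>

definition ksets :: "nat \<Rightarrow> nat \<Rightarrow> nat set set" where
  "ksets N k = {S. S \<subseteq> {1..N} \<and> card S = k}"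

text \<open>The sum of the \<open>k\<close> largest entries as a maximum of linear forms, which
  gives measurability and the Lipschitz bound without ordering the entries.\<close>

definition topsum :: "nat \<Rightarrow> nat \<Rightarrow> (nat \<Rightarrow> real) \<Rightarrow> real" where
  "topsum N k x = Max ((\<lambda>S. \<Sum>i\<in>S. x i) ` ksets N k)"

lemma finite_ksets [simp]: "finite (ksets N k)"
  unfolding ksets_def by (rule finite_subset[of _ "Pow {1..N}"]) auto

lemma ksets_finite_sub: "S \<in> ksets N k \<Longrightarrow> finite S \<and> S \<subseteq> {1..N} \<and> card S = k"
  unfolding ksets_def by (auto intro: finite_subset)

lemma card_ksets: "card (ksets N k) = N choose k"
  unfolding ksets_def using n_subsets[of "{1..N}" k] by simp

lemma ksets_nonempty: "k \<le> N \<Longrightarrow> ksets N k \<noteq> {}"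
  using card_ksets[of N k] by (metis binomial_eq_0_iff card.empty not_less)

lemma topsum_ge: "S \<in> ksets N k \<Longrightarrow> (\<Sum>i\<in>S. x i) \<le> topsum N k x"
  unfolding topsum_def by (intro Max_ge) auto

lemma topsum_le_iff: "k \<le> N \<Longrightarrow> topsum N k x \<le> b \<longleftrightarrow> (\<forall>S\<in>ksets N k. (\<Sum>i\<in>S. x i) \<le> b)"
  unfolding topsum_def using ksets_nonempty[of k N] by (subst Max_le_iff) auto

lemma topsum_lipschitz:
  assumes k: "k \<le> N"
  shows "\<bar>topsum N k x - topsum N k y\<bar> \<le> (\<Sum>i\<in>{1..N}. \<bar>x i - y i\<bar>)"
proof -
  have le: "topsum N k x \<le> topsum N k y + (\<Sum>i\<in>{1..N}. \<bar>x i - y i\<bar>)" for x y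
    unfolding topsum_le_iff[OF k]
  proof
    fix S assume S: "S \<in> ksets N k"
    have "(\<Sum>i\<in>S. x i) \<le> (\<Sum>i\<in>S. y i + \<bar>x i - y i\<bar>)"
      by (intro sum_mono) (auto simp: abs_if)
    also have "\<dots> \<le> topsum N k y + (\<Sum>i\<in>{1..N}. \<bar>x i - y i\<bar>)"
      unfolding sum.distrib using ksets_finite_sub[OF S]
      by (intro add_mono topsum_ge S sum_mono2) auto
    finally show "(\<Sum>i\<in>S. x i) \<le> topsum N k y + (\<Sum>i\<in>{1..N}. \<bar>x i - y i\<bar>)" .
  qed
  show ?thesis
    using le[of x y] le[of y x] by (simp add: abs_le_iff abs_minus_commute)
qed

lemma topsum_measurable [measurable]: "topsum N k \<in> borel_measurable (gprod {1..N})"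
  unfolding topsum_def[abs_def]
proof (intro borel_measurable_Max)
  fix S assume "S \<in> ksets N k"
  then show "(\<lambda>x. \<Sum>i\<in>S. x i) \<in> borel_measurable (gprod {1..N})"
    by (intro borel_measurable_sum) (use ksets_finite_sub[of S N k] in auto)
qed simp

lemma topsum_integrable:
  assumes "k \<le> N"
  shows "integrable (gprod {1..N}) (topsum N k)" "integrable (gprod {1..N}) (\<lambda>x. exp (c * topsum N k x))"
  using integrable_gprod_linear_growth[OF _ topsum_measurable lipschitz_linear_growth[OF topsum_lipschitz[OF assms]]]
  by auto

section \<open>Upper and lower bounds for the moment generating function\<close>

definition mgf :: "nat \<Rightarrow> nat \<Rightarrow> real \<Rightarrow> real" where
  "mgf N k c = (\<integral>x. exp (c * topsum N k x) \<partial>gprod {1..N})"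

definition topmean :: "nat \<Rightarrow> nat \<Rightarrow> real" where
  "topmean N k = (\<integral>x. topsum N k x \<partial>gprod {1..N})"

lemma mgf_ge_exp_mean: "k \<le> N \<Longrightarrow> exp (c * topmean N k) \<le> mgf N k c"
  unfolding mgf_def topmean_def by (intro exp_expectation_le prob_space_gprod topsum_integrable)

lemma mgf_pos: "k \<le> N \<Longrightarrow> 0 < mgf N k c"
  using mgf_ge_exp_mean[of k N c] by (rule less_le_trans[OF exp_gt_zero])

text \<open>Together with Jensen's bound \<open>mgf_ge_exp_mean\<close> this determines
  \<open>ln (mgf N k c) / c\<close> up to \<open>N * c\<close> for positive
  \<open>c\<close>.\<close>

lemma mgf_le_concentration: "k \<le> N \<Longrightarrow> mgf N k c \<le> exp (c * topmean N k + N * c\<^sup>2)"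
  unfolding mgf_def topmean_def
  using gprod_lipschitz_exp_le[OF finite_atLeastAtMost topsum_measurable topsum_lipschitz, where c = c] by simp

text \<open>Up to reflecting the normal variable and rescaling \<open>c\<close> this is
  \<open>I2\<close>, as shown in \<open>I2_eq_plus_mgf\<close>.\<close>

definition plus_mgf :: "real \<Rightarrow> real \<Rightarrow> real" where
  "plus_mgf c \<nu> = (\<integral>t. exp (c * max (t - \<nu>) 0) \<partial>gauss)"

lemma integrable_plus_mgf [simp]: "integrable gauss (\<lambda>t. exp (c * max (t - \<nu>) 0))"
  by (rule integrable_gauss_lipschitz) (auto simp: max_def abs_if)

lemma plus_mgf_ge_1: "0 \<le> c \<Longrightarrow> 1 \<le> plus_mgf c \<nu>"
proof -
  assume c: "0 \<le> c"
  have "(\<integral>t. 1 \<partial>gauss) \<le> plus_mgf c \<nu>"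
    unfolding plus_mgf_def using c by (intro integral_mono) auto
  then show ?thesis by (simp add: gauss.prob_space)
qed

lemma plus_mgf_ge_exp: "0 \<le> c \<Longrightarrow> exp (c\<^sup>2 / 2 - c * \<nu>) \<le> plus_mgf c \<nu>"
proof -
  assume c: "0 \<le> c"
  have "(\<integral>t. exp (c * t) * exp (- (c * \<nu>)) \<partial>gauss) \<le> plus_mgf c \<nu>"
    unfolding plus_mgf_def
  proof (intro integral_mono)
    fix t
    have "c * (t - \<nu>) \<le> c * max (t - \<nu>) 0"
      using c by (intro mult_left_mono) auto
    then show "exp (c * t) * exp (- (c * \<nu>)) \<le> exp (c * max (t - \<nu>) 0)"
      by (simp add: exp_add[symmetric] algebra_simps)
  qed auto
  then have "exp (c\<^sup>2 / 2) * exp (- (c * \<nu>)) \<le> plus_mgf c \<nu>"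
    by (simp add: integral_exp_gauss)
  then show ?thesis by (simp add: exp_add[symmetric])
qed

text \<open>Each entry is at most \<open>\<nu>\<close> plus its excess over \<open>\<nu>\<close>.
  Summing over the \<open>k\<close> chosen entries and enlarging the excess to all \<open>N\<close>
  entries leaves a product of independent factors.\<close>

lemma mgf_le_plus_mgf:
  assumes k: "k \<le> N" and c: "0 \<le> c"
  shows "mgf N k c \<le> exp (c * (real k * \<nu>)) * plus_mgf c \<nu> ^ N"
proof -
  have le: "topsum N k x \<le> real k * \<nu> + (\<Sum>i\<in>{1..N}. max (x i - \<nu>) 0)" for x
    unfolding topsum_le_iff[OF k]
  proof
    fix S assume S: "S \<in> ksets N k"
    have "(\<Sum>i\<in>S. x i) \<le> (\<Sum>i\<in>S. \<nu> + max (x i - \<nu>) 0)"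
      by (intro sum_mono) auto
    also have "\<dots> \<le> real k * \<nu> + (\<Sum>i\<in>{1..N}. max (x i - \<nu>) 0)"
      unfolding sum.distrib using ksets_finite_sub[OF S] by (intro add_mono sum_mono2) auto
    finally show "(\<Sum>i\<in>S. x i) \<le> real k * \<nu> + (\<Sum>i\<in>{1..N}. max (x i - \<nu>) 0)" .
  qed
  have i: "integrable (gprod {1..N}) (\<lambda>x. \<Prod>i\<in>{1..N}. exp (c * max (x i - \<nu>) 0))"
    by (intro GP.product_integrable_prod) auto
  have "mgf N k c \<le> (\<integral>x. exp (c * (real k * \<nu>)) * (\<Prod>i\<in>{1..N}. exp (c * max (x i - \<nu>) 0)) \<partial>gprod {1..N})"
    unfolding mgf_def
  proof (intro integral_mono topsum_integrable k)
    fix x :: "nat \<Rightarrow> real"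
    have "c * topsum N k x \<le> c * (real k * \<nu> + (\<Sum>i\<in>{1..N}. max (x i - \<nu>) 0))"
      using le c by (rule mult_left_mono)
    then show "exp (c * topsum N k x) \<le> exp (c * (real k * \<nu>)) * (\<Prod>i\<in>{1..N}. exp (c * max (x i - \<nu>) 0))"
      by (simp add: exp_sum[symmetric] exp_add[symmetric] sum_distrib_left[symmetric] distrib_left)
  qed (use i in simp)
  also have "\<dots> = exp (c * (real k * \<nu>)) * plus_mgf c \<nu> ^ N"
    using GP.product_integral_prod[of "{1..N}" "\<lambda>_ t. exp (c * max (t - \<nu>) 0)"]
    by (simp add: plus_mgf_def)
  finally show ?thesis .
qed

text \<open>The fixed subset \<open>{1..k}\<close> already contributes a normal sum of variance
  \<open>k\<close>. This is the source of the lower bound \<open>c / 2\<close> for each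
  block.\<close>

lemma mgf_ge_gaussian:
  assumes k: "k \<le> N" and c: "0 \<le> c"
  shows "exp (c\<^sup>2 / 2) ^ k \<le> mgf N k c"
proof -
  let ?f = "\<lambda>i t. if i \<le> k then exp (c * t) else 1"
  have int: "integrable gauss (?f i)" for i by (cases "i \<le> k") auto
  have "(\<integral>x. (\<Prod>i\<in>{1..N}. ?f i (x i)) \<partial>gprod {1..N}) = (\<Prod>i\<in>{1..N}. \<integral>t. ?f i t \<partial>gauss)"
    using int by (intro GP.product_integral_prod) auto
  also have "\<dots> = (\<Prod>i\<in>{1..N}. if i \<in> {1..k} then exp (c\<^sup>2 / 2) else 1)"
    by (intro prod.cong) (auto simp: integral_exp_gauss gauss.prob_space)
  also have "\<dots> = exp (c\<^sup>2 / 2) ^ k"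
    using k by (subst prod.inter_restrict[symmetric]) (auto simp: Int_absorb1)
  finally have eq: "exp (c\<^sup>2 / 2) ^ k = (\<integral>x. (\<Prod>i\<in>{1..N}. ?f i (x i)) \<partial>gprod {1..N})" ..
  show ?thesis
    unfolding eq mgf_def
  proof (intro integral_mono topsum_integrable k GP.product_integrable_prod int)
    fix x :: "nat \<Rightarrow> real"
    have "(\<Prod>i\<in>{1..N}. ?f i (x i)) = (\<Prod>i\<in>{1..N}. if i \<in> {1..k} then exp (c * x i) else 1)"
      by (intro prod.cong) auto
    also have "\<dots> = (\<Prod>i\<in>{1..k}. exp (c * x i))"
      using k by (subst prod.inter_restrict[symmetric]) (auto simp: Int_absorb1)
    also have "\<dots> = exp (c * (\<Sum>i\<in>{1..k}. x i))"
      by (simp add: exp_sum sum_distrib_left)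
    also have "\<dots> \<le> exp (c * topsum N k x)"
      using k c topsum_ge[of "{1..k}" N k x] by (auto simp: ksets_def intro!: mult_left_mono)
    finally show "(\<Prod>i\<in>{1..N}. ?f i (x i)) \<le> exp (c * topsum N k x)" .
  qed simp
qed

section \<open>The event that exactly the largest entries exceed a level\<close>

text \<open>The terms \<open>t j\<close> of the binomial expansion of
  \<open>(k + (N - k)) ^ N\<close> increase up to \<open>j = k\<close> and decrease afterwards, so
  the largest of the \<open>N + 1\<close> terms is \<open>t k\<close>. The case \<open>k = N\<close>
  is separate because ratios are compared after cancelling \<open>N - k\<close>.\<close>

lemma binomial_mode:
  assumes k: "k \<le> N"
  shows "N ^ N \<le> (N + 1) * ((N choose k) * k ^ k * (N - k) ^ (N - k))"
proof (cases "k = N")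
  case False
  then have kN: "k < N" using k by simp
  define t where "t j = (N choose j) * k ^ j * (N - k) ^ (N - j)" for j
  \<comment> \<open>The ratio of consecutive terms, cleared of denominators to stay in the natural
    numbers.\<close>
  have rec: "t (Suc j) * (Suc j * (N - k)) = t j * ((N - j) * k)" if "j < N" for j
  proof -
    have "(N choose Suc j) * Suc j = (N choose j) * (N - j)"
      using binomial_absorb_comp[of N j] binomial_absorption[of j N] by (simp add: mult.commute)
    moreover have "(N - k) ^ (N - j) = (N - k) ^ (N - Suc j) * (N - k)"
      using that by (metis Suc_diff_Suc power_Suc2)
    moreover have "t (Suc j) * (Suc j * (N - k))
        = ((N choose Suc j) * Suc j) * (k * k ^ j) * ((N - k) ^ (N - Suc j) * (N - k))"
      unfolding t_def power_Suc by (simp only: ac_simps)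
    ultimately show ?thesis
      unfolding t_def by (simp only: ac_simps)
  qed
  have up: "t j \<le> t (Suc j)" if "j < k" for j
  proof -
    have "Suc j * (N - k) \<le> k * (N - j)"
      using that kN by (intro mult_le_mono) auto
    then have "Suc j * (N - k) \<le> (N - j) * k"
      by (simp only: mult.commute[of k])
    then have "t j * (Suc j * (N - k)) \<le> t (Suc j) * (Suc j * (N - k))"
      unfolding rec[OF order.strict_trans[OF that kN]] by (intro mult_le_mono2)
    then show ?thesis using kN by simp
  qed
  have down: "t (Suc j) \<le> t j" if "k \<le> j" "j < N" for j
  proof -
    have "(N - j) * k \<le> (N - k) * Suc j"
      using that kN by (intro mult_le_mono) auto
    then have "(N - j) * k \<le> Suc j * (N - k)"
      by (simp only: mult.commute[of "N - k"])
    then have "t (Suc j) * (Suc j * (N - k)) \<le> t j * (Suc j * (N - k))"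
      unfolding rec[OF that(2)] by (intro mult_le_mono2)
    then show ?thesis using kN by simp
  qed
  have "t j \<le> t k" if "j \<le> N" for j
  proof (cases "j \<le> k")
    case True
    then show ?thesis
      by (induction j rule: inc_induct) (auto intro: order_trans[OF up])
  next
    case False
    then have "k \<le> j" by simp
    then show ?thesis using that
      by (induction j rule: dec_induct) (auto intro: order_trans[OF down])
  qed
  then have "(\<Sum>j\<le>N. t j) \<le> (\<Sum>j\<le>N. t k)"
    by (intro sum_mono) auto
  moreover have "N ^ N = (\<Sum>j\<le>N. t j)"
    using binomial[of k "N - k" N] kN by (simp add: t_def)
  ultimately show ?thesis by (simp add: t_def)
qed simp


definition up_mgf :: "real \<Rightarrow> real \<Rightarrow> real" where
  "up_mgf c \<nu> = (\<integral>t. exp (c * t) * indicator {\<nu><..} t \<partial>gauss)"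

definition low_mass :: "real \<Rightarrow> real" where
  "low_mass \<nu> = (\<integral>t. indicator {..\<nu>} t \<partial>gauss)"

lemma integrable_gauss_indicator [simp]:
  fixes f :: "real \<Rightarrow> real"
  shows "integrable gauss f \<Longrightarrow> A \<in> sets borel \<Longrightarrow> integrable gauss (\<lambda>t. f t * indicator A t)"
  using integrable_mult_indicator[of A gauss f] by (simp add: mult.commute)

lemma integrable_gauss_indicator' [simp]:
  "A \<in> sets borel \<Longrightarrow> integrable gauss (\<lambda>t. indicator A t :: real)"
  using integrable_gauss_indicator[of "\<lambda>_. 1" A] by simp

lemma plus_mgf_split: "plus_mgf c \<nu> = low_mass \<nu> + exp (- c * \<nu>) * up_mgf c \<nu>"
proof -
  have "exp (c * max (t - \<nu>) 0) = indicator {..\<nu>} t + exp (- c * \<nu>) * (exp (c * t) * indicator {\<nu><..} t)" for t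
    by (auto simp: indicator_def max_def exp_add[symmetric] algebra_simps)
  then show ?thesis
    unfolding plus_mgf_def low_mass_def up_mgf_def by simp
qed

text \<open>For different \<open>S\<close> the events that exactly the entries in \<open>S\<close>
  exceed \<open>\<nu>\<close> are disjoint, and on each of them the maximum is at least the sum over
  \<open>S\<close>. By independence each event contributes the same product, and there are
  \<open>N choose k\<close> of them.\<close>

lemma mgf_ge_split:
  assumes k: "k \<le> N" and c: "0 \<le> c"
  shows "real (N choose k) * up_mgf c \<nu> ^ k * low_mass \<nu> ^ (N - k) \<le> mgf N k c"
proof -
  let ?f = "\<lambda>S i t. if i \<in> S then exp (c * t) * indicator {\<nu><..} t else indicator {..\<nu>} t :: real"
  have int: "integrable gauss (?f S i)" for S and i :: nat by (cases "i \<in> S") auto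
  have ip: "integrable (gprod {1..N}) (\<lambda>x. \<Prod>i\<in>{1..N}. ?f S i (x i))" for S
    by (intro GP.product_integrable_prod int) auto
  have val: "(\<integral>x. (\<Prod>i\<in>{1..N}. ?f S i (x i)) \<partial>gprod {1..N}) = up_mgf c \<nu> ^ k * low_mass \<nu> ^ (N - k)"
    if S: "S \<in> ksets N k" for S
  proof -
    have fin: "finite S" "S \<subseteq> {1..N}" "card S = k" using ksets_finite_sub[OF S] by auto
    have "(\<integral>x. (\<Prod>i\<in>{1..N}. ?f S i (x i)) \<partial>gprod {1..N}) = (\<Prod>i\<in>{1..N}. \<integral>t. ?f S i t \<partial>gauss)"
      by (intro GP.product_integral_prod int) auto
    also have "\<dots> = (\<Prod>i\<in>{1..N}. if i \<in> S then up_mgf c \<nu> else low_mass \<nu>)"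
      by (intro prod.cong) (auto simp: up_mgf_def low_mass_def)
    also have "\<dots> = up_mgf c \<nu> ^ card ({1..N} \<inter> S) * low_mass \<nu> ^ card ({1..N} - S)"
      by (simp add: prod.If_cases Diff_eq)
    also have "\<dots> = up_mgf c \<nu> ^ k * low_mass \<nu> ^ (N - k)"
      using fin by (simp add: Int_absorb1 card_Diff_subset)
    finally show ?thesis .
  qed
  have "real (N choose k) * up_mgf c \<nu> ^ k * low_mass \<nu> ^ (N - k)
      = (\<integral>x. (\<Sum>S\<in>ksets N k. \<Prod>i\<in>{1..N}. ?f S i (x i)) \<partial>gprod {1..N})"
    using ip val by (simp add: card_ksets mult.assoc)
  also have "\<dots> \<le> mgf N k c"
    unfolding mgf_def
  proof (intro integral_mono topsum_integrable k Bochner_Integration.integrable_sum ip)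
    fix x :: "nat \<Rightarrow> real"
    \<comment> \<open>The only subset whose product does not vanish at \<open>x\<close>, provided
      that it has size \<open>k\<close>.\<close>
    define S0 where "S0 = {i \<in> {1..N}. \<nu> < x i}"
    have z: "(\<Prod>i\<in>{1..N}. ?f S i (x i)) = 0" if "S \<in> ksets N k" "S \<noteq> S0" for S
    proof -
      have "\<exists>i\<in>{1..N}. ?f S i (x i) = 0"
        using that ksets_finite_sub[of S N k] unfolding S0_def by (auto simp: indicator_def)
      then show ?thesis by (intro prod_zero) auto
    qed
    show "(\<Sum>S\<in>ksets N k. \<Prod>i\<in>{1..N}. ?f S i (x i)) \<le> exp (c * topsum N k x)"
    proof (cases "S0 \<in> ksets N k")
      case True
      then have sub: "S0 \<subseteq> {1..N}" using ksets_finite_sub by blast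
      have "(\<Sum>S\<in>ksets N k. \<Prod>i\<in>{1..N}. ?f S i (x i)) = (\<Prod>i\<in>{1..N}. ?f S0 i (x i))"
        using z True by (subst sum.mono_neutral_right[of "ksets N k" "{S0}"]) auto
      also have "\<dots> = (\<Prod>i\<in>{1..N}. if i \<in> S0 then exp (c * x i) else 1)"
        by (intro prod.cong) (auto simp: S0_def indicator_def)
      also have "\<dots> = (\<Prod>i\<in>S0. exp (c * x i))"
        using sub by (subst prod.inter_restrict[symmetric]) (auto simp: Int_absorb1)
      also have "\<dots> = exp (c * (\<Sum>i\<in>S0. x i))"
        using sub by (simp add: exp_sum sum_distrib_left finite_subset)
      also have "\<dots> \<le> exp (c * topsum N k x)"
        using topsum_ge[OF True] c by (simp add: mult_left_mono)
      finally show ?thesis .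
    next
      case False
      then have "(\<Sum>S\<in>ksets N k. \<Prod>i\<in>{1..N}. ?f S i (x i)) = 0"
      proof (intro sum.neutral ballI)
        fix S assume "S \<in> ksets N k"
        then show "(\<Prod>i\<in>{1..N}. ?f S i (x i)) = 0"
          using False by (intro z) auto
      qed
      then show ?thesis by simp
    qed
  qed
  finally show ?thesis .
qed

lemma AE_gauss_neq: "AE t in gauss. t \<noteq> \<nu>"
proof -
  have "AE t in lborel. 0 < ennreal (std_normal_density t) \<longrightarrow> t \<noteq> \<nu>"
    using AE_lborel_singleton[of \<nu>] by eventually_elim simp
  then show ?thesis unfolding gauss_def by (subst AE_density) auto
qed

text \<open>Dominated convergence: the indicators converge except at \<open>t = \<nu>\<close>, which
  is a null set.\<close>

lemma isCont_gauss_indicator: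
  fixes f :: "real \<Rightarrow> real"
  assumes f: "integrable gauss f"
  shows "isCont (\<lambda>\<nu>. \<integral>t. f t * indicator {\<nu><..} t \<partial>gauss) \<nu>"
proof (rule continuous_at_sequentiallyI)
  fix u assume u: "u \<longlonglongrightarrow> \<nu>"
  have [measurable]: "f \<in> borel_measurable borel"
    using borel_measurable_integrable[OF f] measurable_cong_sets[OF sets_gauss refl] by metis
  show "(\<lambda>n. \<integral>t. f t * indicator {u n<..} t \<partial>gauss) \<longlonglongrightarrow> (\<integral>t. f t * indicator {\<nu><..} t \<partial>gauss)"
  proof (rule integral_dominated_convergence)
    show "integrable gauss (\<lambda>t. \<bar>f t\<bar>)" using f by simp
    show "AE t in gauss. (\<lambda>n. f t * indicator {u n<..} t) \<longlonglongrightarrow> f t * indicator {\<nu><..} t"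
    proof (rule AE_mp[OF AE_gauss_neq[of \<nu>]], rule AE_I2, rule impI)
      fix t assume "t \<noteq> \<nu>"
      then consider "t < \<nu>" | "\<nu> < t" by linarith
      then have "\<forall>\<^sub>F n in sequentially. f t * indicator {u n<..} t = f t * indicator {\<nu><..} t"
      proof cases
        case 1
        show ?thesis
          using order_tendstoD(1)[OF u 1] by eventually_elim (use 1 in \<open>auto simp: indicator_def\<close>)
      next
        case 2
        show ?thesis
          using order_tendstoD(2)[OF u 2] by eventually_elim (use 2 in \<open>auto simp: indicator_def\<close>)
      qed
      then show "(\<lambda>n. f t * indicator {u n<..} t) \<longlonglongrightarrow> f t * indicator {\<nu><..} t"
        by (rule tendsto_eventually)
    qed
  qed (auto simp: indicator_def)
qed

lemma low_mass_eq: "low_mass \<nu> = 1 - (\<integral>t. 1 * indicator {\<nu><..} t \<partial>gauss)"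
proof -
  have "low_mass \<nu> = (\<integral>t. 1 - 1 * indicator {\<nu><..} t \<partial>gauss)"
    unfolding low_mass_def by (intro Bochner_Integration.integral_cong) (auto simp: indicator_def)
  then show ?thesis by (simp add: gauss.prob_space)
qed

lemma up_mgf_le: "up_mgf c \<nu> \<le> exp (c\<^sup>2 / 2)"
  unfolding up_mgf_def integral_exp_gauss[symmetric]
proof (intro integral_mono integrable_gauss_indicator)
  show "exp (c * t) * indicator {\<nu><..} t \<le> exp (c * t)" for t
    by (auto simp: indicator_def)
qed auto

text \<open>A Chernoff bound with exponent 1. This bound and \<open>low_mass_ge\<close> only serve
  to find levels at which the balance has opposite signs.\<close>

lemma low_mass_le: "low_mass \<nu> \<le> exp (\<nu> + 1 / 2)"
proof -
  have "low_mass \<nu> \<le> (\<integral>t. exp \<nu> * exp ((- 1) * t) \<partial>gauss)"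
    unfolding low_mass_def
  proof (intro integral_mono integrable_gauss_indicator' integrable_mult_right integrable_exp_gauss)
    show "indicator {..\<nu>} t \<le> exp \<nu> * exp ((- 1) * t)" for t
      by (auto simp: indicator_def exp_add[symmetric])
  qed auto
  also have "\<dots> = exp \<nu> * exp (1 / 2)"
    using integral_exp_gauss[of "- 1"] by simp
  finally show ?thesis by (simp add: exp_add)
qed

lemma low_mass_ge: "1 - exp (1 / 2 - \<nu>) \<le> low_mass \<nu>"
proof -
  have "(\<integral>t. indicator {\<nu><..} t \<partial>gauss) \<le> (\<integral>t. exp (- \<nu>) * exp (1 * t) \<partial>gauss)"
  proof (intro integral_mono integrable_gauss_indicator' integrable_mult_right integrable_exp_gauss)
    show "indicator {\<nu><..} t \<le> exp (- \<nu>) * exp (1 * t)" for t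
      by (auto simp: indicator_def exp_add[symmetric])
  qed auto
  also have "\<dots> = exp (- \<nu>) * exp (1 / 2)"
    using integral_exp_gauss[of 1] by simp
  also have "\<dots> = exp (1 / 2 - \<nu>)"
    by (simp add: exp_add[symmetric])
  finally show ?thesis by (simp add: low_mass_eq)
qed

lemma exp_decay_tendsto: "0 < c \<Longrightarrow> ((\<lambda>x. exp (- c * x)) \<longlongrightarrow> 0) at_top" for c :: real
  by real_asymp

lemma exp_shift_tendsto: "((\<lambda>x::real. exp (b - x)) \<longlongrightarrow> 0) at_top"
  by real_asymp

text \<open>At this level the upper bound \<open>mgf_le_plus_mgf\<close> is stationary in \<open>\<nu>\<close>.\<close>

lemma exists_balanced_level:
  fixes k N :: nat
  assumes k: "0 < k" "k < N" and c: "0 < c"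
  obtains \<nu> where "exp (- c * \<nu>) * up_mgf c \<nu> = real k / real N * plus_mgf c \<nu>"
    "low_mass \<nu> = real (N - k) / real N * plus_mgf c \<nu>"
proof -
  \<comment> \<open>A zero of \<open>D\<close> makes the parts of \<open>plus_mgf\<close> above and
    below the level stand in the ratio \<open>k\<close> to \<open>N - k\<close>.\<close>
  define D where "D \<nu> = real k * low_mass \<nu> - real (N - k) * (exp (- c * \<nu>) * up_mgf c \<nu>)" for \<nu>
  have NK: "real (N - k) = real N - real k" using k by (simp add: of_nat_diff)
  have cont: "isCont D \<nu>" for \<nu>
    unfolding D_def[abs_def] low_mass_eq up_mgf_def
    by (intro continuous_intros isCont_gauss_indicator) auto
  have ev: "\<forall>\<^sub>F \<nu> in at_top. 0 < real k * (1 - exp (1 / 2 - \<nu>)) - real (N - k) * (exp (- c * \<nu>) * exp (c\<^sup>2 / 2))"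
    (is "eventually ?P at_top")
  proof -
    have "((\<lambda>\<nu>. real k * (1 - exp (1 / 2 - \<nu>)) - real (N - k) * (exp (- c * \<nu>) * exp (c\<^sup>2 / 2)))
        \<longlongrightarrow> real k * (1 - 0) - real (N - k) * (0 * exp (c\<^sup>2 / 2))) at_top"
      by (intro tendsto_mult tendsto_diff tendsto_const exp_decay_tendsto c exp_shift_tendsto)
    then show ?thesis
      using k by (intro order_tendstoD(1)) auto
  qed
  obtain \<nu>1 where v1: "0 < real k * (1 - exp (1 / 2 - \<nu>1)) - real (N - k) * (exp (- c * \<nu>1) * exp (c\<^sup>2 / 2))"
    using eventually_happens'[OF _ ev] by auto
  have "0 \<le> D \<nu>1"
    using mult_left_mono[OF low_mass_ge[of \<nu>1], of "real k"]
      mult_left_mono[OF mult_left_mono[OF up_mgf_le[of c \<nu>1], of "exp (- c * \<nu>1)"], of "real (N - k)"] v1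
    unfolding D_def by simp
  \<comment> \<open>Chosen so that \<open>N * exp (\<nu>0 + 1 / 2)\<close> equals
    \<open>N - k\<close>, which makes the upper bound for \<open>D \<nu>0\<close> vanish.\<close>
  define \<nu>0 where "\<nu>0 = ln (real (N - k) / real N) - 1 / 2"
  have "D \<nu>0 = real N * low_mass \<nu>0 - real (N - k) * plus_mgf c \<nu>0"
    unfolding D_def plus_mgf_split NK by (simp add: algebra_simps)
  also have "\<dots> \<le> real N * exp (\<nu>0 + 1 / 2) - real (N - k) * 1"
    using low_mass_le[of \<nu>0] plus_mgf_ge_1[of c \<nu>0] c by (intro diff_mono mult_left_mono) auto
  also have "\<dots> = 0" using k by (simp add: \<nu>0_def)
  finally have "D \<nu>0 \<le> 0" .
  \<comment> \<open>The two levels come from unrelated estimates, so either order has to be covered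
    by the intermediate value theorem.\<close>
  have "\<exists>\<nu>. D \<nu> = 0"
  proof (cases "\<nu>0 \<le> \<nu>1")
    case True
    then show ?thesis using IVT[of D \<nu>0 0 \<nu>1] \<open>0 \<le> D \<nu>1\<close> \<open>D \<nu>0 \<le> 0\<close> cont by auto
  next
    case False
    then show ?thesis using IVT2[of D \<nu>0 0 \<nu>1] \<open>0 \<le> D \<nu>1\<close> \<open>D \<nu>0 \<le> 0\<close> cont by auto
  qed
  then obtain \<nu> where "D \<nu> = 0" by blast
  then have eq: "real k * low_mass \<nu> = (real N - real k) * (exp (- c * \<nu>) * up_mgf c \<nu>)"
    by (simp add: D_def NK)
  define u where "u = exp (- c * \<nu>) * up_mgf c \<nu>"
  have J: "plus_mgf c \<nu> = low_mass \<nu> + u"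
    by (simp only: plus_mgf_split u_def)
  have "real N * u = real k * plus_mgf c \<nu>" "real N * low_mass \<nu> = real (N - k) * plus_mgf c \<nu>"
    using eq unfolding J NK u_def[symmetric] by (simp_all add: algebra_simps)
  then have "u = real k / real N * plus_mgf c \<nu>" "low_mass \<nu> = real (N - k) / real N * plus_mgf c \<nu>"
    using k by (simp_all add: field_simps)
  then show ?thesis using that[of \<nu>] unfolding u_def by blast
qed

text \<open>At the balanced level the bound of \<open>mgf_ge_split\<close> is the upper bound of
  \<open>mgf_le_plus_mgf\<close> times the probability of the value \<open>k\<close> under the
  binomial law with parameters \<open>N\<close> and \<open>k / N\<close>, and
  \<open>binomial_mode\<close> bounds that probability below.\<close>

lemma mgf_ge_plus_mgf:
  assumes k: "0 < k" "k < N" and c: "0 < c"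
  obtains \<nu> where "exp (c * (real k * \<nu>)) * plus_mgf c \<nu> ^ N \<le> (real N + 1) * mgf N k c"
proof -
  obtain \<nu> where v: "exp (- c * \<nu>) * up_mgf c \<nu> = real k / real N * plus_mgf c \<nu>"
    "low_mass \<nu> = real (N - k) / real N * plus_mgf c \<nu>"
    using exists_balanced_level[OF k c] by blast
  let ?J = "plus_mgf c \<nu>"
  have J: "1 \<le> ?J" using plus_mgf_ge_1 c by simp
  have up: "up_mgf c \<nu> = exp (c * \<nu>) * (real k / real N * ?J)"
    unfolding v(1)[symmetric] by (simp add: exp_minus)
  have pw: "(e * (A / n * J)) ^ k * (B / n * J) ^ l = e ^ k * J ^ (k + l) * (A ^ k * B ^ l / n ^ (k + l))"
    for e A B n J :: real and l
    by (simp add: power_mult_distrib power_divide power_add)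
  have e: "exp (c * \<nu>) ^ k = exp (c * (real k * \<nu>))"
    by (simp add: exp_of_nat_mult[symmetric] mult.left_commute)
  have "real (N ^ N) \<le> real ((N + 1) * ((N choose k) * k ^ k * (N - k) ^ (N - k)))"
    using binomial_mode[of k N] k by (simp only: of_nat_le_iff) 
  then have "real N ^ N \<le> (real N + 1) * (real (N choose k) * real k ^ k * real (N - k) ^ (N - k))"
    by (simp add: distrib_right)
  then have b: "1 \<le> (real N + 1) * (real (N choose k) * real k ^ k * real (N - k) ^ (N - k)) / real N ^ N"
    using k by (subst le_divide_eq_1_pos) auto
  have "exp (c * (real k * \<nu>)) * ?J ^ N * 1
     \<le> exp (c * (real k * \<nu>)) * ?J ^ N * ((real N + 1) * (real (N choose k) * real k ^ k * real (N - k) ^ (N - k)) / real N ^ N)"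
    using b J by (intro mult_left_mono) auto
  also have "\<dots> = (real N + 1) * (real (N choose k) * up_mgf c \<nu> ^ k * low_mass \<nu> ^ (N - k))"
    using pw[of "exp (c * \<nu>)" "real k" "real N" ?J "real (N - k)" "N - k"] k
    unfolding up v(2) e by (simp add: mult.assoc mult.left_commute)
  also have "\<dots> \<le> (real N + 1) * mgf N k c"
    using mgf_ge_split[of k N c \<nu>] k c by (intro mult_left_mono) auto
  finally show ?thesis using that[of \<nu>] by simp
qed

subsection \<open>Exponential rates\<close>

text \<open>Dividing by \<open>N * c\<close> gives a finite limit for fixed \<open>c\<close>, and
  gives the mean per entry as \<open>c\<close> tends to 0.\<close>

definition rate :: "nat \<Rightarrow> nat \<Rightarrow> real \<Rightarrow> real" where
  "rate N k c = ln (mgf N k c) / (real N * c)"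

lemma rate_le_plus_mgf:
  assumes k: "0 < k" "k \<le> N" and c: "0 < c"
  shows "rate N k c \<le> real k / real N * \<nu> + ln (plus_mgf c \<nu>) / c"
proof -
  have J: "0 < plus_mgf c \<nu>" using plus_mgf_ge_1[of c \<nu>] c by simp
  have "ln (mgf N k c) \<le> ln (exp (c * (real k * \<nu>)) * plus_mgf c \<nu> ^ N)"
    using mgf_le_plus_mgf[of k N c \<nu>] mgf_pos[of k N c] k c by simp
  also have "\<dots> = c * (real k * \<nu>) + real N * ln (plus_mgf c \<nu>)"
    using J by (simp add: ln_mult ln_realpow)
  finally have "rate N k c \<le> (c * (real k * \<nu>) + real N * ln (plus_mgf c \<nu>)) / (real N * c)"
    unfolding rate_def using k c by (intro divide_right_mono) auto
  also have "\<dots> = real k / real N * \<nu> + ln (plus_mgf c \<nu>) / c"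
    using k c by (simp add: field_simps)
  finally show ?thesis .
qed

lemma rate_ge:
  assumes k: "0 < k" "k \<le> N" and c: "0 < c"
  shows "real k / real N * (c / 2) \<le> rate N k c"
proof -
  have "real k * (c\<^sup>2 / 2) = ln (exp (c\<^sup>2 / 2) ^ k)"
    by (simp add: ln_realpow)
  also have "\<dots> \<le> ln (mgf N k c)"
    using mgf_ge_gaussian[of k N c] mgf_pos[of k N c] k c by (subst ln_le_cancel_iff) auto
  finally have "real k * (c\<^sup>2 / 2) / (real N * c) \<le> rate N k c"
    unfolding rate_def using k c by (intro divide_right_mono) auto
  moreover have "real k * (c\<^sup>2 / 2) / (real N * c) = real k / real N * (c / 2)"
    using c k by (simp add: power2_eq_square field_simps)
  ultimately show ?thesis by simp
qed

lemma rate_mean: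
  assumes k: "0 < k" "k \<le> N" and c: "0 < c"
  shows "topmean N k / real N \<le> rate N k c" "rate N k c \<le> topmean N k / real N + c"
proof -
  have "c * topmean N k \<le> ln (mgf N k c)"
    using mgf_ge_exp_mean[of k N c] mgf_pos[of k N c] k by (subst ln_ge_iff) auto
  then have "c * topmean N k / (real N * c) \<le> rate N k c"
    unfolding rate_def using k c by (intro divide_right_mono) auto
  then show "topmean N k / real N \<le> rate N k c"
    using c by simp
  have "ln (mgf N k c) \<le> ln (exp (c * topmean N k + N * c\<^sup>2))"
    using mgf_le_concentration[of k N c] mgf_pos[of k N c] k by (subst ln_le_cancel_iff) auto
  then have "rate N k c \<le> (c * topmean N k + N * c\<^sup>2) / (real N * c)"
    unfolding rate_def using k c by (intro divide_right_mono) auto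
  also have "\<dots> = topmean N k / real N + c"
    using c k by (simp add: power2_eq_square field_simps)
  finally show "rate N k c \<le> topmean N k / real N + c" .
qed

text \<open>Hoelder's inequality in its pointwise form: after division of the two exponentials by
  their integrals \<open>exp A\<close> and \<open>exp B\<close>, convexity of \<open>exp\<close>
  applies pointwise and both normalised integrals are 1.\<close>

lemma ln_mgf_convex:
  assumes k: "k \<le> N" and l: "0 \<le> l" "l \<le> 1"
  shows "ln (mgf N k ((1 - l) * a + l * b)) \<le> (1 - l) * ln (mgf N k a) + l * ln (mgf N k b)"
proof -
  define A where "A = ln (mgf N k a)"
  define B where "B = ln (mgf N k b)"
  have AB: "exp A = mgf N k a" "exp B = mgf N k b"
    using mgf_pos[OF k] by (simp_all add: A_def B_def)
  note int = topsum_integrable[OF k]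
  have "mgf N k ((1 - l) * a + l * b)
      \<le> (\<integral>x. exp ((1 - l) * A + l * B) * ((1 - l) * (exp (a * topsum N k x) / exp A) + l * (exp (b * topsum N k x) / exp B)) \<partial>gprod {1..N})"
    unfolding mgf_def
  proof (intro integral_mono)
    fix x :: "nat \<Rightarrow> real"
    let ?u = "a * topsum N k x - A" and ?v = "b * topsum N k x - B"
    have "exp ((1 - l) * ?u + l * ?v) \<le> (1 - l) * exp ?u + l * exp ?v"
      using convex_onD[OF convex_on_exp[of 1], of l ?u ?v] l by simp
    then have "exp ((1 - l) * A + l * B) * exp ((1 - l) * ?u + l * ?v)
        \<le> exp ((1 - l) * A + l * B) * ((1 - l) * exp ?u + l * exp ?v)"
      by (intro mult_left_mono) auto
    moreover have "exp ((1 - l) * A + l * B) * exp ((1 - l) * ?u + l * ?v) = exp (((1 - l) * a + l * b) * topsum N k x)"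
      unfolding exp_add[symmetric] by (simp add: algebra_simps)
    ultimately show "exp (((1 - l) * a + l * b) * topsum N k x)
        \<le> exp ((1 - l) * A + l * B) * ((1 - l) * (exp (a * topsum N k x) / exp A) + l * (exp (b * topsum N k x) / exp B))"
      by (simp add: exp_diff)
  qed (use int in auto)
  also have "\<dots> = exp ((1 - l) * A + l * B) * ((1 - l) * (mgf N k a / exp A) + l * (mgf N k b / exp B))"
    using int by (simp add: mgf_def)
  also have "\<dots> = exp ((1 - l) * A + l * B)"
    unfolding AB[symmetric] by simp
  finally have "ln (mgf N k ((1 - l) * a + l * b)) \<le> ln (exp ((1 - l) * A + l * B))"
    using mgf_pos[OF k] by (subst ln_le_cancel_iff) auto
  then show ?thesis by (simp add: A_def B_def)
qed

text \<open>A convex function vanishing at 0 has an increasing quotient by its argument.\<close>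

lemma rate_mono:
  assumes k: "0 < k" "k \<le> N" and c: "0 < c" "c \<le> d"
  shows "rate N k c \<le> rate N k d"
proof -
  have "mgf N k 0 = 1"
    using prob_space.prob_space[OF prob_space_gprod] by (simp add: mgf_def)
  then have "ln (mgf N k c) \<le> c / d * ln (mgf N k d)"
    using ln_mgf_convex[of k N "c / d" 0 d] k c by simp
  then have "ln (mgf N k c) / (real N * c) \<le> c / d * ln (mgf N k d) / (real N * c)"
    using k c by (intro divide_right_mono) auto
  then show ?thesis
    using c by (simp add: rate_def mult.commute)
qed

text \<open>Convexity between \<open>c\<close> and \<open>2 * d\<close> bounds \<open>p d\<close> by
  the values at the two ends. Concentration bounds the right one in terms of the mean, and Jensen
  bounds the mean by \<open>p c / c\<close>. The 4 is the square of the factor 2 in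
  \<open>2 * d\<close>.\<close>

lemma rate_lipschitz:
  assumes k: "0 < k" "k \<le> N" and c: "0 < c" "c \<le> d"
  shows "rate N k d \<le> rate N k c + 4 * (d - c)"
proof -
  define \<mu> where "\<mu> = topmean N k"
  define n where "n = real N"
  \<comment> \<open>The length of the interval from \<open>c\<close> to \<open>2 * d\<close>; it is
    at least \<open>d\<close>, which later absorbs the surplus factor \<open>d\<close>.\<close>
  define D where "D = 2 * d - c"
  define p where "p x = ln (mgf N k x)" for x
  have n: "0 < n" using k by (simp add: n_def)
  have D: "0 < D" "d \<le> D" using c by (auto simp: D_def)
  have lo: "x * \<mu> \<le> p x" for x
    unfolding p_def \<mu>_def using mgf_ge_exp_mean[of k N x] mgf_pos[of k N x] k by (subst ln_ge_iff) auto
  have "p (2 * d) \<le> ln (exp (2 * d * \<mu> + n * (2 * d)\<^sup>2))"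
    unfolding p_def \<mu>_def n_def
    using mgf_le_concentration[of k N "2 * d"] mgf_pos[of k N "2 * d"] k by (subst ln_le_cancel_iff) auto
  then have hi: "p (2 * d) \<le> 2 * d * \<mu> + 4 * n * d\<^sup>2"
    by (simp add: power_mult_distrib)
  have dd: "d = (1 - (d - c) / D) * c + (d - c) / D * (2 * d)"
    using D by (simp add: field_simps) (simp add: D_def algebra_simps)
  have "p d \<le> (1 - (d - c) / D) * p c + (d - c) / D * p (2 * d)"
    using ln_mgf_convex[of k N "(d - c) / D" c "2 * d"] k c D dd unfolding p_def by (auto simp: D_def)
  then have "D * p d \<le> D * ((1 - (d - c) / D) * p c + (d - c) / D * p (2 * d))"
    using D by (intro mult_left_mono) auto
  also have "\<dots> = d * p c + (d - c) * p (2 * d)"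
    using D by (simp add: field_simps) (simp add: D_def algebra_simps)
  also have "\<dots> \<le> d * p c + (d - c) * (2 * d * \<mu> + 4 * n * d\<^sup>2)"
    using hi c by (intro add_left_mono mult_left_mono) auto
  finally have "c * (D * p d) \<le> c * (d * p c + (d - c) * (2 * d * \<mu> + 4 * n * d\<^sup>2))"
    using c by (intro mult_left_mono) auto
  also have "\<dots> = c * d * p c + 2 * d * (d - c) * (c * \<mu>) + 4 * n * c * d * (d - c) * d"
    by (simp add: power2_eq_square algebra_simps)
  \<comment> \<open>Uses \<open>c * \<mu> \<le> p c\<close> in the second term and
    \<open>d \<le> D\<close> in the third, so that \<open>D\<close> can be cancelled.\<close>
  also have "\<dots> \<le> c * d * p c + 2 * d * (d - c) * p c + 4 * n * c * d * (d - c) * D"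
    using lo[of c] c n D by (intro add_mono mult_left_mono order_refl mult_nonneg_nonneg) auto
  also have "\<dots> = D * (d * p c + 4 * n * c * d * (d - c))"
    by (simp add: D_def algebra_simps)
  finally have "D * (c * p d) \<le> D * (d * p c + 4 * n * c * d * (d - c))"
    by (simp add: ac_simps)
  then have "c * p d \<le> d * p c + 4 * n * c * d * (d - c)"
    using D by simp
  then have "c * p d / (n * c * d) \<le> (d * p c + 4 * n * c * d * (d - c)) / (n * c * d)"
    using n c by (intro divide_right_mono) auto
  also have "\<dots> = p c / (n * c) + 4 * (d - c)"
    using n c by (simp add: add_divide_distrib)
  finally show ?thesis
    using c by (simp add: rate_def p_def n_def)
qed

lemma plus_mgf_le: "plus_mgf c \<nu> \<le> 1 + exp (c\<^sup>2 / 2 - c * \<nu>)"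
proof -
  have "plus_mgf c \<nu> \<le> (\<integral>t. 1 + exp (c * t) * exp (- (c * \<nu>)) \<partial>gauss)"
    unfolding plus_mgf_def
  proof (intro integral_mono)
    show "exp (c * max (t - \<nu>) 0) \<le> 1 + exp (c * t) * exp (- (c * \<nu>))" for t
      by (auto simp: max_def exp_add[symmetric] algebra_simps)
  qed auto
  also have "\<dots> = 1 + exp (c\<^sup>2 / 2) * exp (- (c * \<nu>))"
    by (simp add: integral_exp_gauss)
  finally show ?thesis by (simp add: exp_add[symmetric])
qed

text \<open>The level depends on \<open>N\<close>. The slack \<open>e\<close> serves the case
  \<open>k = N\<close>, in which the infimum over levels is not attained.\<close>

lemma rate_ge_plus_mgf:
  assumes k: "0 < k" "k \<le> N" and c: "0 < c" and e: "0 < e"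
  obtains \<nu> where "real k / real N * \<nu> + ln (plus_mgf c \<nu>) / c \<le> rate N k c + ln (real N + 1) / (real N * c) + e"
proof (cases "k < N")
  case True
  then obtain \<nu> where v: "exp (c * (real k * \<nu>)) * plus_mgf c \<nu> ^ N \<le> (real N + 1) * mgf N k c"
    using mgf_ge_plus_mgf[of k N c] k c by blast
  have J: "0 < plus_mgf c \<nu>" using plus_mgf_ge_1[of c \<nu>] c by simp
  have "c * (real k * \<nu>) + real N * ln (plus_mgf c \<nu>) = ln (exp (c * (real k * \<nu>)) * plus_mgf c \<nu> ^ N)"
    using J by (simp add: ln_mult ln_realpow)
  also have "\<dots> \<le> ln ((real N + 1) * mgf N k c)"
    using v J mgf_pos[of k N c] k by (subst ln_le_cancel_iff) auto
  also have "\<dots> = ln (real N + 1) + ln (mgf N k c)"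
    using mgf_pos[of k N c] k by (subst ln_mult) auto
  finally have "(c * (real k * \<nu>) + real N * ln (plus_mgf c \<nu>)) / (real N * c) \<le> (ln (real N + 1) + ln (mgf N k c)) / (real N * c)"
    using k c by (intro divide_right_mono) auto
  moreover have "(c * (real k * \<nu>) + real N * ln (plus_mgf c \<nu>)) / (real N * c) = real k / real N * \<nu> + ln (plus_mgf c \<nu>) / c"
    using k c by (simp add: field_simps)
  ultimately show ?thesis
    using that[of \<nu>] e by (simp add: rate_def add_divide_distrib)
next
  case False
  then have kN: "k = N" using k by simp
  \<comment> \<open>Solves \<open>exp (c * \<nu> - c\<^sup>2 / 2) = e * c\<close>, so that the
    surplus 1 in the bound for \<open>plus_mgf\<close> costs at most \<open>e\<close> after taking
    the logarithm and dividing by \<open>c\<close>.\<close>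
  define \<nu> where "\<nu> = (ln (e * c) + c\<^sup>2 / 2) / c"
  have cv: "c * \<nu> - c\<^sup>2 / 2 = ln (e * c)" using c by (simp add: \<nu>_def)
  have J: "0 < plus_mgf c \<nu>" using plus_mgf_ge_1[of c \<nu>] c by simp
  have "plus_mgf c \<nu> \<le> exp (c\<^sup>2 / 2 - c * \<nu>) * (1 + exp (c * \<nu> - c\<^sup>2 / 2))"
    using plus_mgf_le[of c \<nu>] by (simp add: distrib_left exp_add[symmetric])
  also have "\<dots> = exp (c\<^sup>2 / 2 - c * \<nu>) * (1 + e * c)"
    unfolding cv using c e by simp
  finally have "ln (plus_mgf c \<nu>) \<le> ln (exp (c\<^sup>2 / 2 - c * \<nu>) * (1 + e * c))"
    using J c e by (subst ln_le_cancel_iff) (auto intro!: mult_pos_pos add_pos_pos)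
  also have "\<dots> = c\<^sup>2 / 2 - c * \<nu> + ln (1 + e * c)"
    using c e by (subst ln_mult) (auto simp: add_pos_pos add_nonneg_eq_0_iff)
  also have "\<dots> \<le> c\<^sup>2 / 2 - c * \<nu> + e * c"
    using ln_add_one_self_le_self[of "e * c"] c e by simp
  finally have "ln (plus_mgf c \<nu>) / c \<le> (c\<^sup>2 / 2 - c * \<nu> + e * c) / c"
    using c by (intro divide_right_mono) auto
  also have "\<dots> = c / 2 - \<nu> + e"
    using c by (simp add: power2_eq_square field_simps)
  finally have "\<nu> + ln (plus_mgf c \<nu>) / c \<le> c / 2 + e" by simp
  moreover have "c / 2 \<le> rate N k c"
    using rate_ge[OF k c] kN k by simp
  moreover have "0 \<le> ln (real N + 1) / (real N * c)"
    using c by simp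
  ultimately show ?thesis
    using that[of \<nu>] kN k by simp
qed

section \<open>The limit of the rates as an infimum over levels\<close>

definition rate_lim :: "real \<Rightarrow> real \<Rightarrow> real" where
  "rate_lim q c = (INF \<nu>. q * \<nu> + ln (plus_mgf c \<nu>) / c)"

lemma ln_plus_mgf_nonneg: "0 < c \<Longrightarrow> 0 \<le> ln (plus_mgf c \<nu>) / c"
  using plus_mgf_ge_1[of c \<nu>] by simp

lemma ln_plus_mgf_ge: "0 < c \<Longrightarrow> 0 \<le> \<nu> + ln (plus_mgf c \<nu>) / c"
proof -
  assume c: "0 < c"
  have "c\<^sup>2 / 2 - c * \<nu> \<le> ln (plus_mgf c \<nu>)"
    using plus_mgf_ge_exp[of c \<nu>] plus_mgf_ge_1[of c \<nu>] c by (subst ln_ge_iff) auto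
  then have "- (c * \<nu>) \<le> ln (plus_mgf c \<nu>)"
    using zero_le_power2[of c] by linarith
  then have "- \<nu> \<le> ln (plus_mgf c \<nu>) / c"
    using c by (simp add: field_simps)
  then show ?thesis by simp
qed

text \<open>The objective is the convex combination, with weights \<open>q\<close> and
  \<open>1 - q\<close>, of \<open>\<nu> + b\<close> and \<open>b\<close>, both nonnegative. The real
  infimum in \<open>rate_lim\<close> is thereby bounded below.\<close>

lemma rate_objective_nonneg:
  assumes "0 < c" "0 \<le> q" "q \<le> 1"
  shows "0 \<le> q * \<nu> + ln (plus_mgf c \<nu>) / c"
proof -
  define b where "b = ln (plus_mgf c \<nu>) / c"
  have "0 \<le> q * (\<nu> + b) + (1 - q) * b"
    unfolding b_def using assms mult_nonneg_nonneg[OF _ ln_plus_mgf_ge[of c \<nu>], of q]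
      mult_nonneg_nonneg[OF _ ln_plus_mgf_nonneg[of c \<nu>], of "1 - q"] by simp
  then show ?thesis unfolding b_def[symmetric] by (simp add: algebra_simps)
qed

lemma rate_lim_le: "0 < c \<Longrightarrow> 0 \<le> q \<Longrightarrow> q \<le> 1 \<Longrightarrow> rate_lim q c \<le> q * \<nu> + ln (plus_mgf c \<nu>) / c"
  unfolding rate_lim_def
  by (intro cINF_lower bdd_belowI2[where m = 0]) (auto intro: rate_objective_nonneg)

lemma rate_lim_nonneg: "0 < c \<Longrightarrow> 0 \<le> q \<Longrightarrow> q \<le> 1 \<Longrightarrow> 0 \<le> rate_lim q c"
  unfolding rate_lim_def by (intro cINF_greatest rate_objective_nonneg) auto

lemma rate_lim_approx:
  assumes "0 < c" "0 \<le> q" "q \<le> 1" "rate_lim q c < x"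
  obtains \<nu> where "q * \<nu> + ln (plus_mgf c \<nu>) / c < x"
proof -
  have "bdd_below (range (\<lambda>\<nu>. q * \<nu> + ln (plus_mgf c \<nu>) / c))"
    using assms by (intro bdd_belowI2[where m = 0]) (auto intro: rate_objective_nonneg)
  then show ?thesis
    using assms(4) that unfolding rate_lim_def by (subst (asm) cINF_less_iff) auto
qed

text \<open>The level in the lower bound varies with \<open>n\<close> without any bound, so
  convergence for fixed levels is not enough. The objectives for \<open>k n / N n\<close> and for
  \<open>q\<close> are instead compared by a factor tending to 1, uniformly in the level; the upper
  bound needs one fixed near-optimal level.\<close>

lemma rate_tendsto_fixed:
  fixes N k :: "nat \<Rightarrow> nat"
  assumes N: "filterlim N at_top sequentially"
    and k: "\<forall>\<^sub>F n in sequentially. 0 < k n \<and> k n \<le> N n"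
    and q: "(\<lambda>n. real (k n) / real (N n)) \<longlonglongrightarrow> q" "0 < q" and c: "0 < c"
  shows "(\<lambda>n. rate (N n) (k n) c) \<longlonglongrightarrow> rate_lim q c"
proof -
  let ?q = "\<lambda>n. real (k n) / real (N n)"
  have q1: "q \<le> 1"
    by (rule tendsto_upperbound[OF q(1)]) (use k in \<open>auto elim!: eventually_mono simp: field_simps\<close>)
  define r where "r = rate_lim q c"
  have r0: "0 \<le> r" unfolding r_def using q q1 c by (intro rate_lim_nonneg) auto
  \<comment> \<open>For \<open>q = 1\<close> the value 1 is a default: then
    \<open>k n / N n \<le> q\<close> always holds and the factor \<open>k n / (N n * q)\<close> does
    the work.\<close>
  define s where "s n = (if q = 1 then 1 else (1 - ?q n) / (1 - q))" for n
  have s: "s \<longlonglongrightarrow> 1"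
  proof (cases "q = 1")
    case False
    then have "(\<lambda>n. (1 - ?q n) / (1 - q)) \<longlonglongrightarrow> (1 - q) / (1 - q)"
      by (intro tendsto_intros q) auto
    then show ?thesis using False by (simp add: s_def[abs_def])
  qed (simp add: s_def[abs_def])
  define lb where "lb n = min (?q n / q) (s n) * r - ln (real (N n) + 1) / (real (N n) * c)" for n
  have "(\<lambda>n. ln (real (N n) + 1) / (real (N n) * c)) \<longlonglongrightarrow> 0"
  proof (rule filterlim_compose[OF _ N])
    show "((\<lambda>n. ln (real n + 1) / (real n * c)) \<longlongrightarrow> 0) sequentially"
      using c by real_asymp
  qed
  then have "lb \<longlonglongrightarrow> min (q / q) 1 * r - 0"
    unfolding lb_def[abs_def] using q by (intro tendsto_intros q s) auto
  then have lb: "lb \<longlonglongrightarrow> r" using q by simp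
  have lb_le: "lb n \<le> rate (N n) (k n) c" if kn: "0 < k n" "k n \<le> N n" for n
  proof (rule field_le_epsilon)
    fix e :: real assume e: "0 < e"
    obtain \<nu> where v: "?q n * \<nu> + ln (plus_mgf c \<nu>) / c \<le> rate (N n) (k n) c + ln (real (N n) + 1) / (real (N n) * c) + e"
      using rate_ge_plus_mgf[OF kn c e] by blast
    define b where "b = ln (plus_mgf c \<nu>) / c"
    have b: "0 \<le> b" "0 \<le> \<nu> + b" unfolding b_def using ln_plus_mgf_nonneg ln_plus_mgf_ge c by auto
    have qn: "0 \<le> ?q n" "?q n \<le> 1" using kn by auto
    have w: "r \<le> q * \<nu> + b" unfolding r_def b_def using q q1 c by (intro rate_lim_le) auto
    have "min (?q n / q) (s n) * r \<le> ?q n * \<nu> + b"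
    proof (cases "?q n \<le> q")
      case True
      have "min (?q n / q) (s n) * r \<le> ?q n / q * r"
        using r0 by (intro mult_right_mono) auto
      also have "\<dots> \<le> ?q n / q * (q * \<nu> + b)"
        using w q qn by (intro mult_left_mono) auto
      also have "\<dots> = ?q n * \<nu> + ?q n / q * b"
        using q by (simp add: distrib_left)
      also have "\<dots> \<le> ?q n * \<nu> + 1 * b"
        using b True q(2) by (intro add_left_mono mult_right_mono) (subst pos_divide_le_eq, auto)
      finally show ?thesis by simp
    next
      case False
      then have q2: "q < 1" using qn by simp
      then have sn: "s n = (1 - ?q n) / (1 - q)" "0 \<le> s n" "s n \<le> 1"
        using False qn by (auto simp: s_def field_simps)
      have "min (?q n / q) (s n) * r \<le> s n * r"
        using r0 by (intro mult_right_mono) auto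
      also have "\<dots> \<le> s n * (q * \<nu> + b)"
        using w sn by (intro mult_left_mono) auto
      \<comment> \<open>Adding a multiple of the nonnegative \<open>\<nu> + b\<close> raises the
        coefficient of \<open>\<nu>\<close> from \<open>s n * q\<close> to \<open>k n / N n\<close>
        and restores the coefficient 1 of \<open>b\<close>.\<close>
      also have "\<dots> \<le> s n * (q * \<nu> + b) + (1 - s n) * (\<nu> + b)"
        using sn b by simp
      also have "\<dots> = (1 - s n * (1 - q)) * \<nu> + b"
        by (simp add: algebra_simps)
      also have "s n * (1 - q) = 1 - ?q n"
        using q2 by (simp add: sn)
      finally show ?thesis by simp
    qed
    then show "lb n \<le> rate (N n) (k n) c + e"
      using v unfolding lb_def b_def by linarith
  qed
  show ?thesis
    unfolding r_def[symmetric]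
  proof (rule order_tendstoI)
    fix x assume "x < r"
    from order_tendstoD(1)[OF lb this] k show "\<forall>\<^sub>F n in sequentially. x < rate (N n) (k n) c"
      by eventually_elim (use lb_le in \<open>auto intro: less_le_trans\<close>)
  next
    fix x assume "r < x"
    then obtain \<nu> where v: "q * \<nu> + ln (plus_mgf c \<nu>) / c < x"
      unfolding r_def using rate_lim_approx[of c q x] q q1 c by auto
    have "(\<lambda>n. ?q n * \<nu> + ln (plus_mgf c \<nu>) / c) \<longlonglongrightarrow> q * \<nu> + ln (plus_mgf c \<nu>) / c"
      by (intro tendsto_intros q)
    from order_tendstoD(2)[OF this v] k show "\<forall>\<^sub>F n in sequentially. rate (N n) (k n) c < x"
    proof eventually_elim
      case (elim n)
      then show ?case using rate_le_plus_mgf[of "k n" "N n" c \<nu>] c by linarith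
    qed
  qed
qed

lemma rate_tendsto:
  fixes N k :: "nat \<Rightarrow> nat"
  assumes N: "filterlim N at_top sequentially"
    and k: "\<forall>\<^sub>F n in sequentially. 0 < k n \<and> k n \<le> N n"
    and q: "(\<lambda>n. real (k n) / real (N n)) \<longlonglongrightarrow> q" "0 < q" and c: "d \<longlonglongrightarrow> c" "0 < c"
  shows "(\<lambda>n. rate (N n) (k n) (d n)) \<longlonglongrightarrow> rate_lim q c"
proof -
  have "(\<lambda>n. rate (N n) (k n) (d n) - rate (N n) (k n) c) \<longlonglongrightarrow> 0"
  proof (rule Lim_null_comparison)
    have "\<forall>\<^sub>F n in sequentially. 0 < d n" using order_tendstoD(1)[OF c] .
    with k show "\<forall>\<^sub>F n in sequentially. norm (rate (N n) (k n) (d n) - rate (N n) (k n) c) \<le> 4 * \<bar>d n - c\<bar>"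
    proof eventually_elim
      case (elim n)
      show ?case
      proof (cases "c \<le> d n")
        case True
        then show ?thesis
          using rate_mono[of "k n" "N n" c "d n"] rate_lipschitz[of "k n" "N n" c "d n"] elim c by simp
      next
        case False
        then show ?thesis
          using rate_mono[of "k n" "N n" "d n" c] rate_lipschitz[of "k n" "N n" "d n" c] elim c by simp
      qed
    qed
    have "(\<lambda>n. 4 * \<bar>d n - c\<bar>) \<longlonglongrightarrow> 4 * \<bar>c - c\<bar>"
      by (intro tendsto_intros c)
    then show "(\<lambda>n. 4 * \<bar>d n - c\<bar>) \<longlonglongrightarrow> 0" by simp
  qed
  from tendsto_add[OF this rate_tendsto_fixed[OF N k q c(2)]] show ?thesis by simp
qed

text \<open>The reflection of \<open>t\<close> turns the negative part in \<open>I2\<close> into the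
  positive excess over the level \<open>\<nu>\<close>.\<close>

lemma I2_eq_plus_mgf: "I2 c \<nu> \<beta> = plus_mgf (c / sqrt \<beta>) \<nu>"
proof -
  have "I2 c \<nu> \<beta> = (\<integral>t. exp (- (c / sqrt \<beta>) * min (t + \<nu>) 0) \<partial>gauss)"
    by (simp add: I2_def gauss_def)
  moreover have "(\<integral>t. exp (- (c / sqrt \<beta>) * min (t + \<nu>) 0) \<partial>gauss) = (\<integral>t. exp (- (c / sqrt \<beta>) * min (- t + \<nu>) 0) \<partial>gauss)"
    by (rule gauss_uminus[symmetric]) measurable
  moreover have "(\<lambda>t. min (- t + \<nu>) 0) = (\<lambda>t. - max (t - \<nu>) 0)"
    by (auto simp: min_def max_def)
  then have "(\<integral>t. exp (- (c / sqrt \<beta>) * min (- t + \<nu>) 0) \<partial>gauss) = plus_mgf (c / sqrt \<beta>) \<nu>"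
    unfolding plus_mgf_def by (intro Bochner_Integration.integral_cong) (auto simp: fun_eq_iff)
  ultimately show ?thesis by simp
qed

section \<open>Limits of infima and of sandwiched sequences\<close>

text \<open>The growth \<open>c / 2\<close> confines the infimum to \<open>c < 2 * V\<close>, where
  finitely many grid points suffice. Every \<open>c\<close> is rounded up to the grid, so a
  one-sided Lipschitz bound is enough and the point 0 is never reached.\<close>

lemma tendsto_INF_grid:
  fixes H :: "nat \<Rightarrow> real \<Rightarrow> real" and h :: "real \<Rightarrow> real"
  assumes lower: "\<forall>\<^sub>F n in sequentially. \<forall>c>0. c / 2 \<le> H n c"
    and lip: "\<forall>\<^sub>F n in sequentially. \<forall>c d. 0 < c \<longrightarrow> c \<le> d \<longrightarrow> H n d \<le> H n c + K * (d - c)"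
    and lim: "\<And>c. 0 < c \<Longrightarrow> (\<lambda>n. H n c) \<longlonglongrightarrow> h c"
  shows "(\<lambda>n. INF c\<in>{0<..}. H n c) \<longlonglongrightarrow> (INF c\<in>{0<..}. h c)"
proof -
  define V where "V = (INF c\<in>{0<..}. h c)"
  have h: "c / 2 \<le> h c" if "0 < c" for c
  proof (rule tendsto_lowerbound[OF lim[OF that]])
    show "\<forall>\<^sub>F n in sequentially. c / 2 \<le> H n c"
      using lower by eventually_elim (use that in blast)
  qed simp
  have h0: "0 \<le> h c" if "0 < c" for c
    using h[OF that] that by linarith
  have bdd: "bdd_below (h ` {0<..})"
    by (rule bdd_belowI2[where m = 0]) (simp add: h0)
  have V0: "0 \<le> V"
    unfolding V_def by (rule cINF_greatest) (auto simp: h0)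
  have bddn: "bdd_below (H n ` {0<..})" if "\<forall>c>0. c / 2 \<le> H n c" for n
  proof (rule bdd_belowI2[where m = 0])
    fix c :: real assume "c \<in> {0<..}"
    then have "0 < c" "c / 2 \<le> H n c" using that by auto
    then show "0 \<le> H n c" by linarith
  qed
  show ?thesis
    unfolding V_def[symmetric]
  proof (rule order_tendstoI)
    fix x assume "V < x"
    then obtain c where c: "0 < c" "h c < x"
      unfolding V_def using bdd by (subst (asm) cINF_less_iff) auto
    from order_tendstoD(2)[OF lim[OF c(1)] c(2)] lower
    show "\<forall>\<^sub>F n in sequentially. (INF c\<in>{0<..}. H n c) < x"
    proof eventually_elim
      case (elim n)
      have "(INF c\<in>{0<..}. H n c) \<le> H n c"
        using c by (intro cINF_lower bddn elim(2)) auto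
      then show ?case using elim by simp
    qed
  next
    fix x assume x: "x < V"
    \<comment> \<open>One third is spent on convergence at the grid points, one on the Lipschitz
      error, and the last keeps the final inequality strict.\<close>
    define e where "e = (V - x) / 3"
    have e: "0 < e" using x by (simp add: e_def)
    define \<delta> where "\<delta> = e / (\<bar>K\<bar> + 1)"
    have \<delta>: "0 < \<delta>" "\<bar>K\<bar> * \<delta> \<le> e"
    proof -
      show "0 < \<delta>" using e by (simp add: \<delta>_def add_nonneg_pos)
      have "\<bar>K\<bar> * \<delta> \<le> (\<bar>K\<bar> + 1) * \<delta>" using \<open>0 < \<delta>\<close> by simp
      then show "\<bar>K\<bar> * \<delta> \<le> e" by (simp add: \<delta>_def)
    qed
    \<comment> \<open>Enough grid points of mesh \<open>\<delta>\<close> to cover the interval up to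
      \<open>2 * V\<close>.\<close>
    define m where "m = nat \<lceil>2 * V / \<delta>\<rceil>"
    have "\<forall>\<^sub>F n in sequentially. \<forall>i\<in>{1..m}. V - e < H n (real i * \<delta>)"
    proof (intro eventually_ball_finite finite_atLeastAtMost ballI)
      fix i assume i: "i \<in> {1..m}"
      then have p: "0 < real i * \<delta>" using \<delta> by simp
      have "V \<le> h (real i * \<delta>)"
        unfolding V_def using p by (intro cINF_lower bdd) auto
      then show "\<forall>\<^sub>F n in sequentially. V - e < H n (real i * \<delta>)"
        using e by (intro order_tendstoD(1)[OF lim[OF p]]) auto
    qed
    with lower lip show "\<forall>\<^sub>F n in sequentially. x < (INF c\<in>{0<..}. H n c)"
    proof eventually_elim
      case (elim n)
      have "V - 2 * e \<le> H n c" if c: "0 < c" for c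
      proof (cases "2 * V \<le> c")
        case True
        moreover have "c / 2 \<le> H n c" using elim(1) c by blast
        ultimately show ?thesis using e by linarith
      next
        case False
        define i where "i = nat \<lceil>c / \<delta>\<rceil>"
        have ci: "0 < \<lceil>c / \<delta>\<rceil>" using c \<delta> by simp
        have ri: "real i = of_int \<lceil>c / \<delta>\<rceil>" using ci by (simp add: i_def)
        have "c / \<delta> \<le> 2 * V / \<delta>" using False \<delta> by (intro divide_right_mono) auto
        then have "i \<le> m" unfolding i_def m_def by (intro nat_mono ceiling_mono)
        moreover have "1 \<le> i" using ci unfolding i_def by linarith
        ultimately have Hi: "V - e < H n (real i * \<delta>)" using elim(3) by auto
        have "c / \<delta> \<le> real i" "real i \<le> c / \<delta> + 1"
          unfolding ri by linarith+
        then have a: "c \<le> real i * \<delta>" "real i * \<delta> - c \<le> \<delta>"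
          using \<delta> by (simp_all add: field_simps)
        have "H n (real i * \<delta>) \<le> H n c + K * (real i * \<delta> - c)"
          using elim(2) c a by blast
        also have "\<dots> \<le> H n c + \<bar>K\<bar> * \<delta>"
          using a by (intro add_left_mono mult_mono) auto
        finally show ?thesis using Hi \<delta>(2) by linarith
      qed
      then have "V - 2 * e \<le> (INF c\<in>{0<..}. H n c)"
        by (intro cINF_greatest) auto
      moreover have "3 * e = V - x" by (simp add: e_def)
      ultimately show ?case using e by linarith
    qed
  qed
qed

text \<open>For every \<open>c\<close> the sequence stays within \<open>K * c\<close> of a
  convergent one, hence it is Cauchy. It is applied to the means, which are squeezed by the
  objectives at small \<open>c\<close>.\<close>

lemma convergent_sandwich:
  fixes x :: "nat \<Rightarrow> real"
  assumes le: "\<And>c. 0 < c \<Longrightarrow> \<forall>\<^sub>F n in sequentially. x n \<le> y c n \<and> y c n \<le> x n + K * c"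
    and lim: "\<And>c. 0 < c \<Longrightarrow> convergent (y c)"
  shows "convergent x"
proof -
  have "Cauchy x"
    unfolding Cauchy_altdef2
  proof (intro allI impI)
    fix e :: real assume e: "0 < e"
    define c where "c = e / (4 * (\<bar>K\<bar> + 1))"
    have c: "0 < c" "K * c < e / 2"
    proof -
      show "0 < c" using e by (simp add: c_def)
      have "K * c \<le> \<bar>K\<bar> * c" using \<open>0 < c\<close> by (intro mult_right_mono) auto
      also have "\<dots> < e / 2" using e by (auto simp: c_def field_simps intro!: add_pos_nonneg)
      finally show "K * c < e / 2" .
    qed
    have "Cauchy (y c)" using lim[OF c(1)] by (rule convergent_Cauchy)
    then obtain M1 where M1: "\<And>m n. M1 \<le> m \<Longrightarrow> M1 \<le> n \<Longrightarrow> dist (y c m) (y c n) < e / 2"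
      using e unfolding Cauchy_def by (meson half_gt_zero)
    obtain M2 where M2: "\<And>n. M2 \<le> n \<Longrightarrow> x n \<le> y c n \<and> y c n \<le> x n + K * c"
      using le[OF c(1)] unfolding eventually_sequentially by blast
    show "\<exists>M. \<forall>n\<ge>M. dist (x n) (x M) < e"
    proof (intro exI[of _ "max M1 M2"] allI impI)
      fix n assume n: "max M1 M2 \<le> n"
      show "dist (x n) (x (max M1 M2)) < e"
        using M1[of n "max M1 M2"] M2[of n] M2[of "max M1 M2"] n c
        unfolding dist_real_def by linarith
    qed
  qed
  then show ?thesis by (simp add: Cauchy_convergent_iff)
qed

subsection \<open>Comparison for submatrix sums\<close>

lemma gprod_reindex:
  assumes "inj_on e J" "e ` J \<subseteq> I"
  shows "distr (gprod I) (gprod J) (\<lambda>\<omega>. \<lambda>j\<in>J. \<omega> (e j)) = gprod J"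
  using distr_PiM_reindex[of I "\<lambda>_. gauss" e J] assms prob_space_gauss by auto

text \<open>Independence of the two coordinate blocks; it separates the row part from the column
  part of the linear process.\<close>

lemma nn_integral_gprod_Plus:
  fixes u :: "('a \<Rightarrow> real) \<Rightarrow> ennreal" and v :: "('b \<Rightarrow> real) \<Rightarrow> ennreal"
  assumes fin: "finite A" "finite B"
    and [measurable]: "u \<in> borel_measurable (gprod A)" "v \<in> borel_measurable (gprod B)"
  shows "(\<integral>\<^sup>+x. u (\<lambda>i\<in>A. x (Inl i)) * v (\<lambda>j\<in>B. x (Inr j)) \<partial>gprod (A <+> B))
    = (\<integral>\<^sup>+x. u x \<partial>gprod A) * (\<integral>\<^sup>+x. v x \<partial>gprod B)"
proof -
  let ?A = "Inl ` A :: ('a + 'b) set" and ?B = "Inr ` B :: ('a + 'b) set"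
  have m: "(\<lambda>x. u (\<lambda>i\<in>A. x (Inl i))) \<in> borel_measurable (gprod ?A)" "(\<lambda>x. v (\<lambda>j\<in>B. x (Inr j))) \<in> borel_measurable (gprod ?B)"
    "(\<lambda>x. u (\<lambda>i\<in>A. x (Inl i)) * v (\<lambda>j\<in>B. x (Inr j))) \<in> borel_measurable (gprod (?A \<union> ?B))"
    by measurable
  have r: "(\<lambda>i\<in>A. merge ?A ?B (x, y) (Inl i)) = (\<lambda>i\<in>A. x (Inl i))" "(\<lambda>j\<in>B. merge ?A ?B (x, y) (Inr j)) = (\<lambda>j\<in>B. y (Inr j))" for x y :: "_ \<Rightarrow> real"
    by (auto simp: merge_def)
  have "(\<integral>\<^sup>+x. u (\<lambda>i\<in>A. x (Inl i)) * v (\<lambda>j\<in>B. x (Inr j)) \<partial>gprod (?A \<union> ?B))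
     = (\<integral>\<^sup>+x. (\<integral>\<^sup>+y. u (\<lambda>i\<in>A. x (Inl i)) * v (\<lambda>j\<in>B. y (Inr j)) \<partial>gprod ?B) \<partial>gprod ?A)"
    using m fin by (subst GP.product_nn_integral_fold) (auto simp: r)
  also have "\<dots> = (\<integral>\<^sup>+x. u (\<lambda>i\<in>A. x (Inl i)) \<partial>gprod ?A) * (\<integral>\<^sup>+y. v (\<lambda>j\<in>B. y (Inr j)) \<partial>gprod ?B)"
    using m by (simp add: nn_integral_cmult nn_integral_multc)
  also have "(\<integral>\<^sup>+x. u (\<lambda>i\<in>A. x (Inl i)) \<partial>gprod ?A) = (\<integral>\<^sup>+x. u x \<partial>distr (gprod ?A) (gprod A) (\<lambda>x. \<lambda>i\<in>A. x (Inl i)))"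
    by (subst nn_integral_distr) auto
  also have "\<dots> = (\<integral>\<^sup>+x. u x \<partial>gprod A)"
    by (subst gprod_reindex) auto
  also have "(\<integral>\<^sup>+y. v (\<lambda>j\<in>B. y (Inr j)) \<partial>gprod ?B) = (\<integral>\<^sup>+x. v x \<partial>distr (gprod ?B) (gprod B) (\<lambda>x. \<lambda>i\<in>B. x (Inr i)))"
    by (subst nn_integral_distr) auto
  also have "\<dots> = (\<integral>\<^sup>+x. v x \<partial>gprod B)"
    by (subst gprod_reindex) auto
  finally show ?thesis unfolding Plus_def .
qed

lemma topsum_restrict: "topsum n k (\<lambda>i\<in>{1..n}. x i) = topsum n k x"
proof -
  have "(\<Sum>i\<in>S. (\<lambda>i\<in>{1..n}. x i) i) = (\<Sum>i\<in>S. x i)" if "S \<in> ksets n k" for S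
    using ksets_finite_sub[OF that] by (intro sum.cong) auto
  then show ?thesis unfolding topsum_def by (auto intro!: arg_cong[where f = Max] image_cong)
qed

definition pairmax :: "nat \<Rightarrow> nat \<Rightarrow> nat \<Rightarrow> nat \<Rightarrow> (nat \<times> nat \<Rightarrow> real) \<Rightarrow> real" where
  "pairmax m n k1 k2 B = Max ((\<lambda>(I, J). \<Sum>i\<in>I. \<Sum>j\<in>J. B (i, j)) ` (ksets m k1 \<times> ksets n k2))"

lemma pairmax_restrict: "pairmax m n k1 k2 (\<lambda>p\<in>{1..m}\<times>{1..n}. B p) = pairmax m n k1 k2 B"
proof -
  have "(\<Sum>i\<in>I. \<Sum>j\<in>J. (\<lambda>p\<in>{1..m}\<times>{1..n}. B p) (i, j)) = (\<Sum>i\<in>I. \<Sum>j\<in>J. B (i, j))"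
    if "I \<in> ksets m k1" "J \<in> ksets n k2" for I J
    using ksets_finite_sub[OF that(1)] ksets_finite_sub[OF that(2)] by (intro sum.cong refl) auto
  then show ?thesis unfolding pairmax_def by (auto intro!: arg_cong[where f = Max] image_cong)
qed

lemma pairmax_measurable [measurable]: "pairmax m n k1 k2 \<in> borel_measurable (gprod ({1..m} \<times> {1..n}))"
  unfolding pairmax_def[abs_def]
proof (intro borel_measurable_Max)
  fix s assume "s \<in> ksets m k1 \<times> ksets n k2"
  then obtain I J where s: "s = (I, J)" "I \<subseteq> {1..m}" "J \<subseteq> {1..n}"
    using ksets_finite_sub by fastforce
  show "(\<lambda>x. case s of (I, J) \<Rightarrow> \<Sum>i\<in>I. \<Sum>j\<in>J. x (i, j)) \<in> borel_measurable (gprod ({1..m} \<times> {1..n}))"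
    unfolding s(1) prod.case
  proof (intro borel_measurable_sum)
    fix i j assume "i \<in> I" "j \<in> J"
    then have "(i, j) \<in> {1..m} \<times> {1..n}" using s by blast
    then show "(\<lambda>x. x (i, j)) \<in> borel_measurable (gprod ({1..m} \<times> {1..n}))"
      by measurable
  qed
qed simp

text \<open>The bound is written as \<open>0 + 1 * ...\<close> to match the growth condition in
  \<open>integrable_gprod_linear_growth\<close>.\<close>

lemma pairmax_growth:
  assumes k: "k1 \<le> m" "k2 \<le> n"
  shows "\<bar>pairmax m n k1 k2 B\<bar> \<le> 0 + 1 * (\<Sum>p\<in>{1..m}\<times>{1..n}. \<bar>B p\<bar>)"
proof -
  have "pairmax m n k1 k2 B \<in> (\<lambda>(I, J). \<Sum>i\<in>I. \<Sum>j\<in>J. B (i, j)) ` (ksets m k1 \<times> ksets n k2)"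
    unfolding pairmax_def using ksets_nonempty k by (intro Max_in) auto
  then obtain I J where IJ: "I \<in> ksets m k1" "J \<in> ksets n k2" "pairmax m n k1 k2 B = (\<Sum>i\<in>I. \<Sum>j\<in>J. B (i, j))"
    by auto
  note sub = ksets_finite_sub[OF IJ(1)] ksets_finite_sub[OF IJ(2)]
  have "\<bar>pairmax m n k1 k2 B\<bar> = \<bar>\<Sum>p\<in>I \<times> J. B p\<bar>"
    using IJ by (simp add: sum.cartesian_product)
  also have "\<dots> \<le> (\<Sum>p\<in>I \<times> J. \<bar>B p\<bar>)" by (rule sum_abs)
  also have "\<dots> \<le> (\<Sum>p\<in>{1..m}\<times>{1..n}. \<bar>B p\<bar>)"
    using sub by (intro sum_mono2) auto
  finally show ?thesis by simp
qed

text \<open>Expansion of \<open>(1 - p) * (1 - q) \<ge> 0\<close>. With \<open>p\<close> and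
  \<open>q\<close> the relative overlaps of rows and columns this is the covariance comparison; it
  is an equality for full overlap.\<close>

lemma overlap_product:
  fixes p q :: real
  assumes "p \<le> 1" "q \<le> 1"
  shows "p + q \<le> 1 + p * q"
proof -
  have "0 \<le> (1 - p) * (1 - q)" using assms by simp
  then show ?thesis by (simp add: algebra_simps)
qed

lemma sum_indicator_overlap:
  assumes "finite A" "I \<subseteq> A"
  shows "(\<Sum>i\<in>A. (if i \<in> I then u else 0) * (if i \<in> J then v else 0)) = card (I \<inter> J) * (u * v :: real)"
proof -
  have "(\<Sum>i\<in>A. (if i \<in> I then u else 0) * (if i \<in> J then v else 0)) = (\<Sum>i\<in>I \<inter> J. u * v)"
    using assms by (intro sum.mono_neutral_cong_right) auto
  then show ?thesis by simp
qed

text \<open>The index (0, 0) lies outside the matrix and carries the additional scalar normal variable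
  that equalises the variances of the two processes.\<close>

lemma pairmax_exp_le:
  assumes k1: "0 < k1" "k1 \<le> m" and k2: "0 < k2" "k2 \<le> n" and c: "0 < c"
  shows "exp (c\<^sup>2 / 2) * (\<integral>x. exp (c * (pairmax m n k1 k2 x / sqrt (real k1 * real k2))) \<partial>gprod ({1..m} \<times> {1..n}))
    \<le> mgf m k1 (c / sqrt (real k1)) * mgf n k2 (c / sqrt (real k2))"
proof -
  define T where "T = ksets m k1 \<times> ksets n k2"
  define S where "S = {1..m} \<times> {1..n}"
  define w where "w = 1 / sqrt (real k1 * real k2)"
  \<comment> \<open>\<open>a\<close> is the bilinear process with the scalar variable added,
    \<open>b\<close> the linear process. Both have variance 2 at every index.\<close>
  define a where "a = (\<lambda>(I :: nat set, J :: nat set) p. if p = (0, 0) then 1 else if p \<in> I \<times> J then w else (0::real))"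
  define b where "b = (\<lambda>(I :: nat set, J :: nat set). case_sum (\<lambda>i. if i \<in> I then 1 / sqrt (real k1) else 0) (\<lambda>j. if j \<in> J then 1 / sqrt (real k2) else (0::real)))"
  define K where "K = insert (0::nat, 0::nat) S"
  define L where "L = {1..m} <+> {1..n}"
  have T: "finite T" "T \<noteq> {}"
    using ksets_nonempty k1 k2 by (auto simp: T_def)
  have S: "finite S" "(0, 0) \<notin> S" by (auto simp: S_def)
  have fin: "finite K" "finite L" by (auto simp: K_def L_def S_def)
  have w: "w * w = 1 / (real k1 * real k2)" using k1 k2 by (simp add: w_def)
  have ga: "gram K a (I, J) (I', J') = 1 + real (card (I \<inter> I')) / real k1 * (real (card (J \<inter> J')) / real k2)"
    if "(I, J) \<in> T" "(I', J') \<in> T" for I J I' J'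
  proof -
    have sub: "I \<subseteq> {1..m}" "J \<subseteq> {1..n}"
      using that ksets_finite_sub unfolding T_def by fast+
    have "gram K a (I, J) (I', J') = 1 + (\<Sum>p\<in>S. a (I, J) p * a (I', J') p)"
      unfolding gram_def K_def using S by (simp add: a_def)
    also have "(\<Sum>p\<in>S. a (I, J) p * a (I', J') p) = (\<Sum>p\<in>S. (if p \<in> I \<times> J then w else 0) * (if p \<in> I' \<times> J' then w else 0))"
      using S by (intro sum.cong) (auto simp: a_def)
    also have "\<dots> = card ((I \<times> J) \<inter> (I' \<times> J')) * (w * w)"
      using S sub by (intro sum_indicator_overlap) (auto simp: S_def)
    also have "(I \<times> J) \<inter> (I' \<times> J') = (I \<inter> I') \<times> (J \<inter> J')" by auto
    finally show ?thesis by (simp add: w card_cartesian_product)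
  qed
  have gb: "gram L b (I, J) (I', J') = real (card (I \<inter> I')) / real k1 + real (card (J \<inter> J')) / real k2"
    if "(I, J) \<in> T" "(I', J') \<in> T" for I J I' J'
  proof -
    have sub: "I \<subseteq> {1..m}" "J \<subseteq> {1..n}"
      using that ksets_finite_sub unfolding T_def by fast+
    have "gram L b (I, J) (I', J')
       = (\<Sum>i\<in>{1..m}. (if i \<in> I then 1 / sqrt (real k1) else 0) * (if i \<in> I' then 1 / sqrt (real k1) else 0))
       + (\<Sum>i\<in>{1..n}. (if i \<in> J then 1 / sqrt (real k2) else 0) * (if i \<in> J' then 1 / sqrt (real k2) else 0))"
      unfolding gram_def L_def b_def by (subst sum.Plus) (simp_all only: prod.case sum.case finite_atLeastAtMost comp_def)
    also have "\<dots> = card (I \<inter> I') * (1 / sqrt (real k1) * (1 / sqrt (real k1))) + card (J \<inter> J') * (1 / sqrt (real k2) * (1 / sqrt (real k2)))"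
      using sub by (intro arg_cong2[where f = "(+)"] sum_indicator_overlap) auto
    finally show ?thesis by simp
  qed
  have ov: "real (card (I \<inter> I')) / real k \<le> 1" "real (card (I \<inter> I)) / real k = 1"
    if "I \<in> ksets N k" "0 < k" for I I' N k
    using ksets_finite_sub[OF that(1)] that(2) card_mono[of I "I \<inter> I'"] by auto
  have "(\<integral>\<^sup>+\<omega>. exp (c * Max (linf K a \<omega> ` T)) \<partial>gprod K) \<le> (\<integral>\<^sup>+\<eta>. exp (c * Max (linf L b \<eta> ` T)) \<partial>gprod L)"
  proof (rule gaussian_max_comparison[OF T fin c])
    fix s t assume st: "s \<in> T" "t \<in> T"
    then obtain I J I' J' where "s = (I, J)" "t = (I', J')" by (metis surj_pair)
    then show "gram L b s t \<le> gram K a s t"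
      using st ga[of I J I' J'] gb[of I J I' J'] k1 k2
        overlap_product[OF ov(1)[of I m k1 I'] ov(1)[of J n k2 J']] by (simp add: T_def)
  next
    fix s assume s: "s \<in> T"
    then obtain I J where "s = (I, J)" by (metis surj_pair)
    then show "gram L b s s = gram K a s s"
      using s ga[of I J I J] gb[of I J I J] k1 k2 ov(2)[of I m k1] ov(2)[of J n k2] by (simp add: T_def)
  qed
  \<comment> \<open>The scalar variable is independent of the matrix and shifts all indices equally,
    so it factors out of the exponential moment as \<open>exp (c\<^sup>2 / 2)\<close>.\<close>
  moreover have "ennreal (exp (c\<^sup>2 / 2) * (\<integral>x. exp (c * (pairmax m n k1 k2 x / sqrt (real k1 * real k2))) \<partial>gprod S))
      \<le> (\<integral>\<^sup>+\<omega>. exp (c * Max (linf K a \<omega> ` T)) \<partial>gprod K)"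
  proof -
    have la: "linf K a \<omega> (I, J) = \<omega> (0, 0) + w * (\<Sum>i\<in>I. \<Sum>j\<in>J. \<omega> (i, j))" if "(I, J) \<in> T" for \<omega> I J
    proof -
      have sub: "I \<subseteq> {1..m}" "J \<subseteq> {1..n}"
        using that ksets_finite_sub unfolding T_def by fast+
      have "linf K a \<omega> (I, J) = \<omega> (0, 0) + (\<Sum>p\<in>S. a (I, J) p * \<omega> p)"
        unfolding linf_def K_def using S by (simp add: a_def)
      also have "(\<Sum>p\<in>S. a (I, J) p * \<omega> p) = (\<Sum>p\<in>I \<times> J. w * \<omega> p)"
        using S sub by (intro sum.mono_neutral_cong_right) (auto simp: a_def S_def)
      finally show ?thesis by (simp add: sum_distrib_left sum.cartesian_product)
    qed
    have le: "\<omega> (0, 0) + w * pairmax m n k1 k2 \<omega> \<le> Max (linf K a \<omega> ` T)" for \<omega>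
    proof -
      have "pairmax m n k1 k2 \<omega> \<in> (\<lambda>(I, J). \<Sum>i\<in>I. \<Sum>j\<in>J. \<omega> (i, j)) ` T"
        unfolding pairmax_def T_def[symmetric] using T by (intro Max_in) auto
      then obtain I J where IJ: "(I, J) \<in> T" "pairmax m n k1 k2 \<omega> = (\<Sum>i\<in>I. \<Sum>j\<in>J. \<omega> (i, j))"
        by auto
      have "\<omega> (0, 0) + w * pairmax m n k1 k2 \<omega> = linf K a \<omega> (I, J)"
        using la[OF IJ(1)] IJ(2) by simp
      also have "\<dots> \<le> Max (linf K a \<omega> ` T)"
        using IJ T by (intro Max_ge) auto
      finally show ?thesis .
    qed
    have pr: "pairmax m n k1 k2 (x((0, 0) := y)) = pairmax m n k1 k2 x" for x y
    proof -
      have "(\<lambda>p\<in>{1..m}\<times>{1..n}. (x((0, 0) := y)) p) = (\<lambda>p\<in>{1..m}\<times>{1..n}. x p)" by auto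
      then show ?thesis by (metis pairmax_restrict)
    qed
    have pm: "pairmax m n k1 k2 \<in> borel_measurable (gprod K)"
    proof -
      have "(\<lambda>x. pairmax m n k1 k2 (\<lambda>p\<in>S. x p)) \<in> borel_measurable (gprod K)"
        unfolding S_def K_def by measurable
      then show ?thesis unfolding S_def pairmax_restrict .
    qed
    have pS: "pairmax m n k1 k2 \<in> borel_measurable (gprod S)"
      unfolding S_def by (rule pairmax_measurable)
    have "integrable (gprod S) (\<lambda>x. exp (c * w * pairmax m n k1 k2 x))"
      unfolding S_def by (rule integrable_gprod_linear_growth(2)[OF _ pairmax_measurable pairmax_growth]) (use k1 k2 in auto)
    then have ip: "integrable (gprod S) (\<lambda>x. exp (c * (w * pairmax m n k1 k2 x)))" by (simp add: mult.assoc)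
    have "ennreal (exp (c\<^sup>2 / 2) * (\<integral>x. exp (c * (w * pairmax m n k1 k2 x)) \<partial>gprod S))
      = (\<integral>\<^sup>+y. ennreal (exp (c * y)) \<partial>gauss) * (\<integral>\<^sup>+x. ennreal (exp (c * (w * pairmax m n k1 k2 x))) \<partial>gprod S)"
      using ip by (simp add: nn_integral_eq_integral integral_exp_gauss ennreal_mult)
    also have "\<dots> = (\<integral>\<^sup>+y. (\<integral>\<^sup>+x. ennreal (exp (c * y)) * ennreal (exp (c * (w * pairmax m n k1 k2 x))) \<partial>gprod S) \<partial>gauss)"
      using pS by (simp add: nn_integral_cmult nn_integral_multc)
    also have "\<dots> = (\<integral>\<^sup>+\<omega>. ennreal (exp (c * \<omega> (0, 0))) * ennreal (exp (c * (w * pairmax m n k1 k2 \<omega>))) \<partial>gprod K)"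
      unfolding K_def using pm S by (subst GP.product_nn_integral_insert_rev) (auto simp: K_def pr)
    also have "\<dots> \<le> (\<integral>\<^sup>+\<omega>. exp (c * Max (linf K a \<omega> ` T)) \<partial>gprod K)"
    proof (intro nn_integral_mono)
      fix \<omega>
      show "ennreal (exp (c * \<omega> (0, 0))) * ennreal (exp (c * (w * pairmax m n k1 k2 \<omega>))) \<le> ennreal (exp (c * Max (linf K a \<omega> ` T)))"
        using mult_left_mono[OF le[of \<omega>], of c] c
        by (simp add: ennreal_mult[symmetric] exp_add[symmetric] distrib_left)
    qed
    finally show ?thesis by (simp add: w_def)
  qed
  moreover have "(\<integral>\<^sup>+\<eta>. exp (c * Max (linf L b \<eta> ` T)) \<partial>gprod L)
      \<le> ennreal (mgf m k1 (c / sqrt (real k1)) * mgf n k2 (c / sqrt (real k2)))"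
  proof -
    let ?u = "\<lambda>x. exp (c / sqrt (real k1) * topsum m k1 x)" and ?v = "\<lambda>x. exp (c / sqrt (real k2) * topsum n k2 x)"
    have lb: "linf L b \<eta> (I, J) = (\<Sum>i\<in>I. \<eta> (Inl i)) / sqrt (real k1) + (\<Sum>j\<in>J. \<eta> (Inr j)) / sqrt (real k2)" if "(I, J) \<in> T" for \<eta> I J
    proof -
      have sub: "I \<subseteq> {1..m}" "J \<subseteq> {1..n}"
        using that ksets_finite_sub unfolding T_def by fast+
      have "(\<Sum>i\<in>{1..m}. (if i \<in> I then 1 / sqrt (real k1) else 0) * \<eta> (Inl i)) = (\<Sum>i\<in>I. 1 / sqrt (real k1) * \<eta> (Inl i))"
        "(\<Sum>i\<in>{1..n}. (if i \<in> J then 1 / sqrt (real k2) else 0) * \<eta> (Inr i)) = (\<Sum>i\<in>J. 1 / sqrt (real k2) * \<eta> (Inr i))"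
        using sub by (auto intro!: sum.mono_neutral_cong_right)
      then show ?thesis
        unfolding linf_def L_def b_def by (simp add: sum.Plus sum_divide_distrib)
    qed
    have le: "exp (c * Max (linf L b \<eta> ` T)) \<le> ?u (\<lambda>i\<in>{1..m}. \<eta> (Inl i)) * ?v (\<lambda>j\<in>{1..n}. \<eta> (Inr j))" for \<eta>
    proof -
      have "Max (linf L b \<eta> ` T) \<le> topsum m k1 (\<lambda>i. \<eta> (Inl i)) / sqrt (real k1) + topsum n k2 (\<lambda>i. \<eta> (Inr i)) / sqrt (real k2)"
      proof (subst Max_le_iff)
        show "\<forall>x\<in>linf L b \<eta> ` T. x \<le> topsum m k1 (\<lambda>i. \<eta> (Inl i)) / sqrt (real k1) + topsum n k2 (\<lambda>i. \<eta> (Inr i)) / sqrt (real k2)"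
          using lb by (auto simp: T_def intro!: add_mono divide_right_mono topsum_ge)
      qed (use T in auto)
      from mult_left_mono[OF this, of c] c show ?thesis
        unfolding topsum_restrict by (simp add: exp_add[symmetric] distrib_left)
    qed
    have "(\<integral>\<^sup>+\<eta>. exp (c * Max (linf L b \<eta> ` T)) \<partial>gprod L)
       \<le> (\<integral>\<^sup>+\<eta>. ennreal (?u (\<lambda>i\<in>{1..m}. \<eta> (Inl i))) * ennreal (?v (\<lambda>j\<in>{1..n}. \<eta> (Inr j))) \<partial>gprod L)"
      using le by (intro nn_integral_mono) (simp add: ennreal_mult[symmetric] del: restrict_apply)
    also have "\<dots> = (\<integral>\<^sup>+x. ennreal (?u x) \<partial>gprod {1..m}) * (\<integral>\<^sup>+x. ennreal (?v x) \<partial>gprod {1..n})"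
      unfolding L_def by (intro nn_integral_gprod_Plus[where u = "\<lambda>x. ennreal (?u x)" and v = "\<lambda>x. ennreal (?v x)"] finite_atLeastAtMost; measurable)
    also have "\<dots> = ennreal (mgf m k1 (c / sqrt (real k1)) * mgf n k2 (c / sqrt (real k2)))"
      using topsum_integrable(2)[OF k1(2), of "c / sqrt (real k1)"] topsum_integrable(2)[OF k2(2), of "c / sqrt (real k2)"]
      by (simp add: nn_integral_eq_integral mgf_def ennreal_mult)
    finally show ?thesis .
  qed
  ultimately have "ennreal (exp (c\<^sup>2 / 2) * (\<integral>x. exp (c * (pairmax m n k1 k2 x / sqrt (real k1 * real k2))) \<partial>gprod S))
     \<le> ennreal (mgf m k1 (c / sqrt (real k1)) * mgf n k2 (c / sqrt (real k2)))"
    by (meson order_trans)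
  then show ?thesis
    using mgf_pos[OF k1(2), of "c / sqrt (real k1)"] mgf_pos[OF k2(2), of "c / sqrt (real k2)"]
    by (subst (asm) ennreal_le_iff) (auto simp: S_def)
qed

text \<open>Jensen's inequality on the left and logarithms on both sides of
  \<open>pairmax_exp_le\<close>; the scalar variable becomes the term \<open>- c / 2\<close>. As
  \<open>c\<close> is arbitrary, the bound passes to the infimum defining
  \<open>lifted_bound\<close>.\<close>

lemma pairmax_mean_le:
  assumes k1: "0 < k1" "k1 \<le> m" and k2: "0 < k2" "k2 \<le> n" and c: "0 < c"
  shows "(\<integral>x. pairmax m n k1 k2 x \<partial>gprod ({1..m} \<times> {1..n})) / sqrt (real k1 * real k2)
    \<le> - c / 2 + 1 / c * ln (mgf m k1 (c / sqrt (real k1))) + 1 / c * ln (mgf n k2 (c / sqrt (real k2)))"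
proof -
  let ?S = "{1..m} \<times> {1..n}" and ?w = "sqrt (real k1 * real k2)"
  have g: "integrable (gprod ?S) (pairmax m n k1 k2)" "integrable (gprod ?S) (\<lambda>x. exp (d * pairmax m n k1 k2 x))" for d
    by (rule integrable_gprod_linear_growth[OF _ pairmax_measurable pairmax_growth]; use k1 k2 in auto)+
  define \<mu> where "\<mu> = (\<integral>x. pairmax m n k1 k2 x \<partial>gprod ?S) / ?w"
  have "exp (c / ?w * (\<integral>x. pairmax m n k1 k2 x \<partial>gprod ?S)) \<le> (\<integral>x. exp (c / ?w * pairmax m n k1 k2 x) \<partial>gprod ?S)"
    by (intro exp_expectation_le prob_space_gprod g)
  then have "exp (c * \<mu>) \<le> (\<integral>x. exp (c * (pairmax m n k1 k2 x / ?w)) \<partial>gprod ?S)"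
    by (simp add: \<mu>_def)
  then have "exp (c\<^sup>2 / 2) * exp (c * \<mu>) \<le> mgf m k1 (c / sqrt (real k1)) * mgf n k2 (c / sqrt (real k2))"
    by (intro order_trans[OF mult_left_mono pairmax_exp_le[OF k1 k2 c]]) auto
  then have "exp (c\<^sup>2 / 2 + c * \<mu>) \<le> exp (ln (mgf m k1 (c / sqrt (real k1))) + ln (mgf n k2 (c / sqrt (real k2))))"
    using mgf_pos[OF k1(2)] mgf_pos[OF k2(2)] by (simp add: exp_add)
  then have "c * \<mu> \<le> ln (mgf m k1 (c / sqrt (real k1))) + ln (mgf n k2 (c / sqrt (real k2))) - c\<^sup>2 / 2"
    by simp
  then have "c * \<mu> / c \<le> (ln (mgf m k1 (c / sqrt (real k1))) + ln (mgf n k2 (c / sqrt (real k2))) - c\<^sup>2 / 2) / c"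
    using c by (intro divide_right_mono) auto
  then show ?thesis
    using c unfolding \<mu>_def[symmetric] by (simp add: diff_divide_distrib add_divide_distrib power2_eq_square)
qed

subsection \<open>Selectors and Gaussian data\<close>

lemma distr_gaussian_family:
  assumes "prob_space M" "I \<noteq> {}" and ind: "prob_space.indep_vars M (\<lambda>_. borel) X I"
    and X: "\<And>i. i \<in> I \<Longrightarrow> distributed M lborel (X i) std_normal_density"
  shows "distr M (gprod I) (\<lambda>\<omega>. \<lambda>i\<in>I. X i \<omega>) = gprod I"
proof -
  interpret prob_space M by fact
  have rv: "X i \<in> borel_measurable M" if "i \<in> I" for i
    using distributed_measurable[OF X[OF that]] by simp
  have d: "distr M borel (X i) = gauss" if "i \<in> I" for i
    using distributed_distr_eq_density[OF X[OF that]] by (simp add: gauss_def cong: distr_cong)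
  have "distr M (PiM I (\<lambda>_. borel)) (\<lambda>\<omega>. \<lambda>i\<in>I. X i \<omega>) = PiM I (\<lambda>i. distr M borel (X i))"
    using indep_vars_iff_distr_eq_PiM'[OF assms(2), where M' = "\<lambda>_. borel" and X = X] rv ind by simp
  also have "\<dots> = gprod I"
    by (intro PiM_cong d refl)
  also have "distr M (PiM I (\<lambda>_. borel)) (\<lambda>\<omega>. \<lambda>i\<in>I. X i \<omega>) = distr M (gprod I) (\<lambda>\<omega>. \<lambda>i\<in>I. X i \<omega>)"
    by (intro distr_cong refl sets_PiM_cong) auto
  finally show ?thesis .
qed

text \<open>The joint law is a Gaussian product, and the law of the coordinates selected by an
  injection \<open>e\<close> is again one. Thus expectations on an arbitrary probability space
  become integrals over \<open>gprod\<close>.\<close>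

lemma integral_gaussian_subfamily:
  fixes f :: "('j \<Rightarrow> real) \<Rightarrow> real"
  assumes M: "prob_space M" "I \<noteq> {}" and ind: "prob_space.indep_vars M (\<lambda>_. borel) X I"
    and X: "\<And>i. i \<in> I \<Longrightarrow> distributed M lborel (X i) std_normal_density"
    and e: "inj_on e J" "e ` J \<subseteq> I" and f: "f \<in> borel_measurable (gprod J)"
  shows "(\<integral>\<omega>. f (\<lambda>j\<in>J. X (e j) \<omega>) \<partial>M) = (\<integral>x. f x \<partial>gprod J)"
    and "integrable M (\<lambda>\<omega>. f (\<lambda>j\<in>J. X (e j) \<omega>)) \<longleftrightarrow> integrable (gprod J) f"
proof -
  have rv: "X i \<in> M \<rightarrow>\<^sub>M gauss" if "i \<in> I" for i
    using distributed_measurable[OF X[OF that]] by (simp cong: measurable_cong_sets)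
  have m: "(\<lambda>\<omega>. \<lambda>i\<in>I. X i \<omega>) \<in> M \<rightarrow>\<^sub>M gprod I"
    using rv by (rule measurable_restrict)
  have r: "(\<lambda>\<omega>. \<lambda>j\<in>J. \<omega> (e j)) \<in> gprod I \<rightarrow>\<^sub>M gprod J"
    using e by (intro measurable_restrict measurable_component_singleton) auto
  have c: "(\<lambda>\<omega>. \<lambda>j\<in>J. \<omega> (e j)) \<circ> (\<lambda>\<omega>. \<lambda>i\<in>I. X i \<omega>) = (\<lambda>\<omega>. \<lambda>j\<in>J. X (e j) \<omega>)"
    using e by (auto simp: restrict_def fun_eq_iff)
  have mJ: "(\<lambda>\<omega>. \<lambda>j\<in>J. X (e j) \<omega>) \<in> M \<rightarrow>\<^sub>M gprod J"
    using measurable_comp[OF m r] unfolding c .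
  have law: "distr M (gprod J) (\<lambda>\<omega>. \<lambda>j\<in>J. X (e j) \<omega>) = gprod J"
    using distr_distr[OF r m] unfolding c by (simp add: distr_gaussian_family[OF M ind X] gprod_reindex[OF e])
  show "(\<integral>\<omega>. f (\<lambda>j\<in>J. X (e j) \<omega>) \<partial>M) = (\<integral>x. f x \<partial>gprod J)"
    using integral_distr[OF mJ f] unfolding law by simp
  show "integrable M (\<lambda>\<omega>. f (\<lambda>j\<in>J. X (e j) \<omega>)) \<longleftrightarrow> integrable (gprod J) f"
    using integrable_distr_eq[OF mJ f] unfolding law by simp
qed

lemma gaussian_data_marginals:
  fixes f :: "(nat \<Rightarrow> real) \<Rightarrow> real" and F :: "(nat \<times> nat \<Rightarrow> real) \<Rightarrow> real"
  assumes d: "gaussian_data M m n h g A" and n: "1 \<le> n"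
  shows "f \<in> borel_measurable (gprod {1..m}) \<Longrightarrow> (\<integral>\<omega>. f (\<lambda>i\<in>{1..m}. h i \<omega>) \<partial>M) = (\<integral>x. f x \<partial>gprod {1..m})"
    and "f \<in> borel_measurable (gprod {1..m}) \<Longrightarrow> integrable M (\<lambda>\<omega>. f (\<lambda>i\<in>{1..m}. h i \<omega>)) \<longleftrightarrow> integrable (gprod {1..m}) f"
    and "f \<in> borel_measurable (gprod {1..n}) \<Longrightarrow> (\<integral>\<omega>. f (\<lambda>j\<in>{1..n}. g j \<omega>) \<partial>M) = (\<integral>x. f x \<partial>gprod {1..n})"
    and "f \<in> borel_measurable (gprod {1..n}) \<Longrightarrow> integrable M (\<lambda>\<omega>. f (\<lambda>j\<in>{1..n}. g j \<omega>)) \<longleftrightarrow> integrable (gprod {1..n}) f"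
    and "F \<in> borel_measurable (gprod ({1..m} \<times> {1..n})) \<Longrightarrow>
      (\<integral>\<omega>. F (\<lambda>p\<in>{1..m} \<times> {1..n}. A (fst p) (snd p) \<omega>) \<partial>M) = (\<integral>x. F x \<partial>gprod ({1..m} \<times> {1..n}))"
proof -
  let ?X = "case_sum h (case_sum g (\<lambda>(i, j). A i j))" and ?I = "{1..m} <+> ({1..n} <+> {1..m} \<times> {1..n})"
  have M: "prob_space M" and ind: "prob_space.indep_vars M (\<lambda>_. borel) ?X ?I"
    and X: "\<And>i. i \<in> ?I \<Longrightarrow> distributed M lborel (?X i) std_normal_density"
    using d unfolding gaussian_data_def by auto
  \<comment> \<open>The column block provides an index because \<open>n\<close> is at least
    1.\<close>
  have I: "?I \<noteq> {}" using n by auto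
  note sub = integral_gaussian_subfamily[OF M I ind X]
  show "(\<integral>\<omega>. f (\<lambda>i\<in>{1..m}. h i \<omega>) \<partial>M) = (\<integral>x. f x \<partial>gprod {1..m})"
    "integrable M (\<lambda>\<omega>. f (\<lambda>i\<in>{1..m}. h i \<omega>)) \<longleftrightarrow> integrable (gprod {1..m}) f" if "f \<in> borel_measurable (gprod {1..m})"
    using sub[where e = Inl and J = "{1..m}" and f = f] that by (auto simp: inj_on_def)
  show "(\<integral>\<omega>. f (\<lambda>j\<in>{1..n}. g j \<omega>) \<partial>M) = (\<integral>x. f x \<partial>gprod {1..n})"
    "integrable M (\<lambda>\<omega>. f (\<lambda>j\<in>{1..n}. g j \<omega>)) \<longleftrightarrow> integrable (gprod {1..n}) f" if "f \<in> borel_measurable (gprod {1..n})"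
    using sub[where e = "\<lambda>j. Inr (Inl j)" and J = "{1..n}" and f = f] that by (auto simp: inj_on_def)
  show "(\<integral>\<omega>. F (\<lambda>p\<in>{1..m} \<times> {1..n}. A (fst p) (snd p) \<omega>) \<partial>M) = (\<integral>x. F x \<partial>gprod ({1..m} \<times> {1..n}))"
    if "F \<in> borel_measurable (gprod ({1..m} \<times> {1..n}))"
    using sub(1)[where e = "\<lambda>p. Inr (Inr p)" and J = "{1..m} \<times> {1..n}" and f = F] that by (auto simp: inj_on_def case_prod_beta)
qed

section \<open>Selectors as subsets of fixed size\<close>

lemma selectors_eq:
  assumes k: "0 < k"
  shows "selectors n k = (\<lambda>S. \<lambda>i\<in>{1..n}. if i \<in> S then 1 / sqrt (real k) else 0) ` ksets n k"
proof (intro equalityI subsetI)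
  fix x assume "x \<in> selectors n k"
  then have x: "x \<in> {1..n} \<rightarrow>\<^sub>E {0, 1 / sqrt (real k)}" "(\<Sum>i = 1..n. x i) = sqrt (real k)"
    by (auto simp: selectors_def)
  define S where "S = {i \<in> {1..n}. x i \<noteq> 0}"
  have xe: "x = (\<lambda>i\<in>{1..n}. if i \<in> S then 1 / sqrt (real k) else 0)"
  proof
    fix i show "x i = (\<lambda>i\<in>{1..n}. if i \<in> S then 1 / sqrt (real k) else 0) i"
      using x(1) by (cases "i \<in> {1..n}") (auto simp: S_def PiE_iff extensional_def)
  qed
  have "(\<Sum>i = 1..n. x i) = (\<Sum>i\<in>S. 1 / sqrt (real k))"
    using x(1) by (intro sum.mono_neutral_cong_right) (auto simp: S_def PiE_iff)
  \<comment> \<open>The prescribed sum forces the support to have exactly \<open>k\<close>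
    elements.\<close>
  then have "sqrt (real k) * sqrt (real k) = real (card S)"
    using k unfolding x(2) by (simp add: field_simps)
  then have "card S = k" by simp
  then have "S \<in> ksets n k" by (auto simp: ksets_def S_def)
  then show "x \<in> (\<lambda>S. \<lambda>i\<in>{1..n}. if i \<in> S then 1 / sqrt (real k) else 0) ` ksets n k"
    using xe by blast
next
  fix x assume "x \<in> (\<lambda>S. \<lambda>i\<in>{1..n}. if i \<in> S then 1 / sqrt (real k) else 0) ` ksets n k"
  then obtain S where S: "S \<in> ksets n k" and x: "x = (\<lambda>i\<in>{1..n}. if i \<in> S then 1 / sqrt (real k) else 0)"
    by blast
  have "(\<Sum>i = 1..n. x i) = (\<Sum>i\<in>S. 1 / sqrt (real k))"
    unfolding x using ksets_finite_sub[OF S] by (intro sum.mono_neutral_cong_right) auto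
  also have "\<dots> = sqrt (real k)"
    using ksets_finite_sub[OF S] by (simp add: real_div_sqrt)
  finally show "x \<in> selectors n k"
    unfolding selectors_def using x by auto
qed

lemma selector_values:
  assumes k: "0 < k"
  shows "{(\<Sum>i = 1..n. g i * x i) | x. x \<in> selectors n k} = (\<lambda>S. (\<Sum>i\<in>S. g i) / sqrt (real k)) ` ksets n k"
proof -
  have "(\<Sum>i = 1..n. g i * (\<lambda>i\<in>{1..n}. if i \<in> S then 1 / sqrt (real k) else 0) i) = (\<Sum>i\<in>S. g i) / sqrt (real k)"
    if S: "S \<in> ksets n k" for S
    unfolding sum_divide_distrib using ksets_finite_sub[OF S] by (intro sum.mono_neutral_cong_right) auto
  then show ?thesis
    unfolding setcompr_eq_image selectors_eq[OF k] Collect_mem_eq image_image by (intro image_cong refl)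
qed

lemma lin_max_eq:
  assumes k: "0 < k" "k \<le> n"
  shows "lin_max n k g = topsum n k g / sqrt (real k)"
proof -
  have "mono (\<lambda>v::real. v / sqrt (real k))"
    by (intro monoI divide_right_mono) auto
  from mono_Max_commute[OF this, of "(\<lambda>S. \<Sum>i\<in>S. g i) ` ksets n k"]
  show ?thesis
    unfolding lin_max_def selector_values[OF k(1)] topsum_def
    using ksets_nonempty[OF k(2)] by (simp add: image_image)
qed

text \<open>The two selectors vary independently, so the maximum of the sum is the sum of the
  maxima.\<close>

lemma lin_bound_eq:
  assumes k1: "0 < k1" "k1 \<le> m" and k2: "0 < k2" "k2 \<le> n"
  shows "lin_bound m n k1 k2 h g = 1 / sqrt (real k1 * real k2) * (topsum m k1 h / sqrt (real k1) + topsum n k2 g / sqrt (real k2))"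
proof -
  let ?Y = "{(\<Sum>i = 1..m. h i * y i) | y. y \<in> selectors m k1}" and ?X = "{(\<Sum>j = 1..n. g j * x j) | x. x \<in> selectors n k2}"
  have fin: "finite ?Y" "?Y \<noteq> {}" "finite ?X" "?X \<noteq> {}"
    unfolding selector_values[OF k1(1)] selector_values[OF k2(1)]
    using ksets_nonempty[OF k1(2)] ksets_nonempty[OF k2(2)] by auto
  have eq: "{(\<Sum>i = 1..m. h i * y i) + (\<Sum>j = 1..n. g j * x j) | x y. x \<in> selectors n k2 \<and> y \<in> selectors m k1}
     = (\<lambda>(u, v). u + v) ` (?Y \<times> ?X)" by force
  have "Max ((\<lambda>(u, v). u + v) ` (?Y \<times> ?X)) = Max ?Y + Max ?X"
  proof (rule Max_eqI)
    show "finite ((\<lambda>(u, v). u + v) ` (?Y \<times> ?X))" using fin by blast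
    show "y \<le> Max ?Y + Max ?X" if "y \<in> (\<lambda>(u, v). u + v) ` (?Y \<times> ?X)" for y
      using that fin by (auto intro!: add_mono Max_ge)
    show "Max ?Y + Max ?X \<in> (\<lambda>(u, v). u + v) ` (?Y \<times> ?X)"
      using Max_in[OF fin(1,2)] Max_in[OF fin(3,4)] by (intro image_eqI[of _ _ "(Max ?Y, Max ?X)"]) simp_all
  qed
  then show ?thesis
    unfolding lin_bound_def eq using lin_max_eq[OF k1, of h] lin_max_eq[OF k2, of g] unfolding lin_max_def by simp
qed

lemma submatrix_avg_eq:
  "submatrix_avg m n k1 k2 A = 1 / (real k1 * real k2) * pairmax m n k1 k2 (\<lambda>p. A (fst p) (snd p))"
proof -
  have "{(\<Sum>i\<in>I1. \<Sum>j\<in>I2. A i j) | I1 I2. I1 \<subseteq> {1..m} \<and> card I1 = k1 \<and> I2 \<subseteq> {1..n} \<and> card I2 = k2}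
     = (\<lambda>(I, J). \<Sum>i\<in>I. \<Sum>j\<in>J. A i j) ` (ksets m k1 \<times> ksets n k2)"
    unfolding ksets_def by force
  then show ?thesis
    unfolding submatrix_avg_def pairmax_def by simp
qed

lemma real_INF_mult:
  fixes f :: "'a \<Rightarrow> real"
  assumes s: "0 < s" and A: "A \<noteq> {}" and bdd: "bdd_below (f ` A)"
  shows "(INF x\<in>A. s * f x) = s * (INF x\<in>A. f x)"
proof (rule antisym)
  obtain b where b: "\<And>x. x \<in> A \<Longrightarrow> b \<le> f x"
    using bdd by (auto simp: bdd_below_def)
  have bdd': "bdd_below ((\<lambda>x. s * f x) ` A)"
    by (rule bdd_belowI2[where m = "s * b"]) (use b s in simp)
  have "(INF x\<in>A. s * f x) / s \<le> (INF x\<in>A. f x)"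
  proof (rule cINF_greatest[OF A])
    fix x assume "x \<in> A"
    then have "(INF x\<in>A. s * f x) \<le> s * f x" by (intro cINF_lower bdd')
    then show "(INF x\<in>A. s * f x) / s \<le> f x" using s by (simp add: pos_divide_le_eq mult.commute)
  qed
  then show "(INF x\<in>A. s * f x) \<le> s * (INF x\<in>A. f x)"
    using s by (simp add: pos_divide_le_eq mult.commute)
  show "s * (INF x\<in>A. f x) \<le> (INF x\<in>A. s * f x)"
    using s by (intro cINF_greatest[OF A] mult_left_mono cINF_lower bdd) auto
qed

section \<open>The normalised contribution of one vector to the objective\<close>

text \<open>One logarithmic term of \<open>lifted_bound\<close> at the argument
  \<open>sqrt n * c\<close>, divided by \<open>sqrt n\<close>. Its expression through
  \<open>rate\<close> isolates the factors that converge separately; \<open>block_eq\<close> gives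
  the direct form.\<close>

definition block :: "nat \<Rightarrow> nat \<Rightarrow> nat \<Rightarrow> real \<Rightarrow> real" where
  "block N k n c = real N / real n * sqrt (real n / real k) * rate N k (c * sqrt (real n / real k))"

text \<open>The expected maximum over selectors divided by \<open>sqrt n\<close>, which is the value
  of \<open>block\<close> in the limit of vanishing \<open>c\<close>.\<close>

definition block_mean :: "nat \<Rightarrow> nat \<Rightarrow> nat \<Rightarrow> real" where
  "block_mean N k n = topmean N k / (sqrt (real k) * sqrt (real n))"

lemma block_eq:
  assumes "0 < k" "k \<le> N" "0 < n"
  shows "block N k n c = ln (mgf N k (c * sqrt (real n / real k))) / (real n * c)"
proof -
  have "sqrt (real n / real k) \<noteq> 0" using assms by simp
  then show ?thesis
    unfolding block_def rate_def using assms by (cases "c = 0") (simp_all add: field_simps)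
qed

text \<open>Two blocks contribute at least \<open>c / 2\<close> each, so after subtracting
  \<open>c / 2\<close> the whole objective is still at least \<open>c / 2\<close>.\<close>

lemma block_ge:
  assumes k: "0 < k" "k \<le> N" and n: "0 < n" and c: "0 < c"
  shows "c / 2 \<le> block N k n c"
proof -
  define \<theta> where "\<theta> = sqrt (real n / real k)"
  have t: "0 < \<theta>" "\<theta> * \<theta> = real n / real k" using k n by (auto simp: \<theta>_def)
  have "c / 2 = real N / real n * (\<theta> * \<theta>) * (real k / real N) * (c / 2)"
    unfolding t using k n by simp
  also have "\<dots> = real N / real n * \<theta> * (real k / real N * (c * \<theta> / 2))" by simp
  also have "\<dots> \<le> block N k n c"
    unfolding block_def \<theta>_def[symmetric] using t c k by (intro mult_left_mono rate_ge) auto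
  finally show ?thesis .
qed

lemma block_lipschitz:
  assumes k: "0 < k" "k \<le> N" and n: "0 < n" and c: "0 < c" "c \<le> d"
  shows "block N k n d \<le> block N k n c + 4 * (real N / real k) * (d - c)"
proof -
  define \<theta> where "\<theta> = sqrt (real n / real k)"
  have t: "0 < \<theta>" "\<theta> * \<theta> = real n / real k" using k n by (auto simp: \<theta>_def)
  have "block N k n d \<le> real N / real n * \<theta> * (rate N k (c * \<theta>) + 4 * (d * \<theta> - c * \<theta>))"
    unfolding block_def \<theta>_def[symmetric] using t c k by (intro mult_left_mono rate_lipschitz) auto
  also have "\<dots> = block N k n c + 4 * (real N / real n * (\<theta> * \<theta>)) * (d - c)"
    unfolding block_def \<theta>_def[symmetric] by (simp add: algebra_simps diff_divide_distrib)
  also have "real N / real n * (\<theta> * \<theta>) = real N / real k"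
    unfolding t using n by simp
  finally show ?thesis .
qed

lemma block_mean_bounds:
  assumes k: "0 < k" "k \<le> N" and n: "0 < n" and c: "0 < c"
  shows "block_mean N k n \<le> block N k n c" "block N k n c \<le> block_mean N k n + real N / real k * c"
proof -
  define \<theta> where "\<theta> = sqrt (real n / real k)"
  have t: "0 < \<theta>" "\<theta> * \<theta> = real n / real k" using k n by (auto simp: \<theta>_def)
  have bm: "block_mean N k n = real N / real n * \<theta> * (topmean N k / real N)"
    using k n real_sqrt_mult_self[of "real n"] by (simp add: block_mean_def \<theta>_def real_sqrt_divide field_simps)
  show "block_mean N k n \<le> block N k n c"
    unfolding bm block_def \<theta>_def[symmetric] using t c k by (intro mult_left_mono rate_mean) auto
  have "block N k n c \<le> real N / real n * \<theta> * (topmean N k / real N + c * \<theta>)"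
    unfolding block_def \<theta>_def[symmetric] using t c k by (intro mult_left_mono rate_mean) auto
  also have "\<dots> = block_mean N k n + real N / real n * (\<theta> * \<theta>) * c"
    unfolding bm by (simp add: algebra_simps)
  also have "real N / real n * (\<theta> * \<theta>) = real N / real k"
    unfolding t using n by simp
  finally show "block N k n c \<le> block_mean N k n + real N / real k * c" .
qed

definition block_objective :: "real \<Rightarrow> real \<Rightarrow> real \<Rightarrow> real \<Rightarrow> real" where
  "block_objective a b c \<nu> = a / c * ln (I2 c \<nu> b) + \<nu> * sqrt b"

definition block_lim :: "real \<Rightarrow> real \<Rightarrow> real \<Rightarrow> real" where
  "block_lim a b c = a * (1 / sqrt b) * rate_lim (b / a) (c * (1 / sqrt b))"

text \<open>The last two claims say that \<open>block_lim\<close> is the infimum of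
  \<open>block_objective\<close> over \<open>\<nu>\<close>. They are kept in this approximating form
  for the later merging of two such infima.\<close>

lemma block_tendsto:
  fixes N k :: "nat \<Rightarrow> nat"
  assumes k: "\<And>n. 1 \<le> n \<Longrightarrow> 0 < k n \<and> k n \<le> N n"
    and a: "(\<lambda>n. real (N n) / real n) \<longlonglongrightarrow> a" and b: "(\<lambda>n. real (k n) / real n) \<longlonglongrightarrow> b" "0 < b" and c: "0 < c"
  shows "(\<lambda>n. block (N n) (k n) n c) \<longlonglongrightarrow> block_lim a b c"
    and "block_lim a b c \<le> block_objective a b c \<nu>"
    and "0 < e \<Longrightarrow> \<exists>\<nu>. block_objective a b c \<nu> < block_lim a b c + e"
proof -
  have ev: "\<forall>\<^sub>F n in sequentially. 0 < n \<and> 0 < k n \<and> k n \<le> N n"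
    using eventually_ge_at_top[of 1] by eventually_elim (use k in auto)
  have ab: "b \<le> a"
    by (rule tendsto_le[OF _ a b(1)]) (use ev in \<open>auto elim!: eventually_mono intro: divide_right_mono\<close>)
  then have a0: "0 < a" using b by simp
  define \<theta> where "\<theta> = 1 / sqrt b"
  have th: "0 < \<theta>" using b by (simp add: \<theta>_def)
  have q: "(\<lambda>n. real (k n) / real (N n)) \<longlonglongrightarrow> b / a"
  proof (rule Lim_transform_eventually)
    show "(\<lambda>n. (real (k n) / real n) / (real (N n) / real n)) \<longlonglongrightarrow> b / a"
      using a0 by (intro tendsto_intros a b) auto
    show "\<forall>\<^sub>F n in sequentially. real (k n) / real n / (real (N n) / real n) = real (k n) / real (N n)"
      using ev by eventually_elim simp
  qed
  have N: "filterlim N at_top sequentially"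
  proof -
    have fl: "filterlim (\<lambda>n. real (N n) / real n * real n) at_top sequentially"
      by (rule filterlim_tendsto_pos_mult_at_top[OF a a0 filterlim_real_sequentially])
    have eq: "\<forall>\<^sub>F n in sequentially. real (N n) / real n * real n = real (N n)"
      using ev by eventually_elim simp
    have "filterlim (\<lambda>n. real (N n)) at_top sequentially"
      by (rule filterlim_cong[OF refl refl eq, THEN iffD1, OF fl])
    then show ?thesis by (simp add: filterlim_sequentially_iff_filterlim_real)
  qed
  have t: "(\<lambda>n. sqrt (real n / real (k n))) \<longlonglongrightarrow> \<theta>"
  proof (rule Lim_transform_eventually)
    have "(\<lambda>n. sqrt (1 / (real (k n) / real n))) \<longlonglongrightarrow> sqrt (1 / b)"
      using b by (intro tendsto_intros) auto
    then show "(\<lambda>n. sqrt (1 / (real (k n) / real n))) \<longlonglongrightarrow> \<theta>"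
      by (simp add: \<theta>_def real_sqrt_divide)
    show "\<forall>\<^sub>F n in sequentially. sqrt (1 / (real (k n) / real n)) = sqrt (real n / real (k n))"
      by simp
  qed
  have ct: "0 < c * \<theta>" using c th by simp
  have q1: "0 < b / a" "b / a \<le> 1" using a0 b ab by auto
  have l_def: "block_lim a b c = a * \<theta> * rate_lim (b / a) (c * \<theta>)"
    by (simp add: block_lim_def \<theta>_def)
  have obj: "a * \<theta> * (b / a * \<nu> + ln (plus_mgf (c * \<theta>) \<nu>) / (c * \<theta>)) = block_objective a b c \<nu>" for \<nu>
  proof -
    have "a * \<theta> * (b / a * \<nu> + ln (plus_mgf (c * \<theta>) \<nu>) / (c * \<theta>)) = \<theta> * b * \<nu> + a / c * ln (plus_mgf (c * \<theta>) \<nu>)"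
      using a0 th c by (simp add: field_simps)
    also have "\<theta> * b = sqrt b" using b by (simp add: \<theta>_def real_div_sqrt)
    finally show ?thesis by (simp add: block_objective_def I2_eq_plus_mgf \<theta>_def)
  qed
  show "(\<lambda>n. block (N n) (k n) n c) \<longlonglongrightarrow> block_lim a b c"
    unfolding block_def l_def
  proof (intro tendsto_mult a t rate_tendsto N q tendsto_const)
    show "\<forall>\<^sub>F n in sequentially. 0 < k n \<and> k n \<le> N n"
      using ev by eventually_elim simp
  qed (use q1 ct in auto)
  show "block_lim a b c \<le> block_objective a b c \<nu>"
    unfolding l_def obj[symmetric] using a0 th q1 ct by (intro mult_left_mono rate_lim_le) auto
  assume e: "0 < e"
  have at: "0 < a * \<theta>" using a0 th by simp
  obtain \<nu> where "b / a * \<nu> + ln (plus_mgf (c * \<theta>) \<nu>) / (c * \<theta>) < rate_lim (b / a) (c * \<theta>) + e / (a * \<theta>)"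
    using rate_lim_approx[of "c * \<theta>" "b / a" "rate_lim (b / a) (c * \<theta>) + e / (a * \<theta>)"] q1 ct e at by auto
  from mult_strict_left_mono[OF this at]
  have "block_objective a b c \<nu> < block_lim a b c + a * \<theta> * (e / (a * \<theta>))"
    unfolding obj l_def distrib_left[of _ "rate_lim (b / a) (c * \<theta>)"] .
  also have "a * \<theta> * (e / (a * \<theta>)) = e"
    using at by (metis less_irrefl nonzero_mult_div_cancel_left times_divide_eq_right)
  finally show "\<exists>\<nu>. block_objective a b c \<nu> < block_lim a b c + e" by blast
qed

subsection \<open>The limits\<close>

text \<open>For fixed \<open>c\<close> the two levels vary independently, so the iterated infima
  form one joint infimum. The bound \<open>lower\<close> keeps all these real infima bounded
  below.\<close>

lemma block_sum_INF_eq: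
  fixes l1 l2 :: "real \<Rightarrow> real" and o1 o2 :: "real \<Rightarrow> real \<Rightarrow> real"
  assumes lower: "\<And>c. 0 < c \<Longrightarrow> c / 2 \<le> - c / 2 + l1 c + l2 c"
    and l1: "\<And>c \<nu>. 0 < c \<Longrightarrow> l1 c \<le> o1 c \<nu>" "\<And>c e. 0 < c \<Longrightarrow> 0 < e \<Longrightarrow> \<exists>\<nu>. o1 c \<nu> < l1 c + e"
    and l2: "\<And>c \<nu>. 0 < c \<Longrightarrow> l2 c \<le> o2 c \<nu>" "\<And>c e. 0 < c \<Longrightarrow> 0 < e \<Longrightarrow> \<exists>\<nu>. o2 c \<nu> < l2 c + e"
  shows "(INF c\<in>{0<..}. - c / 2 + l1 c + l2 c)
    = (INF (c, \<nu>1, \<nu>2)\<in>{0<..} \<times> UNIV \<times> UNIV. - c / 2 + o1 c \<nu>1 + o2 c \<nu>2)"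
    (is "?V = ?W")
proof (rule antisym)
  have bddV: "bdd_below ((\<lambda>c. - c / 2 + l1 c + l2 c) ` {0<..})"
  proof (rule bdd_belowI2[where m = 0])
    fix c :: real assume "c \<in> {0<..}"
    then have c: "0 < c" by simp
    show "0 \<le> - c / 2 + l1 c + l2 c" using lower[OF c] c by linarith
  qed
  have obj: "- c / 2 + l1 c + l2 c \<le> - c / 2 + o1 c \<nu>1 + o2 c \<nu>2" if "0 < c" for c \<nu>1 \<nu>2
    using l1(1)[OF that, of \<nu>1] l2(1)[OF that, of \<nu>2] by linarith
  have bddW: "bdd_below ((\<lambda>(c, \<nu>1, \<nu>2). - c / 2 + o1 c \<nu>1 + o2 c \<nu>2) ` ({0<..} \<times> UNIV \<times> UNIV))"
  proof (rule bdd_belowI2[where m = 0])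
    fix t :: "real \<times> real \<times> real" assume t: "t \<in> {0<..} \<times> UNIV \<times> UNIV"
    obtain c \<nu>1 \<nu>2 where tt: "t = (c, \<nu>1, \<nu>2)" by (cases t)
    with t have "0 < c" by simp
    from lower[OF this] obj[OF this, of \<nu>1 \<nu>2] this show "0 \<le> (case t of (c, \<nu>1, \<nu>2) \<Rightarrow> - c / 2 + o1 c \<nu>1 + o2 c \<nu>2)"
      unfolding tt prod.case by linarith
  qed
  show "?V \<le> ?W"
  proof (rule cINF_greatest)
    fix t :: "real \<times> real \<times> real" assume t: "t \<in> {0<..} \<times> UNIV \<times> UNIV"
    obtain c \<nu>1 \<nu>2 where tt: "t = (c, \<nu>1, \<nu>2)" by (cases t)
    with t have c: "0 < c" by simp
    have "?V \<le> - c / 2 + l1 c + l2 c"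
      using c by (intro cINF_lower bddV) simp
    then show "?V \<le> (case t of (c, \<nu>1, \<nu>2) \<Rightarrow> - c / 2 + o1 c \<nu>1 + o2 c \<nu>2)"
      using obj[OF c, of \<nu>1 \<nu>2] unfolding tt prod.case by linarith
  qed (auto intro: exI[of _ 1])
  show "?W \<le> ?V"
  proof (rule cINF_greatest)
    fix c :: real assume "c \<in> {0<..}"
    then have c: "0 < c" by simp
    show "?W \<le> - c / 2 + l1 c + l2 c"
    proof (rule field_le_epsilon)
      fix e :: real assume e: "0 < e"
      obtain \<nu>1 \<nu>2 where v: "o1 c \<nu>1 < l1 c + e / 2" "o2 c \<nu>2 < l2 c + e / 2"
        using l1(2)[OF c, of "e / 2"] l2(2)[OF c, of "e / 2"] e by auto
      have "?W \<le> (case (c, \<nu>1, \<nu>2) of (c, \<nu>1, \<nu>2) \<Rightarrow> - c / 2 + o1 c \<nu>1 + o2 c \<nu>2)"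
        using c by (intro cINF_lower[OF bddW]) simp
      then show "?W \<le> - c / 2 + l1 c + l2 c + e"
        using v unfolding prod.case by linarith
    qed
  qed simp
qed

lemma gaussian_data_mgf:
  assumes d: "gaussian_data M m n h g A" and n: "1 \<le> n" and k1: "0 < k1" "k1 \<le> m" and k2: "0 < k2" "k2 \<le> n"
  shows "(\<integral>\<omega>. exp (c * lin_max m k1 (\<lambda>i. h i \<omega>)) \<partial>M) = mgf m k1 (c / sqrt (real k1))"
    and "(\<integral>\<omega>. exp (c * lin_max n k2 (\<lambda>j. g j \<omega>)) \<partial>M) = mgf n k2 (c / sqrt (real k2))"
proof -
  have m1: "(\<lambda>x. exp (c / sqrt (real k1) * topsum m k1 x)) \<in> borel_measurable (gprod {1..m})"
    and m2: "(\<lambda>x. exp (c / sqrt (real k2) * topsum n k2 x)) \<in> borel_measurable (gprod {1..n})"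
    by measurable
  show "(\<integral>\<omega>. exp (c * lin_max m k1 (\<lambda>i. h i \<omega>)) \<partial>M) = mgf m k1 (c / sqrt (real k1))"
    using gaussian_data_marginals(1)[OF d n m1] unfolding topsum_restrict mgf_def lin_max_eq[OF k1] by simp
  show "(\<integral>\<omega>. exp (c * lin_max n k2 (\<lambda>j. g j \<omega>)) \<partial>M) = mgf n k2 (c / sqrt (real k2))"
    using gaussian_data_marginals(3)[OF d n m2] unfolding topsum_restrict mgf_def lin_max_eq[OF k2] by simp
qed

text \<open>Multiplication by \<open>sqrt n\<close> is a bijection of the positive half-line, so
  substituting \<open>sqrt n * c\<close> leaves the infimum unchanged and brings out a factor
  \<open>sqrt n\<close>.\<close>

lemma lifted_bound_eq:
  assumes d: "gaussian_data M m n h g A" and n: "1 \<le> n" and k1: "0 < k1" "k1 \<le> m" and k2: "0 < k2" "k2 \<le> n"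
  shows "sqrt (real n) * lifted_bound M m n k1 k2 h g
    = real n / sqrt (real k1 * real k2) * (INF c\<in>{0<..}. - c / 2 + block m k1 n c + block n k2 n c)"
proof -
  let ?F = "\<lambda>c. - c / 2 + 1 / c * ln (mgf m k1 (c / sqrt (real k1))) + 1 / c * ln (mgf n k2 (c / sqrt (real k2)))"
  let ?H = "\<lambda>c. - c / 2 + block m k1 n c + block n k2 n c"
  have sn: "0 < sqrt (real n)" "sqrt (real n) * sqrt (real n) = real n" using n by auto
  have scale: "?F (sqrt (real n) * c) = sqrt (real n) * ?H c" if c: "0 < c" for c
  proof -
    have b: "1 / (sqrt (real n) * c) * ln (mgf N k (sqrt (real n) * c / sqrt (real k))) = sqrt (real n) * block N k n c"
      if "0 < k" "k \<le> N" for N k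
    proof -
      have "sqrt (real n) * c / sqrt (real k) = c * sqrt (real n / real k)"
        by (simp add: real_sqrt_divide)
      moreover have "1 / (sqrt (real n) * c) = sqrt (real n) / (real n * c)"
        using sn c n by (simp add: field_simps)
      ultimately show ?thesis
        using block_eq[OF that, of n c] n by simp
    qed
    show ?thesis unfolding b[OF k1] b[OF k2] by (simp add: algebra_simps)
  qed
  have img: "(\<lambda>c. sqrt (real n) * c) ` {0<..} = {0<..}"
  proof (intro equalityI subsetI)
    fix x :: real assume "x \<in> {0<..}"
    then show "x \<in> (\<lambda>c. sqrt (real n) * c) ` {0<..}"
      using sn by (intro image_eqI[of _ _ "x / sqrt (real n)"]) auto
  qed (use sn in auto)
  have "(INF c\<in>{0<..}. ?F c) = (INF c\<in>{0<..}. ?F (sqrt (real n) * c))"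
    by (subst img[symmetric], subst image_image) simp
  also have "\<dots> = (INF c\<in>{0<..}. sqrt (real n) * ?H c)"
    using scale by (intro INF_cong refl) auto
  also have "\<dots> = sqrt (real n) * (INF c\<in>{0<..}. ?H c)"
  proof (intro real_INF_mult sn bdd_belowI2[where m = 0])
    fix c :: real assume "c \<in> {0<..}"
    then have c: "0 < c" by simp
    show "0 \<le> ?H c"
      using block_ge[OF k1 _ c, of n] block_ge[OF k2 _ c, of n] n c by simp
  qed auto
  finally have F: "(INF c\<in>{0<..}. ?F c) = sqrt (real n) * (INF c\<in>{0<..}. ?H c)" .
  show ?thesis
    unfolding lifted_bound_def gaussian_data_mgf[OF d n k1 k2] F
    using sn(2) by (simp add: mult.assoc[symmetric])
qed

text \<open>The comparison holds for every finite \<open>n\<close>. Of the prefactor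
  \<open>1 / (k1 * k2)\<close> one square root normalises the bilinear process and the other is the
  prefactor of \<open>lifted_bound\<close>.\<close>

lemma expectation_submatrix_avg_le:
  assumes d: "gaussian_data M m n h g A" and n: "1 \<le> n" and k1: "0 < k1" "k1 \<le> m" and k2: "0 < k2" "k2 \<le> n"
  shows "(\<integral>\<omega>. submatrix_avg m n k1 k2 (\<lambda>i j. A i j \<omega>) \<partial>M) \<le> lifted_bound M m n k1 k2 h g"
proof -
  let ?w = "sqrt (real k1 * real k2)" and ?P = "\<integral>x. pairmax m n k1 k2 x \<partial>gprod ({1..m} \<times> {1..n})"
  have "(\<integral>\<omega>. submatrix_avg m n k1 k2 (\<lambda>i j. A i j \<omega>) \<partial>M) = 1 / (real k1 * real k2) * ?P"
    using gaussian_data_marginals(5)[OF d n pairmax_measurable, of k1 k2]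
    unfolding pairmax_restrict submatrix_avg_eq by simp
  also have "real k1 * real k2 = ?w * ?w" by simp
  also have "1 / (?w * ?w) * ?P = 1 / ?w * (?P / ?w)" by simp
  also have "\<dots> \<le> lifted_bound M m n k1 k2 h g"
    unfolding lifted_bound_def gaussian_data_mgf[OF d n k1 k2]
    by (intro mult_left_mono cINF_greatest pairmax_mean_le k1 k2) auto
  finally show ?thesis .
qed

lemma expectation_lin_bound:
  assumes d: "gaussian_data M m n h g A" and n: "1 \<le> n" and k1: "0 < k1" "k1 \<le> m" and k2: "0 < k2" "k2 \<le> n"
  shows "(\<integral>\<omega>. lin_bound m n k1 k2 (\<lambda>i. h i \<omega>) (\<lambda>j. g j \<omega>) \<partial>M) * sqrt (real n)
    = real n / sqrt (real k1 * real k2) * (block_mean m k1 n + block_mean n k2 n)"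
proof -
  note marg = gaussian_data_marginals[OF d n]
  have i1: "integrable M (\<lambda>\<omega>. topsum m k1 (\<lambda>i. h i \<omega>))"
    using marg(2)[OF topsum_measurable, of k1] topsum_integrable(1)[OF k1(2)] unfolding topsum_restrict by blast
  have i2: "integrable M (\<lambda>\<omega>. topsum n k2 (\<lambda>i. g i \<omega>))"
    using marg(4)[OF topsum_measurable, of k2] topsum_integrable(1)[OF k2(2)] unfolding topsum_restrict by blast
  have e1: "(\<integral>\<omega>. topsum m k1 (\<lambda>i. h i \<omega>) \<partial>M) = topmean m k1"
    using marg(1)[OF topsum_measurable, of k1] unfolding topsum_restrict topmean_def .
  have e2: "(\<integral>\<omega>. topsum n k2 (\<lambda>i. g i \<omega>) \<partial>M) = topmean n k2"
    using marg(3)[OF topsum_measurable, of k2] unfolding topsum_restrict topmean_def .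
  have "x / sqrt (real k) * sqrt (real n) = real n * (x / (sqrt (real k) * sqrt (real n)))" for x and k :: nat
  proof -
    have "x / q * s = (s * s) * (x / (q * s))" if "s \<noteq> 0" for q s :: real
      using that by simp
    from this[of "sqrt (real n)" "sqrt (real k)"] show ?thesis using n by simp
  qed
  then have "1 / w * (x / sqrt (real k1) + y / sqrt (real k2)) * sqrt (real n)
      = real n / w * (x / (sqrt (real k1) * sqrt (real n)) + y / (sqrt (real k2) * sqrt (real n)))" for w x y
    by (simp only: mult.assoc distrib_right) (simp add: distrib_left)
  moreover have "(\<integral>\<omega>. lin_bound m n k1 k2 (\<lambda>i. h i \<omega>) (\<lambda>j. g j \<omega>) \<partial>M)
     = 1 / sqrt (real k1 * real k2) * (topmean m k1 / sqrt (real k1) + topmean n k2 / sqrt (real k2))"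
    unfolding lin_bound_eq[OF k1 k2] using i1 i2 by (simp add: e1 e2)
  ultimately show ?thesis
    unfolding block_mean_def by (simp only:)
qed

text \<open>The data for different \<open>n\<close> may be unrelated, as only their laws for each
  \<open>n\<close> enter. The bound for \<open>E\<xi>\<close> uses \<open>limsup\<close> and
  therefore covers the limit whenever it exists; the minimum on the right appears as an infimum for
  the same reason as in \<open>lifted_bound\<close>.\<close>

theorem theorem6:
  fixes m k1 k2 :: "nat \<Rightarrow> nat"
    and \<alpha> \<beta>1 \<beta>2 :: real
    and M :: "nat \<Rightarrow> 'a measure"
    and h g :: "nat \<Rightarrow> nat \<Rightarrow> 'a \<Rightarrow> real"
    and A :: "nat \<Rightarrow> nat \<Rightarrow> nat \<Rightarrow> 'a \<Rightarrow> real"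
  assumes k1: "\<And>n. n \<ge> 1 \<Longrightarrow> 1 \<le> k1 n \<and> k1 n \<le> m n"
    and k2: "\<And>n. n \<ge> 1 \<Longrightarrow> 1 \<le> k2 n \<and> k2 n \<le> n"
    and alpha: "(\<lambda>n. real (m n) / real n) \<longlonglongrightarrow> \<alpha>"
    and beta1: "(\<lambda>n. real (k1 n) / real n) \<longlonglongrightarrow> \<beta>1" "\<beta>1 > 0"
    and beta2: "(\<lambda>n. real (k2 n) / real n) \<longlonglongrightarrow> \<beta>2" "\<beta>2 > 0"
    and data: "\<And>n. n \<ge> 1 \<Longrightarrow> gaussian_data (M n) (m n) n (h n) (g n) (A n)"
  defines "L2 \<equiv> \<lambda>n. lifted_bound (M n) (m n) n (k1 n) (k2 n) (h n) (g n)"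
    and "EL \<equiv> \<lambda>n. \<integral>\<omega>. lin_bound (m n) n (k1 n) (k2 n) (\<lambda>i. h n i \<omega>) (\<lambda>j. g n j \<omega>) \<partial>M n"
    and "E\<xi> \<equiv> \<lambda>n. \<integral>\<omega>. submatrix_avg (m n) n (k1 n) (k2 n) (\<lambda>i j. A n i j \<omega>) \<partial>M n"
  shows "(\<lambda>n. sqrt (real n) * L2 n) \<longlonglongrightarrow>
           1 / sqrt (\<beta>1 * \<beta>2) *
           (INF (c, \<nu>1, \<nu>2)\<in>{0<..} \<times> UNIV \<times> UNIV.
              - c / 2
              + \<alpha> / c * ln (I2 c \<nu>1 \<beta>1) + \<nu>1 * sqrt \<beta>1
              + 1 / c * ln (I2 c \<nu>2 \<beta>2) + \<nu>2 * sqrt \<beta>2)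
         \<and> convergent (\<lambda>n. EL n * sqrt (real n))
         \<and> limsup (\<lambda>n. ereal (E\<xi> n * sqrt (real n))) \<le> ereal (lim (\<lambda>n. L2 n * sqrt (real n)))
         \<and> lim (\<lambda>n. L2 n * sqrt (real n)) \<le> lim (\<lambda>n. EL n * sqrt (real n))"
proof -
  \<comment> \<open>\<open>C n * V n\<close> is the scaled \<open>L2 n\<close> and
    \<open>C n * B n\<close> the scaled \<open>EL n\<close>, so only the infimum \<open>V\<close>
    and the mean \<open>B\<close> have to be compared.\<close>
  define H where "H n c = - c / 2 + block (m n) (k1 n) n c + block n (k2 n) n c" for n c
  define V where "V n = (INF c\<in>{0<..}. H n c)" for n
  define C where "C n = real n / sqrt (real (k1 n) * real (k2 n))" for n
  define B where "B n = block_mean (m n) (k1 n) n + block_mean n (k2 n) n" for n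
  have K1: "0 < k1 n" "k1 n \<le> m n" and K2: "0 < k2 n" "k2 n \<le> n" if "1 \<le> n" for n
    using k1[OF that] k2[OF that] by auto
  have ev: "\<forall>\<^sub>F n in sequentially. 1 \<le> n" by (rule eventually_ge_at_top)
  have one: "(\<lambda>n. real n / real n) \<longlonglongrightarrow> 1"
    by (rule tendsto_eventually) (use ev in \<open>eventually_elim, simp\<close>)
  define l1 where "l1 = block_lim \<alpha> \<beta>1"
  define l2 where "l2 = block_lim 1 \<beta>2"
  note l1 = block_tendsto[where N = m and k = k1, OF conjI[OF K1] alpha beta1, folded l1_def]
  \<comment> \<open>The column vector has length \<open>n\<close> itself, so its length ratio is 1
    in place of \<open>\<alpha>\<close>.\<close>
  note l2 = block_tendsto[where N = "\<lambda>n. n" and k = k2, OF conjI[OF K2] one beta2, folded l2_def]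
  have Hlim: "(\<lambda>n. H n c) \<longlonglongrightarrow> - c / 2 + l1 c + l2 c" if "0 < c" for c
    unfolding H_def by (intro tendsto_intros l1 l2 that)
  have Hge: "c / 2 \<le> H n c" if "1 \<le> n" "0 < c" for n c
    using block_ge[OF K1[OF that(1)] _ that(2), of n] block_ge[OF K2[OF that(1)] _ that(2), of n] that by (simp add: H_def)
  have ratio: "(\<lambda>n. real (m n) / real (k1 n)) \<longlonglongrightarrow> \<alpha> / \<beta>1" "(\<lambda>n. real n / real (k2 n)) \<longlonglongrightarrow> 1 / \<beta>2"
  proof -
    have "(\<lambda>n. real (m n) / real n / (real (k1 n) / real n)) \<longlonglongrightarrow> \<alpha> / \<beta>1"
      using beta1 by (intro tendsto_intros alpha) auto
    then show "(\<lambda>n. real (m n) / real (k1 n)) \<longlonglongrightarrow> \<alpha> / \<beta>1"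
      by (rule Lim_transform_eventually) (use ev in \<open>eventually_elim, simp\<close>)
    have "(\<lambda>n. real n / real n / (real (k2 n) / real n)) \<longlonglongrightarrow> 1 / \<beta>2"
      using beta2 by (intro tendsto_intros one) auto
    then show "(\<lambda>n. real n / real (k2 n)) \<longlonglongrightarrow> 1 / \<beta>2"
      by (rule Lim_transform_eventually) (use ev in \<open>eventually_elim, simp\<close>)
  qed
  define R where "R n = real (m n) / real (k1 n) + real n / real (k2 n)" for n
  \<comment> \<open>The added 1 makes \<open>r\<close> a strict eventual upper bound for
    \<open>R n\<close>, uniform in \<open>n\<close>.\<close>
  define r where "r = \<alpha> / \<beta>1 + 1 / \<beta>2 + 1"
  have R: "\<forall>\<^sub>F n in sequentially. R n < r"
    unfolding R_def by (rule order_tendstoD(2)[OF tendsto_add[OF ratio]]) (simp add: r_def)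
  have Hlip: "\<forall>\<^sub>F n in sequentially. \<forall>c d. 0 < c \<longrightarrow> c \<le> d \<longrightarrow> H n d \<le> H n c + 4 * r * (d - c)"
    using ev R
  proof (eventually_elim, intro allI impI)
    fix n and c d :: real assume n: "1 \<le> n" and Rn: "R n < r" and c: "0 < c" "c \<le> d"
    have "H n d \<le> H n c + 4 * (real (m n) / real (k1 n)) * (d - c) + 4 * (real n / real (k2 n)) * (d - c)"
      using block_lipschitz[OF K1[OF n] _ c, of n] block_lipschitz[OF K2[OF n] _ c, of n] n c unfolding H_def by linarith
    also have "\<dots> = H n c + 4 * R n * (d - c)"
      by (simp add: R_def algebra_simps)
    also have "\<dots> \<le> H n c + 4 * r * (d - c)"
      using Rn c by (intro add_left_mono mult_right_mono) auto
    finally show "H n d \<le> H n c + 4 * r * (d - c)" .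
  qed
  have "V \<longlonglongrightarrow> (INF c\<in>{0<..}. - c / 2 + l1 c + l2 c)"
    unfolding V_def[abs_def]
    by (rule tendsto_INF_grid[OF eventually_mono[OF ev] Hlip Hlim]) (use Hge in blast)+
  also have "(INF c\<in>{0<..}. - c / 2 + l1 c + l2 c)
     = (INF (c, \<nu>1, \<nu>2)\<in>{0<..} \<times> UNIV \<times> UNIV. - c / 2 + block_objective \<alpha> \<beta>1 c \<nu>1 + block_objective 1 \<beta>2 c \<nu>2)"
  proof (rule block_sum_INF_eq)
    show "c / 2 \<le> - c / 2 + l1 c + l2 c" if "0 < c" for c
      by (rule tendsto_lowerbound[OF Hlim[OF that] eventually_mono[OF ev]]) (use Hge that in auto)
  qed (use l1 l2 in auto)
  also have "\<dots> = (INF (c, \<nu>1, \<nu>2)\<in>{0<..} \<times> UNIV \<times> UNIV.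
              - c / 2
              + \<alpha> / c * ln (I2 c \<nu>1 \<beta>1) + \<nu>1 * sqrt \<beta>1
              + 1 / c * ln (I2 c \<nu>2 \<beta>2) + \<nu>2 * sqrt \<beta>2)" (is "_ = ?W")
    by (simp only: block_objective_def add.assoc[symmetric])
  finally have V: "V \<longlonglongrightarrow> ?W" .
  have C: "C \<longlonglongrightarrow> 1 / sqrt (\<beta>1 * \<beta>2)"
  proof (rule Lim_transform_eventually)
    show "(\<lambda>n. 1 / sqrt (real (k1 n) / real n * (real (k2 n) / real n))) \<longlonglongrightarrow> 1 / sqrt (\<beta>1 * \<beta>2)"
      using beta1 beta2 by (intro tendsto_intros) auto
    show "\<forall>\<^sub>F n in sequentially. 1 / sqrt (real (k1 n) / real n * (real (k2 n) / real n)) = C n"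
      using ev
    proof eventually_elim
      case (elim n)
      have "real (k1 n) / real n * (real (k2 n) / real n) = real (k1 n) * real (k2 n) / (real n)\<^sup>2"
        by (simp add: power2_eq_square)
      then show ?case by (simp add: C_def real_sqrt_divide)
    qed
  qed
  have L2: "sqrt (real n) * L2 n = C n * V n" if "1 \<le> n" for n
    unfolding L2_def C_def V_def H_def by (rule lifted_bound_eq[OF data[OF that] that K1[OF that] K2[OF that]])
  have lim1: "(\<lambda>n. sqrt (real n) * L2 n) \<longlonglongrightarrow> 1 / sqrt (\<beta>1 * \<beta>2) * ?W"
    by (rule Lim_transform_eventually[OF tendsto_mult[OF C V] eventually_mono[OF ev]]) (use L2 in auto)
  then have lim2: "(\<lambda>n. L2 n * sqrt (real n)) \<longlonglongrightarrow> 1 / sqrt (\<beta>1 * \<beta>2) * ?W"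
    by (simp add: mult.commute)
  have EL: "EL n * sqrt (real n) = C n * B n" if "1 \<le> n" for n
    unfolding EL_def C_def B_def by (rule expectation_lin_bound[OF data[OF that] that K1[OF that] K2[OF that]])
  \<comment> \<open>\<open>H n c + c / 2\<close> is the sum of the two blocks, each of which exceeds
    its mean by at most its length ratio times \<open>c\<close>.\<close>
  have Bbd: "B n \<le> H n c + c / 2" "H n c + c / 2 \<le> B n + R n * c" if "1 \<le> n" "0 < c" for n c
    using block_mean_bounds[OF K1[OF that(1)] _ that(2), of n] block_mean_bounds[OF K2[OF that(1)] _ that(2), of n] that
    unfolding B_def H_def R_def distrib_right by linarith+
  have "convergent B"
  proof (rule convergent_sandwich[where y = "\<lambda>c n. H n c + c / 2" and K = r])
    fix c :: real assume c: "0 < c"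
    show "\<forall>\<^sub>F n in sequentially. B n \<le> H n c + c / 2 \<and> H n c + c / 2 \<le> B n + r * c"
      using ev R
    proof eventually_elim
      case (elim n)
      have "R n * c \<le> r * c" using elim c by (intro mult_right_mono) auto
      then show ?case using Bbd[OF elim(1) c] by linarith
    qed
    show "convergent (\<lambda>n. H n c + c / 2)"
      using tendsto_add[OF Hlim[OF c] tendsto_const[of "c / 2"]] by (rule convergentI)
  qed
  then obtain b where b: "B \<longlonglongrightarrow> b" by (auto simp: convergent_def)
  have limEL: "(\<lambda>n. EL n * sqrt (real n)) \<longlonglongrightarrow> 1 / sqrt (\<beta>1 * \<beta>2) * b"
    by (rule Lim_transform_eventually[OF tendsto_mult[OF C b] eventually_mono[OF ev]]) (use EL in auto)
  have VB: "V n \<le> B n" if n: "1 \<le> n" for n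
  proof (rule field_le_epsilon)
    fix e :: real assume e: "0 < e"
    \<comment> \<open>A small \<open>c\<close> makes \<open>H n c\<close> exceed \<open>B n\<close>
      by at most \<open>e\<close>; the 1 in the denominator guards against division by zero.\<close>
    define c where "c = e / (R n + 1)"
    have R0: "0 \<le> R n" by (simp add: R_def)
    have c: "0 < c" "R n * c \<le> e"
    proof -
      show "0 < c" using R0 e by (simp add: c_def)
      have "R n * c \<le> (R n + 1) * c" using \<open>0 < c\<close> by simp
      also have "\<dots> = e" using R0 by (simp add: c_def)
      finally show "R n * c \<le> e" .
    qed
    have "bdd_below (H n ` {0<..})"
    proof (rule bdd_belowI2[where m = 0])
      fix c :: real assume "c \<in> {0<..}"
      then have c: "0 < c" by simp
      show "0 \<le> H n c" using Hge[OF n c] c by linarith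
    qed
    then have "V n \<le> H n c"
      unfolding V_def using c by (intro cINF_lower) auto
    then show "V n \<le> B n + e" using Bbd(2)[OF n c(1)] c by linarith
  qed
  have "lim (\<lambda>n. L2 n * sqrt (real n)) \<le> lim (\<lambda>n. EL n * sqrt (real n))"
    unfolding limI[OF lim2] limI[OF limEL]
  proof (rule tendsto_le[OF _ limEL lim2])
    show "\<forall>\<^sub>F n in sequentially. L2 n * sqrt (real n) \<le> EL n * sqrt (real n)"
      using ev
    proof eventually_elim
      case (elim n)
      then show ?case
        using L2[OF elim] EL[OF elim] mult_left_mono[OF VB[OF elim], of "C n"] by (simp add: C_def mult.commute)
    qed
  qed simp
  moreover have "limsup (\<lambda>n. ereal (E\<xi> n * sqrt (real n))) \<le> ereal (lim (\<lambda>n. L2 n * sqrt (real n)))"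
  proof -
    have "limsup (\<lambda>n. ereal (E\<xi> n * sqrt (real n))) \<le> limsup (\<lambda>n. ereal (L2 n * sqrt (real n)))"
    proof (rule Limsup_mono)
      show "\<forall>\<^sub>F n in sequentially. ereal (E\<xi> n * sqrt (real n)) \<le> ereal (L2 n * sqrt (real n))"
        using ev
      proof eventually_elim
        case (elim n)
        have "E\<xi> n \<le> L2 n"
          unfolding E\<xi>_def L2_def by (rule expectation_submatrix_avg_le[OF data[OF elim] elim K1[OF elim] K2[OF elim]])
        then show ?case by (simp add: mult_right_mono)
      qed
    qed
    also have "\<dots> = ereal (lim (\<lambda>n. L2 n * sqrt (real n)))"
      unfolding limI[OF lim2] by (intro lim_imp_Limsup tendsto_intros lim2) simp
    finally show ?thesis .
  qed
  moreover have "convergent (\<lambda>n. EL n * sqrt (real n))"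
    using limEL by (rule convergentI)
  ultimately show ?thesis using lim1 by blast
qed

end
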